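(* Let $A\in\mathcal M$ be an arbitrary pointed simplicial presheaf and $n\ge1$ an arbitrary integer. Then: (1) The following tower is functorial (in $A$) in $\mathcal M$: $$\varprojlim \tau_n(A)\to\cdots\xrightarrow{\nu_{n+1}^A}\tau_{n+1}(A)\xrightarrow{\nu_n^A}\tau_n(A)\xrightarrow{\nu_{n-1}^A}\cdots\xrightarrow{\nu_2^A}\tau_2(A)\xrightarrow{\nu_1^A}\tau_1(A)\to *,$$ together with the compatible maps $\tau_{\le n}^A:A\to\tau_n(A)$ (so $\nu_n^A\circ\tau_{\le n+1}^A=\tau_{\le n}^A$) and the induced map $A\to\varprojlim\tau_n(A)$. (2) The following tower is functorial in $\mathcal H$: $$\mathrm{ho}\!\varprojlim t_n(A)\to\cdots\xrightarrow{\nu_{n+1}^A}t_{n+1}(A)\xrightarrow{\nu_n^A}t_n(A)\xrightarrow{\nu_{n-1}^A}\cdots\xrightarrow{\nu_2^A}t_2(A)\xrightarrow{\nu_1^A}t_1(A)\to *,$$ together with the compatible maps $\tau_{\le n}^A:A\to t_n(A)$ and the map $A\to \mathrm{ho}\!\varprojlim t_n(A)$. (3) $\tau_{\le n}^A$ is a weak equivalence in $WB_{n-1}\mathcal M$, and $\nu_n^A$ (resp. $t_1(A)\to *$) is a fibration in $WB_n\mathcal M$ (resp. $WB_0\mathcal M$).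
   Context: $X$ is a Noetherian separated base scheme of finite Krull dimension, and $Sm_X$ is the category of smooth schemes of finite type over $X$, regarded as a site with the Nisnevich topology. Closed subsets are considered as closed subschemes with the reduced structure. $\mathcal M$ is the category of pointed simplicial presheaves on $Sm_X$ with Jardine's motivic (injective) model structure: cofibrations are the monomorphisms and weak equivalences are the motivic ($\mathbb A^1$-local Nisnevich) weak equivalences; $\mathcal H$ is its homotopy category and $\mathrm{Ho}:\mathcal M\to\mathcal H$ the localization functor. For $Y\in Sm_X$, $Y_+$ denotes the presheaf represented by $Y$ with a disjoint base point. For $Z$ closed in $Y$, $codim_Y Z$ is the infimum of $\dim \mathcal O_{Y,z}$ over the generic points $z$ of $Z$ (so it is $\infty$ if $Z=\emptyset$). For $n\ge 0$, $WB_n$ is the set of maps $\iota_{U,Y}:U_+\to Y_+$ induced by open immersions $U\to Y$ with $Y\in Sm_X$ irreducible, $Z=Y\setminus U\in Sm_X$ and $codim_Y Z\ge n+1$; $WB_n\mathcal M$ is the left Bousfield localization of $\mathcal M$ with respect to $WB_n$. The functors $\tau_n:\mathcal M\to\mathcal M$ ($n\ge1$), with natural transformations $\tau_{\le n}:id\to\tau_n$ and $\nu_n:\tau_{n+1}\to\tau_n$, are defined inductively using the functorial factorizations (trivial cofibration followed by fibration): $A\xrightarrow{\tau_{\le 1}^A}\tau_1A\to *$ is the factorization of $A\to *$ in $WB_0\mathcal M$; and given $\tau_{\le n}^A:A\to\tau_nA$, it is factored in $WB_n\mathcal M$ as a trivial cofibration $\tau_{\le n+1}^A:A\to\tau_{n+1}A$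 followed by a fibration $\nu_n^A:\tau_{n+1}A\to\tau_nA$. The functor $t_n:\mathcal H\to\mathcal H$ is the unique functor with $t_n\circ\mathrm{Ho}=\mathrm{Ho}\circ\tau_n$; the object $t_n(A)$ and the maps $\tau_{\le n}^A,\nu_n^A$ in $\mathcal H$ are represented by $\tau_n(A)$ and the maps of the same name in $\mathcal M$, and assertions about fibrations and weak equivalences refer to these representatives. The tower in (2) is called the unstable slice tower. *)

theory Defs
  imports
    "HOL-Algebra.QuotRing"
    "HOL-Algebra.Generated_Rings"
    "HOL-Algebra.Ring_Divisibility"
    "HOL-Homology.Simplices"
    "HOL-Library.Extended_Nat"
begin

section \<open>Categories and functors\<close>

record ('o, 'm) cat =
  Obj :: "'o set"
  Arr :: "'m set"
  Dom :: "'m \<Rightarrow> 'o"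
  Cod :: "'m \<Rightarrow> 'o"
  Idn :: "'o \<Rightarrow> 'm"
  Cmp :: "'m \<Rightarrow> 'm \<Rightarrow> 'm"

text \<open>\<open>Cmp C g f\<close> is \<open>g\<close> after \<open>f\<close>.\<close>

definition homset :: "('o, 'm) cat \<Rightarrow> 'o \<Rightarrow> 'o \<Rightarrow> 'm set" where
  "homset C a b = {f \<in> Arr C. Dom C f = a \<and> Cod C f = b}"

definition category :: "('o, 'm) cat \<Rightarrow> bool" where
  "category C \<longleftrightarrow>
     (\<forall>f\<in>Arr C. Dom C f \<in> Obj C \<and> Cod C f \<in> Obj C) \<and>
     (\<forall>a\<in>Obj C. Idn C a \<in> homset C a a) \<and>
     (\<forall>f\<in>Arr C. \<forall>g\<in>Arr C. Cod C f = Dom C g \<longrightarrow> Cmp C g f \<in> homset C (Dom C f) (Cod C g)) \<and>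
     (\<forall>f\<in>Arr C. Cmp C f (Idn C (Dom C f)) = f \<and> Cmp C (Idn C (Cod C f)) f = f) \<and>
     (\<forall>f\<in>Arr C. \<forall>g\<in>Arr C. \<forall>h\<in>Arr C. Cod C f = Dom C g \<longrightarrow> Cod C g = Dom C h \<longrightarrow>
        Cmp C h (Cmp C g f) = Cmp C (Cmp C h g) f)"

record ('o, 'm, 'p, 'n) func =
  fob :: "'o \<Rightarrow> 'p"
  far :: "'m \<Rightarrow> 'n"

definition is_functor :: "('o, 'm) cat \<Rightarrow> ('p, 'n) cat \<Rightarrow> ('o, 'm, 'p, 'n) func \<Rightarrow> bool" where
  "is_functor C D F \<longleftrightarrow>
     (\<forall>a\<in>Obj C. fob F a \<in> Obj D \<and> far F (Idn C a) = Idn D (fob F a)) \<and>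
     (\<forall>f\<in>Arr C. far F f \<in> homset D (fob F (Dom C f)) (fob F (Cod C f))) \<and>
     (\<forall>f\<in>Arr C. \<forall>g\<in>Arr C. Cod C f = Dom C g \<longrightarrow>
        far F (Cmp C g f) = Cmp D (far F g) (far F f))"

text \<open>Equality of functors on \<open>C\<close>; values outside \<open>C\<close> carry no information.\<close>

definition functor_eq ::
  "('o, 'm) cat \<Rightarrow> ('o, 'm, 'p, 'n) func \<Rightarrow> ('o, 'm, 'p, 'n) func \<Rightarrow> bool" where
  "functor_eq C F G \<longleftrightarrow>
     (\<forall>a\<in>Obj C. fob F a = fob G a) \<and> (\<forall>f\<in>Arr C. far F f = far G f)"

definition id_func :: "('o, 'm, 'o, 'm) func" where
  "id_func = \<lparr>fob = id, far = id\<rparr>"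

definition const_func :: "('p, 'n) cat \<Rightarrow> 'p \<Rightarrow> ('o, 'm, 'p, 'n) func" where
  "const_func D b = \<lparr>fob = \<lambda>_. b, far = \<lambda>_. Idn D b\<rparr>"

definition comp_func ::
  "('p, 'n, 'q, 'k) func \<Rightarrow> ('o, 'm, 'p, 'n) func \<Rightarrow> ('o, 'm, 'q, 'k) func" where
  "comp_func G F = \<lparr>fob = fob G \<circ> fob F, far = far G \<circ> far F\<rparr>"

definition nat_trans ::
  "('o, 'm) cat \<Rightarrow> ('p, 'n) cat \<Rightarrow> ('o, 'm, 'p, 'n) func \<Rightarrow> ('o, 'm, 'p, 'n) func
   \<Rightarrow> ('o \<Rightarrow> 'n) \<Rightarrow> bool" where
  "nat_trans C D F G \<eta> \<longleftrightarrow>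
     (\<forall>a\<in>Obj C. \<eta> a \<in> homset D (fob F a) (fob G a)) \<and>
     (\<forall>f\<in>Arr C. Cmp D (\<eta> (Cod C f)) (far F f) = Cmp D (far G f) (\<eta> (Dom C f)))"

definition monic :: "('o, 'm) cat \<Rightarrow> 'm \<Rightarrow> bool" where
  "monic C i \<longleftrightarrow> i \<in> Arr C \<and>
     (\<forall>f\<in>Arr C. \<forall>g\<in>Arr C. Dom C f = Dom C g \<longrightarrow> Cod C f = Dom C i \<longrightarrow> Cod C g = Dom C i \<longrightarrow>
        Cmp C i f = Cmp C i g \<longrightarrow> f = g)"

text \<open>Towers are indexed by \<open>n \<ge> 1\<close>: objects \<open>T n\<close> and maps \<open>d n : T (n + 1) \<rightarrow> T n\<close>.\<close>

definition tower_cone ::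
  "('o, 'm) cat \<Rightarrow> (nat \<Rightarrow> 'o) \<Rightarrow> (nat \<Rightarrow> 'm) \<Rightarrow> 'o \<Rightarrow> (nat \<Rightarrow> 'm) \<Rightarrow> bool" where
  "tower_cone C T d K \<kappa> \<longleftrightarrow> K \<in> Obj C \<and>
     (\<forall>n\<ge>1. \<kappa> n \<in> homset C K (T n) \<and> Cmp C (d n) (\<kappa> (Suc n)) = \<kappa> n)"

definition tower_limit ::
  "('o, 'm) cat \<Rightarrow> (nat \<Rightarrow> 'o) \<Rightarrow> (nat \<Rightarrow> 'm) \<Rightarrow> 'o \<Rightarrow> (nat \<Rightarrow> 'm) \<Rightarrow> bool" where
  "tower_limit C T d L \<pi> \<longleftrightarrow> tower_cone C T d L \<pi> \<and>
     (\<forall>K \<kappa>. tower_cone C T d K \<kappa> \<longrightarrow>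
        (\<exists>!h. h \<in> homset C K L \<and> (\<forall>n\<ge>1. Cmp C (\<pi> n) h = \<kappa> n)))"


section \<open>Localization of a category\<close>

text \<open>
  The homotopy category \<open>C[W\<inverse>]\<close> is constructed with the objects of \<open>C\<close> and with
  classes of zigzags as arrows.  A letter \<open>Inl f\<close> is an arrow \<open>f\<close>, a letter \<open>Inr w\<close> is the
  formal inverse of \<open>w \<in> W\<close>; words are read from source to target.
\<close>

fun letter_dom :: "('o, 'm) cat \<Rightarrow> 'm + 'm \<Rightarrow> 'o" where
  "letter_dom C (Inl f) = Dom C f"
| "letter_dom C (Inr w) = Cod C w"

fun letter_cod :: "('o, 'm) cat \<Rightarrow> 'm + 'm \<Rightarrow> 'o" where
  "letter_cod C (Inl f) = Cod C f"
| "letter_cod C (Inr w) = Dom C w"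

fun zigzag :: "('o, 'm) cat \<Rightarrow> 'm set \<Rightarrow> 'o \<Rightarrow> ('m + 'm) list \<Rightarrow> 'o \<Rightarrow> bool" where
  "zigzag C W a [] b \<longleftrightarrow> a \<in> Obj C \<and> a = b"
| "zigzag C W a (x # xs) b \<longleftrightarrow>
     x \<in> Inl ` Arr C \<union> Inr ` (W \<inter> Arr C) \<and> letter_dom C x = a \<and> zigzag C W (letter_cod C x) xs b"

inductive zigzag_step :: "('o, 'm) cat \<Rightarrow> 'm set \<Rightarrow> ('m + 'm) list \<Rightarrow> ('m + 'm) list \<Rightarrow> bool"
  for C W where
  "a \<in> Obj C \<Longrightarrow> zigzag_step C W (xs @ [Inl (Idn C a)] @ ys) (xs @ ys)"
| "f \<in> Arr C \<Longrightarrow> g \<in> Arr C \<Longrightarrow> Cod C f = Dom C g \<Longrightarrow>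
     zigzag_step C W (xs @ [Inl f, Inl g] @ ys) (xs @ [Inl (Cmp C g f)] @ ys)"
| "w \<in> W \<Longrightarrow> zigzag_step C W (xs @ [Inl w, Inr w] @ ys) (xs @ ys)"
| "w \<in> W \<Longrightarrow> zigzag_step C W (xs @ [Inr w, Inl w] @ ys) (xs @ ys)"

definition zigzag_class ::
  "('o, 'm) cat \<Rightarrow> 'm set \<Rightarrow> 'o \<Rightarrow> 'o \<Rightarrow> ('m + 'm) list \<Rightarrow> ('m + 'm) list set" where
  "zigzag_class C W a b xs =
     {(us, vs). zigzag C W a us b \<and> zigzag C W a vs b \<and>
                (zigzag_step C W us vs \<or> zigzag_step C W vs us)}\<^sup>* `` {xs}"

type_synonym ('o, 'm) loc_arr = "'o \<times> ('m + 'm) list set \<times> 'o"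

definition localization :: "('o, 'm) cat \<Rightarrow> 'm set \<Rightarrow> ('o, ('o, 'm) loc_arr) cat" where
  "localization C W =
     \<lparr>Obj = Obj C,
      Arr = {(a, zigzag_class C W a b xs, b) | a b xs. zigzag C W a xs b},
      Dom = (\<lambda>(a, p, b). a),
      Cod = (\<lambda>(a, p, b). b),
      Idn = (\<lambda>a. (a, zigzag_class C W a a [], a)),
      Cmp = (\<lambda>(b, q, c) (a, p, b'). (a, \<Union>xs\<in>p. \<Union>ys\<in>q. zigzag_class C W a c (xs @ ys), c))\<rparr>"

definition loc_func :: "('o, 'm) cat \<Rightarrow> 'm set \<Rightarrow> ('o, 'm, 'o, ('o, 'm) loc_arr) func" where
  "loc_func C W =
     \<lparr>fob = id, far = \<lambda>f. (Dom C f, zigzag_class C W (Dom C f) (Cod C f) [Inl f], Cod C f)\<rparr>"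


section \<open>Model structures\<close>

definition has_lift :: "('o, 'm) cat \<Rightarrow> 'm \<Rightarrow> 'm \<Rightarrow> bool" where
  "has_lift C i p \<longleftrightarrow>
     (\<forall>u v. u \<in> homset C (Dom C i) (Dom C p) \<longrightarrow> v \<in> homset C (Cod C i) (Cod C p) \<longrightarrow>
        Cmp C v i = Cmp C p u \<longrightarrow>
        (\<exists>h \<in> homset C (Cod C i) (Dom C p). Cmp C h i = u \<and> Cmp C p h = v))"

definition rlp :: "('o, 'm) cat \<Rightarrow> 'm set \<Rightarrow> 'm set" where
  "rlp C S = {p \<in> Arr C. \<forall>i\<in>S. has_lift C i p}"

definition is_retract :: "('o, 'm) cat \<Rightarrow> 'm \<Rightarrow> 'm \<Rightarrow> bool" where
  "is_retract C f g \<longleftrightarrow>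
     (\<exists>u r v s. u \<in> homset C (Dom C f) (Dom C g) \<and> r \<in> homset C (Dom C g) (Dom C f) \<and>
        v \<in> homset C (Cod C f) (Cod C g) \<and> s \<in> homset C (Cod C g) (Cod C f) \<and>
        Cmp C r u = Idn C (Dom C f) \<and> Cmp C s v = Idn C (Cod C f) \<and>
        Cmp C g u = Cmp C v f \<and> Cmp C f r = Cmp C s g)"

definition subcategory_closed :: "('o, 'm) cat \<Rightarrow> 'm set \<Rightarrow> bool" where
  "subcategory_closed C S \<longleftrightarrow> S \<subseteq> Arr C \<and> (\<forall>a\<in>Obj C. Idn C a \<in> S) \<and>
     (\<forall>f\<in>S. \<forall>g\<in>S. Cod C f = Dom C g \<longrightarrow> Cmp C g f \<in> S)"

text \<open>
  A functorial factorization \<open>f = rgt f \<circ> lft f\<close>.  For a commutative square \<open>(u, v) : f \<rightarrow> g\<close>,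
  that is \<open>v \<circ> f = g \<circ> u\<close>, the map between the intermediate objects is \<open>mid f g u v\<close>.
\<close>

record 'm ffact =
  lft :: "'m \<Rightarrow> 'm"
  rgt :: "'m \<Rightarrow> 'm"
  mid :: "'m \<Rightarrow> 'm \<Rightarrow> 'm \<Rightarrow> 'm \<Rightarrow> 'm"

definition square :: "('o, 'm) cat \<Rightarrow> 'm \<Rightarrow> 'm \<Rightarrow> 'm \<Rightarrow> 'm \<Rightarrow> bool" where
  "square C f g u v \<longleftrightarrow> f \<in> Arr C \<and> g \<in> Arr C \<and>
     u \<in> homset C (Dom C f) (Dom C g) \<and> v \<in> homset C (Cod C f) (Cod C g) \<and>
     Cmp C v f = Cmp C g u"

definition functorial_factorization :: "('o, 'm) cat \<Rightarrow> 'm ffact \<Rightarrow> bool" where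
  "functorial_factorization C \<phi> \<longleftrightarrow>
     (\<forall>f\<in>Arr C. lft \<phi> f \<in> Arr C \<and> rgt \<phi> f \<in> Arr C \<and> Dom C (lft \<phi> f) = Dom C f \<and>
        Cod C (lft \<phi> f) = Dom C (rgt \<phi> f) \<and> Cod C (rgt \<phi> f) = Cod C f \<and>
        Cmp C (rgt \<phi> f) (lft \<phi> f) = f \<and>
        mid \<phi> f f (Idn C (Dom C f)) (Idn C (Cod C f)) = Idn C (Cod C (lft \<phi> f))) \<and>
     (\<forall>f g u v. square C f g u v \<longrightarrow>
        mid \<phi> f g u v \<in> homset C (Cod C (lft \<phi> f)) (Cod C (lft \<phi> g)) \<and>
        Cmp C (mid \<phi> f g u v) (lft \<phi> f) = Cmp C (lft \<phi> g) u \<and>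
        Cmp C v (rgt \<phi> f) = Cmp C (rgt \<phi> g) (mid \<phi> f g u v)) \<and>
     (\<forall>f g h u v u' v'. square C f g u v \<longrightarrow> square C g h u' v' \<longrightarrow>
        mid \<phi> f h (Cmp C u' u) (Cmp C v' v) = Cmp C (mid \<phi> g h u' v') (mid \<phi> f g u v))"

text \<open>
  A model structure in the sense of Hovey: the functorial factorizations (\<open>\<alpha>\<close>: cofibration
  followed by trivial fibration, \<open>\<gamma>\<close>: trivial cofibration followed by fibration) are part of
  the structure.
\<close>

definition model_structure ::
  "('o, 'm) cat \<Rightarrow> 'm set \<Rightarrow> 'm set \<Rightarrow> 'm set \<Rightarrow> 'm ffact \<Rightarrow> 'm ffact \<Rightarrow> bool" where
  "model_structure C W Cf Fb \<alpha> \<gamma> \<longleftrightarrow>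
     subcategory_closed C W \<and> subcategory_closed C Cf \<and> subcategory_closed C Fb \<and>
     (\<forall>f\<in>Arr C. \<forall>g\<in>Arr C. Cod C f = Dom C g \<longrightarrow>
        (f \<in> W \<and> Cmp C g f \<in> W \<longrightarrow> g \<in> W) \<and> (g \<in> W \<and> Cmp C g f \<in> W \<longrightarrow> f \<in> W)) \<and>
     (\<forall>f\<in>Arr C. \<forall>g\<in>Arr C. is_retract C f g \<longrightarrow>
        (g \<in> W \<longrightarrow> f \<in> W) \<and> (g \<in> Cf \<longrightarrow> f \<in> Cf) \<and> (g \<in> Fb \<longrightarrow> f \<in> Fb)) \<and>
     (\<forall>i\<in>Cf. \<forall>p\<in>Fb. i \<in> W \<or> p \<in> W \<longrightarrow> has_lift C i p) \<and>
     functorial_factorization C \<alpha> \<and> functorial_factorization C \<gamma> \<and>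
     (\<forall>f\<in>Arr C. lft \<alpha> f \<in> Cf \<and> rgt \<alpha> f \<in> Fb \<inter> W \<and> lft \<gamma> f \<in> Cf \<inter> W \<and> rgt \<gamma> f \<in> Fb)"

text \<open>
  Homotopy limits of functorial towers.  The tower of functors \<open>T n\<close> with maps \<open>d n\<close> is replaced,
  through weak equivalences \<open>w n : T n \<rightarrow> R n\<close> natural in \<open>A\<close>, by a tower of fibrations \<open>r n\<close>
  starting in a fibrant object \<open>R 1 A\<close>; the homotopy limit is the functor on the homotopy category
  induced by the limit \<open>\<Lambda>\<close> of the replaced tower, \<open>p n\<close> are its projections to the \<open>T n\<close>, and
  \<open>c\<close> is the map from the identity functor induced by the compatible maps \<open>e n : A \<rightarrow> T n A\<close>.
  \<open>bang A\<close> is the map from \<open>A\<close> to the terminal object.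
\<close>

definition is_holim ::
  "('o, 'm) cat \<Rightarrow> 'm set \<Rightarrow> 'm set \<Rightarrow> ('o \<Rightarrow> 'm) \<Rightarrow>
   (nat \<Rightarrow> ('o, 'm, 'o, 'm) func) \<Rightarrow> (nat \<Rightarrow> 'o \<Rightarrow> 'm) \<Rightarrow> (nat \<Rightarrow> 'o \<Rightarrow> 'm) \<Rightarrow>
   ('o, ('o, 'm) loc_arr, 'o, ('o, 'm) loc_arr) func \<Rightarrow>
   (nat \<Rightarrow> 'o \<Rightarrow> ('o, 'm) loc_arr) \<Rightarrow> ('o \<Rightarrow> ('o, 'm) loc_arr) \<Rightarrow> bool" where
  "is_holim C W Fb bang T d e h p c \<longleftrightarrow>
     (let H = localization C W; Ho = loc_func C W in
      is_functor H H h \<and>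
      (\<exists>R r w \<Lambda> \<pi> k.
        (\<forall>n\<ge>1. is_functor C C (R n) \<and> nat_trans C C (R (Suc n)) (R n) (r n) \<and>
               nat_trans C C (T n) (R n) (w n)) \<and>
        (\<forall>A\<in>Obj C. bang (fob (R 1) A) \<in> Fb \<and>
           (\<forall>n\<ge>1. w n A \<in> W \<and> r n A \<in> Fb \<and>
              Cmp C (r n A) (w (Suc n) A) = Cmp C (w n A) (d n A))) \<and>
        is_functor C C \<Lambda> \<and> (\<forall>n\<ge>1. nat_trans C C \<Lambda> (R n) (\<pi> n)) \<and>
        (\<forall>A\<in>Obj C. tower_limit C (\<lambda>n. fob (R n) A) (\<lambda>n. r n A) (fob \<Lambda> A) (\<lambda>n. \<pi> n A)) \<and>
        nat_trans C C id_func \<Lambda> k \<and>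
        (\<forall>A\<in>Obj C. \<forall>n\<ge>1. Cmp C (\<pi> n A) (k A) = Cmp C (w n A) (e n A)) \<and>
        functor_eq C (comp_func h Ho) (comp_func Ho \<Lambda>) \<and>
        (\<forall>A\<in>Obj C. c A = far Ho (k A) \<and>
           (\<forall>n\<ge>1. p n A \<in> homset H (fob h A) (fob (T n) A) \<and>
              Cmp H (far Ho (w n A)) (p n A) = far Ho (\<pi> n A)))))"


section \<open>Simplicial sets\<close>

type_synonym delta_arr = "nat \<times> (nat \<Rightarrow> nat) \<times> nat"

text \<open>The object \<open>n\<close> of the simplex category is the ordinal \<open>{0, ..., n}\<close>.\<close>

definition Delta :: "(nat, delta_arr) cat" where
  "Delta =
     \<lparr>Obj = UNIV,
      Arr = {(m, \<theta>, n). \<theta> \<in> {..m} \<rightarrow>\<^sub>E {..n} \<and> mono_on {..m} \<theta>},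
      Dom = (\<lambda>(m, \<theta>, n). m),
      Cod = (\<lambda>(m, \<theta>, n). n),
      Idn = (\<lambda>n. (n, \<lambda>i\<in>{..n}. i, n)),
      Cmp = (\<lambda>(n, \<eta>, k) (m, \<theta>, n'). (m, compose {..m} \<eta> \<theta>, k))\<rparr>"

record 'x sset =
  spx :: "nat \<Rightarrow> 'x set"
  sact :: "delta_arr \<Rightarrow> 'x \<Rightarrow> 'x"

subsection \<open>Geometric realization\<close>

definition simplex_push :: "delta_arr \<Rightarrow> (nat \<Rightarrow> real) \<Rightarrow> nat \<Rightarrow> real" where
  "simplex_push \<alpha> t = (case \<alpha> of (m, \<theta>, n) \<Rightarrow> (\<lambda>j. \<Sum>i | i \<le> m \<and> \<theta> i = j. t i))"

type_synonym 'x rpoint = "nat \<times> 'x \<times> (nat \<Rightarrow> real)"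

definition rpoints :: "'x sset \<Rightarrow> 'x rpoint set" where
  "rpoints K = {(n, x, t). x \<in> spx K n \<and> t \<in> standard_simplex n}"

definition rglue :: "'x sset \<Rightarrow> ('x rpoint \<times> 'x rpoint) set" where
  "rglue K =
     {((Dom Delta \<alpha>, sact K \<alpha> x, t), (Cod Delta \<alpha>, x, simplex_push \<alpha> t)) | \<alpha> x t.
        \<alpha> \<in> Arr Delta \<and> x \<in> spx K (Cod Delta \<alpha>) \<and> t \<in> standard_simplex (Dom Delta \<alpha>)}"

definition rclass :: "'x sset \<Rightarrow> 'x rpoint \<Rightarrow> 'x rpoint set" where
  "rclass K z = (rglue K \<union> (rglue K)\<inverse>)\<^sup>* `` {z}"

definition realization_open :: "'x sset \<Rightarrow> 'x rpoint set set \<Rightarrow> bool" where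
  "realization_open K S \<longleftrightarrow> S \<subseteq> rclass K ` rpoints K \<and>
     (\<forall>n. \<forall>x\<in>spx K n. openin (subtopology (powertop_real UNIV) (standard_simplex n))
        {t \<in> standard_simplex n. rclass K (n, x, t) \<in> S})"

lemma istopology_realization: "istopology (realization_open K)"
proof -
  have int: "{t \<in> standard_simplex n. rclass K (n, x, t) \<in> S \<inter> T} =
      {t \<in> standard_simplex n. rclass K (n, x, t) \<in> S} \<inter>
      {t \<in> standard_simplex n. rclass K (n, x, t) \<in> T}" for n x S T
    by auto
  have un: "{t \<in> standard_simplex n. rclass K (n, x, t) \<in> \<Union>\<S>} =
      (\<Union>S\<in>\<S>. {t \<in> standard_simplex n. rclass K (n, x, t) \<in> S})" for n x \<S>
    by auto
  show ?thesis
    unfolding istopology_def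
  proof (intro conjI allI impI)
    show "realization_open K (S \<inter> T)" if "realization_open K S" "realization_open K T" for S T
      using that unfolding realization_open_def int by (simp add: openin_Int le_infI1)
    show "realization_open K (\<Union>\<S>)" if "\<forall>S\<in>\<S>. realization_open K S" for \<S>
      using that unfolding realization_open_def un
      by (intro conjI allI ballI openin_Union) (auto simp: Sup_le_iff)
  qed
qed

definition realization :: "'x sset \<Rightarrow> 'x rpoint set topology" where
  "realization K = topology (realization_open K)"

lemma openin_realization: "openin (realization K) = realization_open K"
  unfolding realization_def by (rule topology_inverse'[OF istopology_realization])

text \<open>The map of realizations into \<open>|L|\<close> induced by a simplicial map \<open>f\<close> into \<open>L\<close>.\<close>

definition rmap :: "'y sset \<Rightarrow> (nat \<Rightarrow> 'x \<Rightarrow> 'y) \<Rightarrow> 'x rpoint set \<Rightarrow> 'y rpoint set" where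
  "rmap L f z = (\<Union>(n, x, t)\<in>z. rclass L (n, f n x, t))"

definition rvertex :: "'x sset \<Rightarrow> 'x \<Rightarrow> 'x rpoint set" where
  "rvertex K v = rclass K (0, v, \<lambda>i. if i = 0 then 1 else 0)"

subsection \<open>Homotopy groups and weak equivalences\<close>

definition cube :: "nat \<Rightarrow> (nat \<Rightarrow> real) topology" where
  "cube n = product_topology (\<lambda>_. top_of_set {0..1}) {..<n}"

definition cube_bd :: "nat \<Rightarrow> (nat \<Rightarrow> real) set" where
  "cube_bd n = {t \<in> topspace (cube n). \<exists>i<n. t i = 0 \<or> t i = 1}"

text \<open>
  Spheroids represent the elements of \<open>\<pi>\<^sub>n(T, b)\<close>.  For \<open>n = 0\<close> the boundary of the
  cube is empty, so that one obtains the set of path components and the base point is irrelevant.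
\<close>

definition spheroid :: "nat \<Rightarrow> 'a topology \<Rightarrow> 'a \<Rightarrow> ((nat \<Rightarrow> real) \<Rightarrow> 'a) \<Rightarrow> bool" where
  "spheroid n T b p \<longleftrightarrow> continuous_map (cube n) T p \<and> (\<forall>t\<in>cube_bd n. p t = b)"

definition spheroid_homotopic ::
  "nat \<Rightarrow> 'a topology \<Rightarrow> 'a \<Rightarrow> ((nat \<Rightarrow> real) \<Rightarrow> 'a) \<Rightarrow> ((nat \<Rightarrow> real) \<Rightarrow> 'a) \<Rightarrow> bool" where
  "spheroid_homotopic n T b p q \<longleftrightarrow> homotopic_with (\<lambda>h. \<forall>t\<in>cube_bd n. h t = b) (cube n) T p q"

text \<open>\<open>F\<close> induces a bijection from \<open>\<pi>\<^sub>n(T, b)\<close> to \<open>\<pi>\<^sub>n(T', b')\<close>.\<close>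

definition pi_bij ::
  "nat \<Rightarrow> 'a topology \<Rightarrow> 'a \<Rightarrow> 'b topology \<Rightarrow> 'b \<Rightarrow> ('a \<Rightarrow> 'b) \<Rightarrow> bool" where
  "pi_bij n T b T' b' F \<longleftrightarrow>
     (\<forall>p q. spheroid n T b p \<longrightarrow> spheroid n T b q \<longrightarrow>
        spheroid_homotopic n T' b' (F \<circ> p) (F \<circ> q) \<longrightarrow> spheroid_homotopic n T b p q) \<and>
     (\<forall>q. spheroid n T' b' q \<longrightarrow> (\<exists>p. spheroid n T b p \<and> spheroid_homotopic n T' b' (F \<circ> p) q))"

definition sset_weq :: "'x sset \<Rightarrow> 'y sset \<Rightarrow> (nat \<Rightarrow> 'x \<Rightarrow> 'y) \<Rightarrow> bool" where
  "sset_weq K L f \<longleftrightarrow>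
     pi_bij 0 (realization K) undefined (realization L) undefined (rmap L f) \<and>
     (\<forall>n\<ge>1. \<forall>v\<in>spx K 0.
        pi_bij n (realization K) (rvertex K v) (realization L) (rvertex L (f 0 v)) (rmap L f))"


section \<open>Pointed simplicial presheaves\<close>

text \<open>
  Small sets are the members of a Grothendieck universe \<open>\<UU>\<close>, rendered up to bijection as a
  family of subsets of a type.
\<close>

definition grothendieck_universe :: "'u set set \<Rightarrow> bool" where
  "grothendieck_universe \<UU> \<longleftrightarrow>
     (\<exists>A\<in>\<UU>. infinite A) \<and>
     (\<forall>A\<in>\<UU>. \<forall>B. B \<subseteq> A \<longrightarrow> B \<in> \<UU>) \<and>
     (\<forall>A\<in>\<UU>. \<forall>f :: 'u \<Rightarrow> 'u. f ` A \<in> \<UU>) \<and>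
     (\<forall>A\<in>\<UU>. \<forall>F :: 'u \<Rightarrow> 'u set. (\<forall>a\<in>A. F a \<in> \<UU>) \<longrightarrow> (\<Union>a\<in>A. F a) \<in> \<UU>) \<and>
     (\<forall>A\<in>\<UU>. \<exists>B\<in>\<UU>. \<exists>e :: 'u set \<Rightarrow> 'u. inj_on e (Pow A) \<and> e ` Pow A \<subseteq> B)"

text \<open>
  A presheaf on \<open>C \<times> \<Delta>\<close>: \<open>val A V n\<close> is the set \<open>A(V)\<^sub>n\<close> with base point \<open>bpt A V n\<close>, and
  \<open>act A f \<theta>\<close> is the map induced by \<open>f\<close> in \<open>C\<close> and \<open>\<theta>\<close> in \<open>\<Delta>\<close>.
\<close>

record ('o, 'f, 'u) spsh =
  val :: "'o \<Rightarrow> nat \<Rightarrow> 'u set"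
  bpt :: "'o \<Rightarrow> nat \<Rightarrow> 'u"
  act :: "'f \<Rightarrow> delta_arr \<Rightarrow> 'u \<Rightarrow> 'u"

definition is_spsh :: "'u set set \<Rightarrow> ('o, 'f) cat \<Rightarrow> ('o, 'f, 'u) spsh \<Rightarrow> bool" where
  "is_spsh \<UU> C A \<longleftrightarrow>
     (\<forall>V\<in>Obj C. \<forall>n. val A V n \<in> \<UU> \<and> bpt A V n \<in> val A V n) \<and>
     (\<forall>f\<in>Arr C. \<forall>\<theta>\<in>Arr Delta.
        act A f \<theta> \<in> val A (Cod C f) (Cod Delta \<theta>) \<rightarrow> val A (Dom C f) (Dom Delta \<theta>) \<and>
        act A f \<theta> (bpt A (Cod C f) (Cod Delta \<theta>)) = bpt A (Dom C f) (Dom Delta \<theta>)) \<and>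
     (\<forall>V\<in>Obj C. \<forall>n. \<forall>x\<in>val A V n. act A (Idn C V) (Idn Delta n) x = x) \<and>
     (\<forall>f\<in>Arr C. \<forall>g\<in>Arr C. \<forall>\<theta>\<in>Arr Delta. \<forall>\<eta>\<in>Arr Delta.
        Cod C f = Dom C g \<longrightarrow> Cod Delta \<theta> = Dom Delta \<eta> \<longrightarrow>
        (\<forall>x\<in>val A (Cod C g) (Cod Delta \<eta>).
           act A (Cmp C g f) (Cmp Delta \<eta> \<theta>) x = act A f \<theta> (act A g \<eta> x)))"

type_synonym ('o, 'f, 'u) psarr =
  "('o, 'f, 'u) spsh \<times> ('o \<Rightarrow> nat \<Rightarrow> 'u \<Rightarrow> 'u) \<times> ('o, 'f, 'u) spsh"

text \<open>
  Components of maps are \<open>undefined\<close> outside their domain, so that each map has exactly one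
  representation.
\<close>

definition psh_arr :: "'u set set \<Rightarrow> ('o, 'f) cat \<Rightarrow> ('o, 'f, 'u) psarr \<Rightarrow> bool" where
  "psh_arr \<UU> C F \<longleftrightarrow> (case F of (A, \<phi>, B) \<Rightarrow>
     is_spsh \<UU> C A \<and> is_spsh \<UU> C B \<and>
     (\<forall>V\<in>Obj C. \<forall>n. \<phi> V n \<in> val A V n \<rightarrow> val B V n \<and> \<phi> V n (bpt A V n) = bpt B V n) \<and>
     (\<forall>f\<in>Arr C. \<forall>\<theta>\<in>Arr Delta. \<forall>x\<in>val A (Cod C f) (Cod Delta \<theta>).
        \<phi> (Dom C f) (Dom Delta \<theta>) (act A f \<theta> x) = act B f \<theta> (\<phi> (Cod C f) (Cod Delta \<theta>) x)) \<and>
     (\<forall>V n x. \<not> (V \<in> Obj C \<and> x \<in> val A V n) \<longrightarrow> \<phi> V n x = undefined))"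

definition psh_cat :: "'u set set \<Rightarrow> ('o, 'f) cat \<Rightarrow> (('o, 'f, 'u) spsh, ('o, 'f, 'u) psarr) cat" where
  "psh_cat \<UU> C =
     \<lparr>Obj = {A. is_spsh \<UU> C A},
      Arr = {F. psh_arr \<UU> C F},
      Dom = (\<lambda>(A, \<phi>, B). A),
      Cod = (\<lambda>(A, \<phi>, B). B),
      Idn = (\<lambda>A. (A, \<lambda>V n x. if V \<in> Obj C \<and> x \<in> val A V n then x else undefined, A)),
      Cmp = (\<lambda>(B, \<psi>, D) (A, \<phi>, B').
        (A, \<lambda>V n x. if V \<in> Obj C \<and> x \<in> val A V n then \<psi> V n (\<phi> V n x) else undefined, D))\<rparr>"

text \<open>
  Arrows of \<open>C\<close> are coded as elements of the universe by \<open>enc\<close>; \<open>enc None\<close> serves as the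
  (disjoint) base point.
\<close>

definition star :: "('f option \<Rightarrow> 'u) \<Rightarrow> ('o, 'f, 'u) spsh" where
  "star enc = \<lparr>val = \<lambda>_ _. {enc None}, bpt = \<lambda>_ _. enc None, act = \<lambda>_ _ x. x\<rparr>"

definition bang ::
  "('o, 'f) cat \<Rightarrow> ('f option \<Rightarrow> 'u) \<Rightarrow> ('o, 'f, 'u) spsh \<Rightarrow> ('o, 'f, 'u) psarr" where
  "bang C enc A =
     (A, \<lambda>V n x. if V \<in> Obj C \<and> x \<in> val A V n then enc None else undefined, star enc)"

text \<open>\<open>representable C enc Y\<close> is \<open>Y\<^sub>+\<close> and \<open>represented_arr C enc f\<close> is \<open>f\<^sub>+\<close>.\<close>

definition representable :: "('o, 'f) cat \<Rightarrow> ('f option \<Rightarrow> 'u) \<Rightarrow> 'o \<Rightarrow> ('o, 'f, 'u) spsh" where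
  "representable C enc Y =
     \<lparr>val = \<lambda>V _. insert (enc None) ((enc \<circ> Some) ` homset C V Y),
      bpt = \<lambda>_ _. enc None,
      act = \<lambda>f _ x. enc (map_option (\<lambda>g. Cmp C g f) (inv_into UNIV enc x))\<rparr>"

definition represented_arr ::
  "('o, 'f) cat \<Rightarrow> ('f option \<Rightarrow> 'u) \<Rightarrow> 'f \<Rightarrow> ('o, 'f, 'u) psarr" where
  "represented_arr C enc f =
     (representable C enc (Dom C f),
      \<lambda>V n x. if V \<in> Obj C \<and> x \<in> val (representable C enc (Dom C f)) V n
              then enc (map_option (\<lambda>g. Cmp C f g) (inv_into UNIV enc x)) else undefined,
      representable C enc (Cod C f))"

text \<open>
  The simplicial mapping space \<open>Map(A, W)\<close> of pointed presheaves: a \<open>k\<close>-simplex is a map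
  \<open>A \<times> \<Delta>[k] \<rightarrow> W\<close> sending \<open>* \<times> \<Delta>[k]\<close> to the base point, that is a pointed map
  \<open>A \<and> \<Delta>[k]\<^sub>+ \<rightarrow> W\<close>.  Its component at the simplex \<open>(x, \<alpha>)\<close>, with \<open>x\<close> in \<open>A(V)\<^sub>m\<close> and \<open>\<alpha> : [m] \<rightarrow> [k]\<close>,
  is \<open>\<phi> V \<alpha> x\<close>.
\<close>

type_synonym ('o, 'u) mapspx = "'o \<Rightarrow> delta_arr \<Rightarrow> 'u \<Rightarrow> 'u"

definition Map ::
  "('o, 'f) cat \<Rightarrow> ('o, 'f, 'u) spsh \<Rightarrow> ('o, 'f, 'u) spsh \<Rightarrow> ('o, 'u) mapspx sset" where
  "Map C A W =
     \<lparr>spx = \<lambda>k. {\<phi>.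
        (\<forall>V\<in>Obj C. \<forall>\<alpha>\<in>Arr Delta. Cod Delta \<alpha> = k \<longrightarrow>
           \<phi> V \<alpha> \<in> val A V (Dom Delta \<alpha>) \<rightarrow> val W V (Dom Delta \<alpha>) \<and>
           \<phi> V \<alpha> (bpt A V (Dom Delta \<alpha>)) = bpt W V (Dom Delta \<alpha>)) \<and>
        (\<forall>f\<in>Arr C. \<forall>\<theta>\<in>Arr Delta. \<forall>\<alpha>\<in>Arr Delta. Cod Delta \<alpha> = k \<longrightarrow> Cod Delta \<theta> = Dom Delta \<alpha> \<longrightarrow>
           (\<forall>x\<in>val A (Cod C f) (Cod Delta \<theta>).
              \<phi> (Dom C f) (Cmp Delta \<alpha> \<theta>) (act A f \<theta> x) = act W f \<theta> (\<phi> (Cod C f) \<alpha> x))) \<and>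
        (\<forall>V \<alpha> x. \<not> (V \<in> Obj C \<and> \<alpha> \<in> Arr Delta \<and> Cod Delta \<alpha> = k \<and> x \<in> val A V (Dom Delta \<alpha>)) \<longrightarrow>
           \<phi> V \<alpha> x = undefined)},
      sact = \<lambda>\<beta> \<phi> V \<alpha> x.
        if V \<in> Obj C \<and> \<alpha> \<in> Arr Delta \<and> Cod Delta \<alpha> = Dom Delta \<beta> \<and> x \<in> val A V (Dom Delta \<alpha>)
        then \<phi> V (Cmp Delta \<beta> \<alpha>) x else undefined\<rparr>"

definition Map_precomp ::
  "('o, 'f) cat \<Rightarrow> ('o, 'f, 'u) psarr \<Rightarrow> nat \<Rightarrow> ('o, 'u) mapspx \<Rightarrow> ('o, 'u) mapspx" where
  "Map_precomp C F k \<phi> = (case F of (A, f, B) \<Rightarrow> (\<lambda>V \<alpha> x.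
     if V \<in> Obj C \<and> \<alpha> \<in> Arr Delta \<and> Cod Delta \<alpha> = k \<and> x \<in> val A V (Dom Delta \<alpha>)
     then \<phi> V \<alpha> (f V (Dom Delta \<alpha>) x) else undefined))"

text \<open>
  \<open>inverts C F W\<close>: \<open>F\<^sup>* : Map(B, W) \<rightarrow> Map(A, W)\<close> is a weak equivalence.  Every
  presheaf is cofibrant, hence for fibrant \<open>W\<close> these are the homotopy function complexes used to
  define left Bousfield localizations.
\<close>

definition inverts ::
  "('o, 'f) cat \<Rightarrow> ('o, 'f, 'u) psarr \<Rightarrow> ('o, 'f, 'u) spsh \<Rightarrow> bool" where
  "inverts C F W \<longleftrightarrow> (case F of (A, f, B) \<Rightarrow> sset_weq (Map C B W) (Map C A W) (Map_precomp C F))"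

definition local_objects ::
  "('o, 'f) cat \<Rightarrow> ('o, 'f, 'u) spsh set \<Rightarrow> ('o, 'f, 'u) psarr set \<Rightarrow> ('o, 'f, 'u) spsh set" where
  "local_objects C Fibrant S = {W \<in> Fibrant. \<forall>F\<in>S. inverts C F W}"

definition local_equivalences ::
  "'u set set \<Rightarrow> ('o, 'f) cat \<Rightarrow> ('o, 'f, 'u) spsh set \<Rightarrow> ('o, 'f, 'u) psarr set" where
  "local_equivalences \<UU> C Local = {F \<in> Arr (psh_cat \<UU> C). \<forall>W\<in>Local. inverts C F W}"

subsection \<open>The injective local model structure\<close>

definition sections :: "('o, 'f) cat \<Rightarrow> ('o, 'f, 'u) spsh \<Rightarrow> 'o \<Rightarrow> 'u sset" where
  "sections C A V = \<lparr>spx = val A V, sact = act A (Idn C V)\<rparr>"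

definition rrestr ::
  "('o, 'f) cat \<Rightarrow> ('o, 'f, 'u) spsh \<Rightarrow> 'f \<Rightarrow> 'u rpoint set \<Rightarrow> 'u rpoint set" where
  "rrestr C A g = rmap (sections C A (Dom C g)) (\<lambda>n. act A g (Idn Delta n))"

text \<open>
  Local weak equivalences induce isomorphisms of the sheaves of homotopy groups at all local base
  points.  A map of presheaves induces an isomorphism of associated sheaves iff it is locally
  injective and locally surjective.  In degree \<open>0\<close> the base point \<open>a\<close> is irrelevant (and always
  exists).  \<open>cov V \<C>\<close> says that \<open>\<C>\<close> is a covering family of \<open>V\<close>.
\<close>

definition local_weqs ::
  "'u set set \<Rightarrow> ('o, 'f) cat \<Rightarrow> ('o \<Rightarrow> 'f set \<Rightarrow> bool) \<Rightarrow> ('o, 'f, 'u) psarr set" where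
  "local_weqs \<UU> C cov = {(A, \<phi>, B). (A, \<phi>, B) \<in> Arr (psh_cat \<UU> C) \<and>
     (\<forall>n. \<forall>V\<in>Obj C. \<forall>a\<in>val A V 0.
       let RA = (\<lambda>V'. realization (sections C A V'));
           RB = (\<lambda>V'. realization (sections C B V'));
           R\<phi> = (\<lambda>V'. rmap (sections C B V') (\<phi> V'));
           a' = (\<lambda>g. rvertex (sections C A (Dom C g)) (act A g (Idn Delta 0) a));
           b' = (\<lambda>g. rvertex (sections C B (Dom C g)) (act B g (Idn Delta 0) (\<phi> V 0 a)));
           a0 = rvertex (sections C A V) a;
           b0 = rvertex (sections C B V) (\<phi> V 0 a)
       in (\<forall>p q. spheroid n (RA V) a0 p \<longrightarrow> spheroid n (RA V) a0 q \<longrightarrow>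
             spheroid_homotopic n (RB V) b0 (R\<phi> V \<circ> p) (R\<phi> V \<circ> q) \<longrightarrow>
             (\<exists>\<C>. cov V \<C> \<and> (\<forall>g\<in>\<C>. spheroid_homotopic n (RA (Dom C g)) (a' g)
                (rrestr C A g \<circ> p) (rrestr C A g \<circ> q)))) \<and>
          (\<forall>q. spheroid n (RB V) b0 q \<longrightarrow>
             (\<exists>\<C>. cov V \<C> \<and> (\<forall>g\<in>\<C>. \<exists>p. spheroid n (RA (Dom C g)) (a' g) p \<and>
                spheroid_homotopic n (RB (Dom C g)) (b' g)
                  (R\<phi> (Dom C g) \<circ> p) (rrestr C B g \<circ> q)))))}"

definition cofibrations :: "'u set set \<Rightarrow> ('o, 'f) cat \<Rightarrow> ('o, 'f, 'u) psarr set" where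
  "cofibrations \<UU> C = {F. monic (psh_cat \<UU> C) F}"

definition fibrations ::
  "'u set set \<Rightarrow> ('o, 'f) cat \<Rightarrow> ('o, 'f, 'u) psarr set \<Rightarrow> ('o, 'f, 'u) psarr set" where
  "fibrations \<UU> C W = rlp (psh_cat \<UU> C) (cofibrations \<UU> C \<inter> W)"

definition globally_fibrant ::
  "'u set set \<Rightarrow> ('o, 'f) cat \<Rightarrow> ('f option \<Rightarrow> 'u) \<Rightarrow> ('o \<Rightarrow> 'f set \<Rightarrow> bool) \<Rightarrow> ('o, 'f, 'u) spsh set"
  where
  "globally_fibrant \<UU> C enc cov =
     {A \<in> Obj (psh_cat \<UU> C). bang C enc A \<in> fibrations \<UU> C (local_weqs \<UU> C cov)}"


section \<open>Commutative algebra\<close>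

definition local_ring :: "('r, 'b) ring_scheme \<Rightarrow> bool" where
  "local_ring R \<longleftrightarrow> cring R \<and> ideal (carrier R - Units R) R"

definition krull_dim :: "('r, 'b) ring_scheme \<Rightarrow> enat" where
  "krull_dim R = Sup {enat n | n. \<exists>P. (\<forall>i\<le>n. primeideal (P i) R) \<and> (\<forall>i<n. P i \<subset> P (Suc i))}"

definition frac :: "'r ring \<Rightarrow> 'r set \<Rightarrow> 'r \<times> 'r \<Rightarrow> ('r \<times> 'r) set" where
  "frac R P x = (case x of (a, s) \<Rightarrow> {(b, t). b \<in> carrier R \<and> t \<in> carrier R - P \<and>
     (\<exists>u\<in>carrier R - P. u \<otimes>\<^bsub>R\<^esub> (a \<otimes>\<^bsub>R\<^esub> t \<ominus>\<^bsub>R\<^esub> b \<otimes>\<^bsub>R\<^esub> s) = \<zero>\<^bsub>R\<^esub>)})"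

text \<open>
  The localization of \<open>R\<close> at the prime ideal \<open>P\<close>.  In the unions all members coincide, since the
  operations are compatible with equality of fractions.
\<close>

definition ring_at :: "'r ring \<Rightarrow> 'r set \<Rightarrow> ('r \<times> 'r) set ring" where
  "ring_at R P =
     \<lparr>carrier = {frac R P (a, s) | a s. a \<in> carrier R \<and> s \<in> carrier R - P},
      monoid.mult = \<lambda>x y. \<Union>(a, s)\<in>x. \<Union>(b, t)\<in>y. frac R P (a \<otimes>\<^bsub>R\<^esub> b, s \<otimes>\<^bsub>R\<^esub> t),
      one = frac R P (\<one>\<^bsub>R\<^esub>, \<one>\<^bsub>R\<^esub>),
      ring.zero = frac R P (\<zero>\<^bsub>R\<^esub>, \<one>\<^bsub>R\<^esub>),
      ring.add = \<lambda>x y. \<Union>(a, s)\<in>x. \<Union>(b, t)\<in>y. frac R P (a \<otimes>\<^bsub>R\<^esub> t \<oplus>\<^bsub>R\<^esub> b \<otimes>\<^bsub>R\<^esub> s, s \<otimes>\<^bsub>R\<^esub> t)\<rparr>"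

definition alg_finite_type :: "'r ring \<Rightarrow> 'r ring \<Rightarrow> ('r \<Rightarrow> 'r) \<Rightarrow> bool" where
  "alg_finite_type A B \<phi> \<longleftrightarrow>
     (\<exists>G. finite G \<and> G \<subseteq> carrier B \<and> generate_ring B (\<phi> ` carrier A \<union> G) = carrier B)"

text \<open>\<open>g\<close> lifts the \<open>A\<close>-algebra map \<open>h : B \<rightarrow> C/I\<close> to an \<open>A\<close>-algebra map \<open>B \<rightarrow> C\<close>.\<close>

definition alg_lift ::
  "'r ring \<Rightarrow> 'r ring \<Rightarrow> ('r \<Rightarrow> 'r) \<Rightarrow> 'r ring \<Rightarrow> 'r set \<Rightarrow> ('r \<Rightarrow> 'r) \<Rightarrow> ('r \<Rightarrow> 'r set) \<Rightarrow> ('r \<Rightarrow> 'r) \<Rightarrow> bool"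
  where
  "alg_lift A B \<phi> C I \<gamma> h g \<longleftrightarrow> g \<in> ring_hom B C \<and> (\<forall>a\<in>carrier A. g (\<phi> a) = \<gamma> a) \<and>
     (\<forall>b\<in>carrier B. h b = I +>\<^bsub>C\<^esub> g b)"

definition lifting_problem ::
  "'r ring \<Rightarrow> 'r ring \<Rightarrow> ('r \<Rightarrow> 'r) \<Rightarrow> 'r ring \<Rightarrow> 'r set \<Rightarrow> ('r \<Rightarrow> 'r) \<Rightarrow> ('r \<Rightarrow> 'r set) \<Rightarrow> bool" where
  "lifting_problem A B \<phi> C I \<gamma> h \<longleftrightarrow>
     cring C \<and> ideal I C \<and> (\<forall>x\<in>I. \<forall>y\<in>I. x \<otimes>\<^bsub>C\<^esub> y = \<zero>\<^bsub>C\<^esub>) \<and>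
     \<gamma> \<in> ring_hom A C \<and> h \<in> ring_hom B (C Quot I) \<and> (\<forall>a\<in>carrier A. h (\<phi> a) = I +>\<^bsub>C\<^esub> \<gamma> a)"

text \<open>
  The test algebras \<open>C\<close> live on the same type as \<open>A\<close> and \<open>B\<close>.  If the type is infinite this is no
  restriction: formal smoothness of \<open>B\<close> only has to be tested on quotients of \<open>P\<close>, where
  \<open>B\<close> is a quotient of the polynomial \<open>A\<close>-algebra \<open>P\<close> on the elements of \<open>B\<close>, and formal
  unramifiedness on \<open>(B \<otimes>\<^sub>A B)/J\<^sup>2\<close> for the kernel \<open>J\<close> of the multiplication.
\<close>

definition formally_smooth :: "'r ring \<Rightarrow> 'r ring \<Rightarrow> ('r \<Rightarrow> 'r) \<Rightarrow> bool" where
  "formally_smooth A B \<phi> \<longleftrightarrow>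
     (\<forall>C I \<gamma> h. lifting_problem A B \<phi> C I \<gamma> h \<longrightarrow> (\<exists>g. alg_lift A B \<phi> C I \<gamma> h g))"

definition formally_unramified :: "'r ring \<Rightarrow> 'r ring \<Rightarrow> ('r \<Rightarrow> 'r) \<Rightarrow> bool" where
  "formally_unramified A B \<phi> \<longleftrightarrow>
     (\<forall>C I \<gamma> h g g'. lifting_problem A B \<phi> C I \<gamma> h \<longrightarrow> alg_lift A B \<phi> C I \<gamma> h g \<longrightarrow>
        alg_lift A B \<phi> C I \<gamma> h g' \<longrightarrow> (\<forall>b\<in>carrier B. g b = g' b))"


section \<open>Schemes\<close>

subsection \<open>Locally ringed spaces\<close>

record ('p, 'r) rspace =
  spc :: "'p topology"
  sect :: "'p set \<Rightarrow> 'r ring"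
  restr :: "'p set \<Rightarrow> 'p set \<Rightarrow> 'r \<Rightarrow> 'r"

text \<open>\<open>restr Y V W\<close> is the restriction from \<open>V\<close> to \<open>W \<subseteq> V\<close>.\<close>

definition ringed_space :: "('p, 'r) rspace \<Rightarrow> bool" where
  "ringed_space Y \<longleftrightarrow>
     (\<forall>V. openin (spc Y) V \<longrightarrow> cring (sect Y V) \<and> (\<forall>s\<in>carrier (sect Y V). restr Y V V s = s)) \<and>
     (\<forall>V W. openin (spc Y) V \<longrightarrow> openin (spc Y) W \<longrightarrow> W \<subseteq> V \<longrightarrow>
        restr Y V W \<in> ring_hom (sect Y V) (sect Y W)) \<and>
     (\<forall>V W W'. openin (spc Y) V \<longrightarrow> openin (spc Y) W \<longrightarrow> openin (spc Y) W' \<longrightarrow>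
        W' \<subseteq> W \<longrightarrow> W \<subseteq> V \<longrightarrow> (\<forall>s\<in>carrier (sect Y V). restr Y W W' (restr Y V W s) = restr Y V W' s)) \<and>
     (\<forall>\<V> \<sigma>. (\<forall>V\<in>\<V>. openin (spc Y) V \<and> \<sigma> V \<in> carrier (sect Y V)) \<longrightarrow>
        (\<forall>V\<in>\<V>. \<forall>W\<in>\<V>. restr Y V (V \<inter> W) (\<sigma> V) = restr Y W (V \<inter> W) (\<sigma> W)) \<longrightarrow>
        (\<exists>!s. s \<in> carrier (sect Y (\<Union>\<V>)) \<and> (\<forall>V\<in>\<V>. restr Y (\<Union>\<V>) V s = \<sigma> V)))"

definition germ :: "('p, 'r) rspace \<Rightarrow> 'p \<Rightarrow> 'p set \<times> 'r \<Rightarrow> ('p set \<times> 'r) set" where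
  "germ Y y z = (case z of (V, s) \<Rightarrow>
     {(W, t). openin (spc Y) W \<and> y \<in> W \<and> t \<in> carrier (sect Y W) \<and>
        (\<exists>W'. openin (spc Y) W' \<and> y \<in> W' \<and> W' \<subseteq> V \<inter> W \<and> restr Y V W' s = restr Y W W' t)})"

text \<open>Every pair of germs at \<open>y\<close> has representatives on a common open neighbourhood of \<open>y\<close>.\<close>

definition stalk :: "('p, 'r) rspace \<Rightarrow> 'p \<Rightarrow> ('p set \<times> 'r) set ring" where
  "stalk Y y =
     \<lparr>carrier = {germ Y y (V, s) | V s. openin (spc Y) V \<and> y \<in> V \<and> s \<in> carrier (sect Y V)},
      monoid.mult = \<lambda>a b. \<Union>{germ Y y (V, s \<otimes>\<^bsub>sect Y V\<^esub> t) | V s t. (V, s) \<in> a \<and> (V, t) \<in> b},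
      one = germ Y y (topspace (spc Y), \<one>\<^bsub>sect Y (topspace (spc Y))\<^esub>),
      ring.zero = germ Y y (topspace (spc Y), \<zero>\<^bsub>sect Y (topspace (spc Y))\<^esub>),
      ring.add = \<lambda>a b. \<Union>{germ Y y (V, s \<oplus>\<^bsub>sect Y V\<^esub> t) | V s t. (V, s) \<in> a \<and> (V, t) \<in> b}\<rparr>"

definition locally_ringed :: "('p, 'r) rspace \<Rightarrow> bool" where
  "locally_ringed Y \<longleftrightarrow> ringed_space Y \<and> (\<forall>y\<in>topspace (spc Y). local_ring (stalk Y y))"

text \<open>
  A morphism \<open>X \<rightarrow> Y\<close> consists of the map on points and the maps
  \<open>smap \<phi> V : O\<^sub>Y(V) \<rightarrow> O\<^sub>X(\<phi>\<inverse> V)\<close>; both are \<open>undefined\<close> outside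
  their domain, so that each morphism has exactly one representation.
\<close>

record ('p, 'r, 'q, 't) rsmor =
  pmap :: "'p \<Rightarrow> 'q"
  smap :: "'q set \<Rightarrow> 't \<Rightarrow> 'r"

definition preimg :: "('p, 'r) rspace \<Rightarrow> ('p, 'r, 'q, 't) rsmor \<Rightarrow> 'q set \<Rightarrow> 'p set" where
  "preimg X \<phi> V = {x \<in> topspace (spc X). pmap \<phi> x \<in> V}"

definition stalk_map ::
  "('p, 'r) rspace \<Rightarrow> ('p, 'r, 'q, 't) rsmor \<Rightarrow> 'p \<Rightarrow> ('q set \<times> 't) set \<Rightarrow> ('p set \<times> 'r) set" where
  "stalk_map X \<phi> x a = (\<Union>(V, s)\<in>a. germ X x (preimg X \<phi> V, smap \<phi> V s))"

definition rs_mor ::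
  "('p, 'r) rspace \<Rightarrow> ('q, 't) rspace \<Rightarrow> ('p, 'r, 'q, 't) rsmor \<Rightarrow> bool" where
  "rs_mor X Y \<phi> \<longleftrightarrow>
     continuous_map (spc X) (spc Y) (pmap \<phi>) \<and> pmap \<phi> \<in> extensional (topspace (spc X)) \<and>
     (\<forall>V. openin (spc Y) V \<longrightarrow> smap \<phi> V \<in> ring_hom (sect Y V) (sect X (preimg X \<phi> V))) \<and>
     (\<forall>V W. openin (spc Y) V \<longrightarrow> openin (spc Y) W \<longrightarrow> W \<subseteq> V \<longrightarrow> (\<forall>s\<in>carrier (sect Y V).
        smap \<phi> W (restr Y V W s) = restr X (preimg X \<phi> V) (preimg X \<phi> W) (smap \<phi> V s))) \<and>
     (\<forall>V s. \<not> (openin (spc Y) V \<and> s \<in> carrier (sect Y V)) \<longrightarrow> smap \<phi> V s = undefined)"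

definition lrs_mor ::
  "('p, 'r) rspace \<Rightarrow> ('q, 't) rspace \<Rightarrow> ('p, 'r, 'q, 't) rsmor \<Rightarrow> bool" where
  "lrs_mor X Y \<phi> \<longleftrightarrow> rs_mor X Y \<phi> \<and>
     (\<forall>x\<in>topspace (spc X). \<forall>a\<in>carrier (stalk Y (pmap \<phi> x)).
        stalk_map X \<phi> x a \<in> Units (stalk X x) \<longrightarrow> a \<in> Units (stalk Y (pmap \<phi> x)))"

definition id_mor :: "('p, 'r) rspace \<Rightarrow> ('p, 'r, 'p, 'r) rsmor" where
  "id_mor X =
     \<lparr>pmap = \<lambda>x\<in>topspace (spc X). x,
      smap = \<lambda>V s. if openin (spc X) V \<and> s \<in> carrier (sect X V) then s else undefined\<rparr>"

definition comp_mor ::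
  "('p, 'r) rspace \<Rightarrow> ('q, 't) rspace \<Rightarrow> ('a, 'b) rspace \<Rightarrow>
   ('q, 't, 'a, 'b) rsmor \<Rightarrow> ('p, 'r, 'q, 't) rsmor \<Rightarrow> ('p, 'r, 'a, 'b) rsmor" where
  "comp_mor X Y Z \<psi> \<phi> =
     \<lparr>pmap = \<lambda>x\<in>topspace (spc X). pmap \<psi> (pmap \<phi> x),
      smap = \<lambda>V s. if openin (spc Z) V \<and> s \<in> carrier (sect Z V)
                   then smap \<phi> (preimg Y \<psi> V) (smap \<psi> V s) else undefined\<rparr>"

definition rs_isomorphic :: "('p, 'r) rspace \<Rightarrow> ('q, 't) rspace \<Rightarrow> bool" where
  "rs_isomorphic X Y \<longleftrightarrow>
     (\<exists>\<phi>. rs_mor X Y \<phi> \<and> homeomorphic_map (spc X) (spc Y) (pmap \<phi>) \<and>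
        (\<forall>V. openin (spc Y) V \<longrightarrow>
           bij_betw (smap \<phi> V) (carrier (sect Y V)) (carrier (sect X (preimg X \<phi> V)))))"

definition open_subspace :: "('p, 'r) rspace \<Rightarrow> 'p set \<Rightarrow> ('p, 'r) rspace" where
  "open_subspace Y V = Y\<lparr>spc := subtopology (spc Y) V\<rparr>"

subsection \<open>Affine schemes and schemes\<close>

definition Spec_open :: "'r ring \<Rightarrow> 'r set set \<Rightarrow> bool" where
  "Spec_open R V \<longleftrightarrow> (\<exists>E\<subseteq>carrier R. V = {P. primeideal P R \<and> \<not> E \<subseteq> P})"

lemma istopology_Spec:
  "istopology (Spec_open R)"
  unfolding istopology_def
proof (intro conjI allI impI)
  fix S T assume "Spec_open R S" "Spec_open R T"
  then obtain E F where E: "E \<subseteq> carrier R" "S = {P. primeideal P R \<and> \<not> E \<subseteq> P}"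
    and F: "F \<subseteq> carrier R" "T = {P. primeideal P R \<and> \<not> F \<subseteq> P}"
    unfolding Spec_open_def by blast
  let ?G = "{x \<otimes>\<^bsub>R\<^esub> y | x y. x \<in> E \<and> y \<in> F}"
  have eq: "(\<not> ?G \<subseteq> P) \<longleftrightarrow> (\<not> E \<subseteq> P \<and> \<not> F \<subseteq> P)" if "primeideal P R" for P
  proof -
    interpret primeideal P R by fact
    show ?thesis
    proof
      assume "\<not> ?G \<subseteq> P"
      then obtain x y where "x \<in> E" "y \<in> F" "x \<otimes>\<^bsub>R\<^esub> y \<notin> P" by blast
      then show "\<not> E \<subseteq> P \<and> \<not> F \<subseteq> P"
        using E(1) F(1) I_l_closed I_r_closed by blast
    next
      assume "\<not> E \<subseteq> P \<and> \<not> F \<subseteq> P"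
      then obtain x y where "x \<in> E" "y \<in> F" "x \<notin> P" "y \<notin> P" by blast
      then show "\<not> ?G \<subseteq> P"
        using E(1) F(1) I_prime by blast
    qed
  qed
  have "?G \<subseteq> carrier R \<or> S \<inter> T = {}"
  proof (cases "\<exists>P. primeideal P R")
    case True
    then obtain P where "primeideal P R" by blast
    then interpret primeideal P R .
    show ?thesis using E(1) F(1) by (blast intro: m_closed)
  qed (use E F in auto)
  moreover have "S \<inter> T = {P. primeideal P R \<and> \<not> ?G \<subseteq> P}"
    using eq E(2) F(2) by blast
  moreover have "S \<inter> T = {} \<Longrightarrow> S \<inter> T = {P. primeideal P R \<and> \<not> {} \<subseteq> P}"
    by simp
  ultimately show "Spec_open R (S \<inter> T)"
    unfolding Spec_open_def by (elim disjE) (rule exI[of _ ?G], simp, rule exI[of _ "{}"], simp)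
next
  fix \<K> assume "\<forall>K\<in>\<K>. Spec_open R K"
  from bchoice[OF this[unfolded Spec_open_def]]
  obtain E where E0: "\<forall>K\<in>\<K>. E K \<subseteq> carrier R \<and> K = {P. primeideal P R \<and> \<not> E K \<subseteq> P}" ..
  then have E: "E K \<subseteq> carrier R" if "K \<in> \<K>" for K
    using that by blast
  have "P \<in> \<Union>\<K> \<longleftrightarrow> primeideal P R \<and> \<not> (\<Union>K\<in>\<K>. E K) \<subseteq> P" for P
  proof -
    have "P \<in> K \<longleftrightarrow> primeideal P R \<and> \<not> E K \<subseteq> P" if "K \<in> \<K>" for K
    proof -
      from bspec[OF E0 that] have "K = {P. primeideal P R \<and> \<not> E K \<subseteq> P}" by (rule conjunct2)
      then have "P \<in> K \<longleftrightarrow> P \<in> {P. primeideal P R \<and> \<not> E K \<subseteq> P}" by (rule arg_cong)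
      then show ?thesis by simp
    qed
    then show ?thesis by (simp only: Union_iff UN_subset_iff) blast
  qed
  then have "\<Union>\<K> = {P. primeideal P R \<and> \<not> (\<Union>K\<in>\<K>. E K) \<subseteq> P}"
    by blast
  moreover have "(\<Union>K\<in>\<K>. E K) \<subseteq> carrier R"
    using E by blast
  ultimately show "Spec_open R (\<Union>\<K>)"
    unfolding Spec_open_def by (intro exI[of _ "\<Union>K\<in>\<K>. E K"] conjI)
qed

definition Spec_top :: "'r ring \<Rightarrow> 'r set topology" where
  "Spec_top R = topology (Spec_open R)"

lemma openin_Spec_top: "openin (Spec_top R) = Spec_open R"
  unfolding Spec_top_def by (rule topology_inverse'[OF istopology_Spec])

definition Spec_sections :: "'r ring \<Rightarrow> 'r set set \<Rightarrow> ('r set \<Rightarrow> ('r \<times> 'r) set) set" where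
  "Spec_sections R V = {\<sigma> \<in> (\<Pi>\<^sub>E P\<in>V. carrier (ring_at R P)).
     \<forall>P\<in>V. \<exists>W. openin (Spec_top R) W \<and> P \<in> W \<and> W \<subseteq> V \<and>
       (\<exists>a\<in>carrier R. \<exists>s\<in>carrier R. \<forall>Q\<in>W. s \<notin> Q \<and> \<sigma> Q = frac R Q (a, s))}"

definition Spec :: "'r ring \<Rightarrow> ('r set, 'r set \<Rightarrow> ('r \<times> 'r) set) rspace" where
  "Spec R =
     \<lparr>spc = Spec_top R,
      sect = \<lambda>V.
        \<lparr>carrier = Spec_sections R V,
         monoid.mult = \<lambda>\<sigma> \<tau>. \<lambda>P\<in>V. \<sigma> P \<otimes>\<^bsub>ring_at R P\<^esub> \<tau> P,
         one = \<lambda>P\<in>V. \<one>\<^bsub>ring_at R P\<^esub>,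
         ring.zero = \<lambda>P\<in>V. \<zero>\<^bsub>ring_at R P\<^esub>,
         ring.add = \<lambda>\<sigma> \<tau>. \<lambda>P\<in>V. \<sigma> P \<oplus>\<^bsub>ring_at R P\<^esub> \<tau> P\<rparr>,
      restr = \<lambda>V W \<sigma>. restrict \<sigma> W\<rparr>"

definition affine_open :: "('p, 'r) rspace \<Rightarrow> 'p set \<Rightarrow> bool" where
  "affine_open Y V \<longleftrightarrow> openin (spc Y) V \<and> rs_isomorphic (open_subspace Y V) (Spec (sect Y V))"

definition scheme :: "('p, 'r) rspace \<Rightarrow> bool" where
  "scheme Y \<longleftrightarrow> locally_ringed Y \<and> (\<forall>y\<in>topspace (spc Y). \<exists>V. affine_open Y V \<and> y \<in> V)"

definition noetherian_scheme :: "('p, 'r) rspace \<Rightarrow> bool" where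
  "noetherian_scheme Y \<longleftrightarrow> scheme Y \<and>
     (\<exists>\<V>. finite \<V> \<and> \<Union>\<V> = topspace (spc Y) \<and>
        (\<forall>V\<in>\<V>. affine_open Y V \<and> noetherian_ring (sect Y V)))"

definition reduced_scheme :: "('p, 'r) rspace \<Rightarrow> bool" where
  "reduced_scheme Y \<longleftrightarrow> scheme Y \<and>
     (\<forall>V. openin (spc Y) V \<longrightarrow> (\<forall>s\<in>carrier (sect Y V). \<forall>k::nat.
        s [^]\<^bsub>sect Y V\<^esub> k = \<zero>\<^bsub>sect Y V\<^esub> \<longrightarrow> s = \<zero>\<^bsub>sect Y V\<^esub>))"

definition irreducible_subset :: "'p topology \<Rightarrow> 'p set \<Rightarrow> bool" where
  "irreducible_subset T S \<longleftrightarrow> S \<noteq> {} \<and> S \<subseteq> topspace T \<and>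
     (\<forall>F G. closedin T F \<longrightarrow> closedin T G \<longrightarrow> S \<subseteq> F \<union> G \<longrightarrow> S \<subseteq> F \<or> S \<subseteq> G)"

definition irreducible_scheme :: "('p, 'r) rspace \<Rightarrow> bool" where
  "irreducible_scheme Y \<longleftrightarrow> irreducible_subset (spc Y) (topspace (spc Y))"

definition finite_dimensional :: "('p, 'r) rspace \<Rightarrow> bool" where
  "finite_dimensional Y \<longleftrightarrow>
     (\<exists>N. \<forall>n Z. (\<forall>i\<le>n. closedin (spc Y) (Z i) \<and> irreducible_subset (spc Y) (Z i)) \<and>
        (\<forall>i<n. Z i \<subset> Z (Suc i)) \<longrightarrow> n \<le> (N::nat))"

definition open_immersion ::
  "('p, 'r) rspace \<Rightarrow> ('q, 't) rspace \<Rightarrow> ('p, 'r, 'q, 't) rsmor \<Rightarrow> bool" where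
  "open_immersion X Y j \<longleftrightarrow> lrs_mor X Y j \<and>
     (let V = pmap j ` topspace (spc X) in
        openin (spc Y) V \<and> homeomorphic_map (spc X) (subtopology (spc Y) V) (pmap j) \<and>
        (\<forall>W. openin (spc Y) W \<longrightarrow> W \<subseteq> V \<longrightarrow>
           bij_betw (smap j W) (carrier (sect Y W)) (carrier (sect X (preimg X j W)))))"

definition closed_immersion ::
  "('p, 'r) rspace \<Rightarrow> ('q, 't) rspace \<Rightarrow> ('p, 'r, 'q, 't) rsmor \<Rightarrow> bool" where
  "closed_immersion X Y i \<longleftrightarrow> lrs_mor X Y i \<and>
     (let Z = pmap i ` topspace (spc X) in
        closedin (spc Y) Z \<and> homeomorphic_map (spc X) (subtopology (spc Y) Z) (pmap i) \<and>
        (\<forall>x\<in>topspace (spc X).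
           stalk_map X i x ` carrier (stalk Y (pmap i x)) = carrier (stalk X x)))"

text \<open>
  Separatedness over the integers: the diagonal \<open>X \<rightarrow> X \<times> X\<close> is a closed immersion.  The
  product is sought among schemes on the type \<open>'s set\<close>, which is large enough to carry it (the
  product of Noetherian schemes on \<open>'s\<close> need not live on \<open>'s\<close> itself).
\<close>

definition separated :: "('s, 's) rspace \<Rightarrow> bool" where
  "separated X \<longleftrightarrow>
     (\<exists>(P :: ('s set, 's set) rspace) p q \<delta>.
        scheme P \<and> lrs_mor P X p \<and> lrs_mor P X q \<and>
        (\<forall>(T :: ('s set, 's set) rspace) f g. scheme T \<longrightarrow> lrs_mor T X f \<longrightarrow> lrs_mor T X g \<longrightarrow>
           (\<exists>!h. lrs_mor T P h \<and> comp_mor T P X p h = f \<and> comp_mor T P X q h = g)) \<and>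
        closed_immersion X P \<delta> \<and>
        comp_mor X P X p \<delta> = id_mor X \<and> comp_mor X P X q \<delta> = id_mor X)"

subsection \<open>Smooth and etale morphisms\<close>

definition algebra_map ::
  "('p, 'r) rspace \<Rightarrow> ('p, 'r, 'q, 't) rsmor \<Rightarrow> 'q set \<Rightarrow> 'p set \<Rightarrow> 't \<Rightarrow> 'r" where
  "algebra_map Y f V W s = restr Y (preimg Y f V) W (smap f V s)"

definition finite_type ::
  "('s, 's) rspace \<Rightarrow> ('s, 's) rspace \<Rightarrow> ('s, 's, 's, 's) rsmor \<Rightarrow> bool" where
  "finite_type Y X f \<longleftrightarrow>
     (\<forall>x\<in>topspace (spc X). \<exists>V \<W>. affine_open X V \<and> x \<in> V \<and> finite \<W> \<and> \<Union>\<W> = preimg Y f V \<and>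
        (\<forall>W\<in>\<W>. affine_open Y W \<and> alg_finite_type (sect X V) (sect Y W) (algebra_map Y f V W)))"

text \<open>
  Smooth means locally of finite presentation and formally smooth, etale means smooth and formally
  unramified.  All schemes to which this is applied are Noetherian, so that finite presentation is
  the same as finite type.
\<close>

definition smooth ::
  "('s, 's) rspace \<Rightarrow> ('s, 's) rspace \<Rightarrow> ('s, 's, 's, 's) rsmor \<Rightarrow> bool" where
  "smooth Y X f \<longleftrightarrow> lrs_mor Y X f \<and>
     (\<forall>y\<in>topspace (spc Y). \<exists>V W. affine_open X V \<and> affine_open Y W \<and> y \<in> W \<and> W \<subseteq> preimg Y f V \<and>
        alg_finite_type (sect X V) (sect Y W) (algebra_map Y f V W) \<and>
        formally_smooth (sect X V) (sect Y W) (algebra_map Y f V W))"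

definition etale ::
  "('s, 's) rspace \<Rightarrow> ('s, 's) rspace \<Rightarrow> ('s, 's, 's, 's) rsmor \<Rightarrow> bool" where
  "etale Y X f \<longleftrightarrow> lrs_mor Y X f \<and>
     (\<forall>y\<in>topspace (spc Y). \<exists>V W. affine_open X V \<and> affine_open Y W \<and> y \<in> W \<and> W \<subseteq> preimg Y f V \<and>
        alg_finite_type (sect X V) (sect Y W) (algebra_map Y f V W) \<and>
        formally_smooth (sect X V) (sect Y W) (algebra_map Y f V W) \<and>
        formally_unramified (sect X V) (sect Y W) (algebra_map Y f V W))"

subsection \<open>The Nisnevich site\<close>

text \<open>
  An object of \<open>Sm X\<close> is a scheme with its structure morphism.  Points and sections are
  elements of one type \<open>'s\<close>; if \<open>'s\<close> is infinite and carries the Noetherian scheme \<open>X\<close>, then every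
  scheme of finite type over \<open>X\<close> is isomorphic to one carried by \<open>'s\<close>.
\<close>

type_synonym 's smobj = "('s, 's) rspace \<times> ('s, 's, 's, 's) rsmor"
type_synonym 's smarr = "'s smobj \<times> ('s, 's, 's, 's) rsmor \<times> 's smobj"

definition is_smooth_scheme :: "('s, 's) rspace \<Rightarrow> 's smobj \<Rightarrow> bool" where
  "is_smooth_scheme X Y \<longleftrightarrow>
     scheme (fst Y) \<and> finite_type (fst Y) X (snd Y) \<and> smooth (fst Y) X (snd Y)"

definition Sm :: "('s, 's) rspace \<Rightarrow> ('s smobj, 's smarr) cat" where
  "Sm X =
     \<lparr>Obj = {Y. is_smooth_scheme X Y},
      Arr = {(Y, \<phi>, Z). is_smooth_scheme X Y \<and> is_smooth_scheme X Z \<and> lrs_mor (fst Y) (fst Z) \<phi> \<and>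
                        comp_mor (fst Y) (fst Z) X (snd Z) \<phi> = snd Y},
      Dom = (\<lambda>(Y, \<phi>, Z). Y),
      Cod = (\<lambda>(Y, \<phi>, Z). Z),
      Idn = (\<lambda>Y. (Y, id_mor (fst Y), Y)),
      Cmp = (\<lambda>(Y, \<psi>, Z) (V, \<phi>, Y'). (V, comp_mor (fst V) (fst Y) (fst Z) \<psi> \<phi>, Z))\<rparr>"

text \<open>
  The residue field map \<open>\<kappa>(f(x)) \<rightarrow> \<kappa>(x)\<close> is an isomorphism; being a map of fields it
  is injective, so that only surjectivity is required.
\<close>

definition residue_iso ::
  "('p, 'r) rspace \<Rightarrow> ('q, 't) rspace \<Rightarrow> ('p, 'r, 'q, 't) rsmor \<Rightarrow> 'p \<Rightarrow> bool" where
  "residue_iso X Y f x \<longleftrightarrow>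
     (\<forall>b\<in>carrier (stalk X x). \<exists>a\<in>carrier (stalk Y (pmap f x)).
        stalk_map X f x a \<ominus>\<^bsub>stalk X x\<^esub> b \<notin> Units (stalk X x))"

definition nisnevich_cover :: "('s, 's) rspace \<Rightarrow> 's smobj \<Rightarrow> 's smarr set \<Rightarrow> bool" where
  "nisnevich_cover X V \<C> \<longleftrightarrow>
     (\<forall>(Y, f, V')\<in>\<C>. (Y, f, V') \<in> Arr (Sm X) \<and> V' = V \<and> etale (fst Y) (fst V) f) \<and>
     (\<forall>v\<in>topspace (spc (fst V)). \<exists>(Y, f, V')\<in>\<C>. \<exists>y\<in>topspace (spc (fst Y)).
        pmap f y = v \<and> residue_iso (fst Y) (fst V) f y)"

text \<open>
  The projection \<open>Y \<times> \<A>\<^sup>1 \<rightarrow> Y\<close>, characterized by its universal property: maps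
  into the affine line over \<open>Y\<close> are given by the pullback \<open>s\<close> of the coordinate \<open>t\<close>.
\<close>

definition affine_line :: "('s, 's) rspace \<Rightarrow> 's smarr \<Rightarrow> bool" where
  "affine_line X p \<longleftrightarrow> p \<in> Arr (Sm X) \<and>
     (\<exists>t. t \<in> carrier (sect (fst (Dom (Sm X) p)) (topspace (spc (fst (Dom (Sm X) p))))) \<and>
        (\<forall>V g s. g \<in> homset (Sm X) V (Cod (Sm X) p) \<longrightarrow>
           s \<in> carrier (sect (fst V) (topspace (spc (fst V)))) \<longrightarrow>
           (\<exists>!h. h \<in> homset (Sm X) V (Dom (Sm X) p) \<and> Cmp (Sm X) p h = g \<and>
              smap (fst (snd h)) (topspace (spc (fst (Dom (Sm X) p)))) t = s)))"

subsection \<open>Codimension\<close>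

text \<open>The generic points of (the irreducible components of) a closed subset \<open>Z\<close>.\<close>

definition generic_points :: "('p, 'r) rspace \<Rightarrow> 'p set \<Rightarrow> 'p set" where
  "generic_points Y Z =
     {z \<in> Z. irreducible_subset (spc Y) (spc Y closure_of {z}) \<and>
        (\<forall>S. irreducible_subset (spc Y) S \<longrightarrow> S \<subseteq> Z \<longrightarrow> spc Y closure_of {z} \<subseteq> S \<longrightarrow>
           S = spc Y closure_of {z})}"

definition codim :: "('p, 'r) rspace \<Rightarrow> 'p set \<Rightarrow> enat" where
  "codim Y Z = (INF z\<in>generic_points Y Z. krull_dim (stalk Y z))"


section \<open>The motivic model structure and its localizations\<close>

abbreviation MM ::
  "'u set set \<Rightarrow> ('s, 's) rspace
   \<Rightarrow> (('s smobj, 's smarr, 'u) spsh, ('s smobj, 's smarr, 'u) psarr) cat" where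
  "MM \<UU> X \<equiv> psh_cat \<UU> (Sm X)"

definition A1_maps ::
  "('s, 's) rspace \<Rightarrow> ('s smarr option \<Rightarrow> 'u) \<Rightarrow> ('s smobj, 's smarr, 'u) psarr set" where
  "A1_maps X enc = {represented_arr (Sm X) enc p | p. affine_line X p}"

text \<open>
  Following Jardine, the motivic fibrant objects are the globally fibrant objects \<open>W\<close> for which
  the maps \<open>W(Y) \<rightarrow> W(Y \<times> \<A>\<^sup>1)\<close> are weak equivalences, and motivic weak equivalences
  are detected by mapping into them.
\<close>

definition motivic_fibrant ::
  "'u set set \<Rightarrow> ('s, 's) rspace \<Rightarrow> ('s smarr option \<Rightarrow> 'u) \<Rightarrow> ('s smobj, 's smarr, 'u) spsh set" where
  "motivic_fibrant \<UU> X enc =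
     local_objects (Sm X) (globally_fibrant \<UU> (Sm X) enc (nisnevich_cover X)) (A1_maps X enc)"

definition motivic_weqs ::
  "'u set set \<Rightarrow> ('s, 's) rspace \<Rightarrow> ('s smarr option \<Rightarrow> 'u) \<Rightarrow> ('s smobj, 's smarr, 'u) psarr set" where
  "motivic_weqs \<UU> X enc = local_equivalences \<UU> (Sm X) (motivic_fibrant \<UU> X enc)"

definition motivic_fibs ::
  "'u set set \<Rightarrow> ('s, 's) rspace \<Rightarrow> ('s smarr option \<Rightarrow> 'u) \<Rightarrow> ('s smobj, 's smarr, 'u) psarr set" where
  "motivic_fibs \<UU> X enc = fibrations \<UU> (Sm X) (motivic_weqs \<UU> X enc)"

definition WB ::
  "('s, 's) rspace \<Rightarrow> ('s smarr option \<Rightarrow> 'u) \<Rightarrow> nat \<Rightarrow> ('s smobj, 's smarr, 'u) psarr set" where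
  "WB X enc n =
     {represented_arr (Sm X) enc (U, j, Y) | U j Y.
        (U, j, Y) \<in> Arr (Sm X) \<and> open_immersion (fst U) (fst Y) j \<and> irreducible_scheme (fst Y) \<and>
        (\<exists>Z i. (Z, i, Y) \<in> Arr (Sm X) \<and> closed_immersion (fst Z) (fst Y) i \<and>
           reduced_scheme (fst Z) \<and>
           pmap i ` topspace (spc (fst Z)) =
             topspace (spc (fst Y)) - pmap j ` topspace (spc (fst U))) \<and>
        codim (fst Y) (topspace (spc (fst Y)) - pmap j ` topspace (spc (fst U))) \<ge> enat (n + 1)}"

definition WB_weqs ::
  "'u set set \<Rightarrow> ('s, 's) rspace \<Rightarrow> ('s smarr option \<Rightarrow> 'u) \<Rightarrow> nat
   \<Rightarrow> ('s smobj, 's smarr, 'u) psarr set" where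
  "WB_weqs \<UU> X enc n =
     local_equivalences \<UU> (Sm X)
       (local_objects (Sm X) (motivic_fibrant \<UU> X enc) (WB X enc n))"

definition WB_fibs ::
  "'u set set \<Rightarrow> ('s, 's) rspace \<Rightarrow> ('s smarr option \<Rightarrow> 'u) \<Rightarrow> nat
   \<Rightarrow> ('s smobj, 's smarr, 'u) psarr set" where
  "WB_fibs \<UU> X enc n = fibrations \<UU> (Sm X) (WB_weqs \<UU> X enc n)"


section \<open>The slice tower\<close>

text \<open>
  Given maps \<open>tm A : A \<rightarrow> *\<close> to a terminal object and functorial factorizations \<open>\<gamma> n\<close>, put
  \<open>\<tau> 0 A = *\<close> and factor \<open>A \<rightarrow> \<tau> n A\<close> by \<open>\<gamma> n\<close> as \<open>A \<rightarrow> \<tau> (n + 1) A \<rightarrow> \<tau> n A\<close>.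
  Thus the maps \<open>A \<rightarrow> \<tau> n A\<close> and the functors \<open>\<tau> n\<close> agree with the usual ones for \<open>n \<ge> 1\<close>.
\<close>

primrec tau_le :: "('o \<Rightarrow> 'm) \<Rightarrow> (nat \<Rightarrow> 'm ffact) \<Rightarrow> nat \<Rightarrow> 'o \<Rightarrow> 'm" where
  "tau_le tm \<gamma> 0 A = tm A"
| "tau_le tm \<gamma> (Suc n) A = lft (\<gamma> n) (tau_le tm \<gamma> n A)"

definition nu :: "('o \<Rightarrow> 'm) \<Rightarrow> (nat \<Rightarrow> 'm ffact) \<Rightarrow> nat \<Rightarrow> 'o \<Rightarrow> 'm" where
  "nu tm \<gamma> n A = rgt (\<gamma> n) (tau_le tm \<gamma> n A)"

primrec tau_arr :: "('o, 'm) cat \<Rightarrow> ('o \<Rightarrow> 'm) \<Rightarrow> (nat \<Rightarrow> 'm ffact) \<Rightarrow> nat \<Rightarrow> 'm \<Rightarrow> 'm" where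
  "tau_arr C tm \<gamma> 0 f = Idn C (Cod C (tm (Dom C f)))"
| "tau_arr C tm \<gamma> (Suc n) f =
     mid (\<gamma> n) (tau_le tm \<gamma> n (Dom C f)) (tau_le tm \<gamma> n (Cod C f)) f (tau_arr C tm \<gamma> n f)"

definition tau ::
  "('o, 'm) cat \<Rightarrow> ('o \<Rightarrow> 'm) \<Rightarrow> (nat \<Rightarrow> 'm ffact) \<Rightarrow> nat \<Rightarrow> ('o, 'm, 'o, 'm) func" where
  "tau C tm \<gamma> n = \<lparr>fob = \<lambda>A. Cod C (tau_le tm \<gamma> n A), far = tau_arr C tm \<gamma> n\<rparr>"

end

theory Submission
  imports Defs
begin

text \<open>
  The functors \<open>\<tau> n\<close> and all naturality statements come from the functorial factorizations; limits of
  towers of presheaves exist because sequences of elements of small sets can be coded in the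
  universe.  The point is that \<open>\<tau> n\<close> and \<open>lim \<tau> n\<close> descend to the homotopy category.  All the
  localizations have the same cofibrations, hence the same trivial fibrations.  If \<open>f : A \<rightarrow> B\<close> is a
  motivic weak equivalence, then \<open>\<tau> (n + 1) f\<close> is a weak equivalence in \<open>WB n\<close>, and the maps \<open>\<nu> n\<close>
  are fibrations there.  Factoring the map of towers \<open>\<tau> f\<close> level by level, in the \<open>n\<close>-th localization at
  level \<open>n + 1\<close>, as a map with a retraction followed by a (Reedy) trivial fibration, and repeating this
  for the retraction, shows that the limit of \<open>\<tau> f\<close> is invertible in the homotopy category.  Constant
  towers give the same for the single functors \<open>\<tau> n\<close>.  Since the tower already consists of fibrations
  between fibrant objects, its limit is the homotopy limit.
\<close>

section \<open>Categories and localization\<close>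

text \<open>Descent along \<open>Ho\<close> is the hard point. By the universal property of the
  localization it suffices that the maps induced by a motivic weak equivalence become isomorphisms
  in the homotopy category; nothing stronger is claimed for them. The obstacle is that a map of
  towers is a weak equivalence at level n + 1 only in the n-th localization: the structure changes
  with the level, while the limit has to be examined in one fixed category. What the levels share
  are the maps in \<open>rlp C Cf\<close>, and these are inverted by \<open>Ho\<close>. Trivial
  cofibrations do not pass to limits, but equations such as r i = 1 do. So the cofibration half of
  each factorization is first converted into an equation, by choosing a retraction, and only
  equations and members of \<open>rlp C Cf\<close> are carried to the limit. Level 0 is the terminal
  object: it turns the first fibrant replacement into an ordinary step of the tower and explains why
  the n-th structure governs level n + 1.\<close>

locale categ =
  fixes C :: "('o, 'm) cat"
  assumes category: "category C"
begin

abbreviation hom where "hom \<equiv> homset C"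
abbreviation cmp (infixr "\<cdot>" 70) where "g \<cdot> f \<equiv> Cmp C g f"

lemma hom_obj: "f \<in> hom a b \<Longrightarrow> a \<in> Obj C \<and> b \<in> Obj C"
  using category unfolding category_def homset_def by blast

lemma arr_hom: "f \<in> Arr C \<Longrightarrow> f \<in> hom (Dom C f) (Cod C f)"
  unfolding homset_def by simp

lemma dom_obj [simp]: "f \<in> Arr C \<Longrightarrow> Dom C f \<in> Obj C"
  and cod_obj [simp]: "f \<in> Arr C \<Longrightarrow> Cod C f \<in> Obj C"
  using hom_obj arr_hom by blast+

lemma hom_arr: "f \<in> hom a b \<Longrightarrow> f \<in> Arr C"
  unfolding homset_def by simp

lemma hom_dom [simp]: "f \<in> hom a b \<Longrightarrow> Dom C f = a"
  and hom_cod [simp]: "f \<in> hom a b \<Longrightarrow> Cod C f = b"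
  unfolding homset_def by simp_all

lemma id_hom [simp, intro]: "a \<in> Obj C \<Longrightarrow> Idn C a \<in> hom a a"
  using category unfolding category_def by blast

lemma comp_hom [intro]: "g \<in> hom b c \<Longrightarrow> f \<in> hom a b \<Longrightarrow> g \<cdot> f \<in> hom a c"
  using category hom_arr hom_dom hom_cod unfolding category_def by metis

lemma id_l: "f \<in> hom a b \<Longrightarrow> Idn C b \<cdot> f = f"
  and id_r: "f \<in> hom a b \<Longrightarrow> f \<cdot> Idn C a = f"
  using category unfolding category_def homset_def by auto

lemma assoc: "h \<in> hom c d \<Longrightarrow> g \<in> hom b c \<Longrightarrow> f \<in> hom a b \<Longrightarrow> (h \<cdot> g) \<cdot> f = h \<cdot> g \<cdot> f"
  using category unfolding category_def homset_def by simp

end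

section \<open>Isomorphisms and chosen inverses\<close>

definition isomorphism :: "('o, 'm) cat \<Rightarrow> 'm \<Rightarrow> bool" where
  "isomorphism C f \<longleftrightarrow> f \<in> Arr C \<and>
     (\<exists>g \<in> homset C (Cod C f) (Dom C f).
        Cmp C g f = Idn C (Dom C f) \<and> Cmp C f g = Idn C (Cod C f))"

definition inv_arr :: "('o, 'm) cat \<Rightarrow> 'm \<Rightarrow> 'm" where
  "inv_arr C f = (SOME g. g \<in> homset C (Cod C f) (Dom C f) \<and>
     Cmp C g f = Idn C (Dom C f) \<and> Cmp C f g = Idn C (Cod C f))"

context categ
begin

lemma inv_arr:
  assumes "f \<in> hom a b" "isomorphism C f"
  shows "inv_arr C f \<in> hom b a" "inv_arr C f \<cdot> f = Idn C a" "f \<cdot> inv_arr C f = Idn C b"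
proof -
  have "\<exists>g. g \<in> homset C (Cod C f) (Dom C f) \<and>
     Cmp C g f = Idn C (Dom C f) \<and> Cmp C f g = Idn C (Cod C f)"
    using assms(2) unfolding isomorphism_def by blast
  from someI_ex[OF this, folded inv_arr_def] assms(1)
  show "inv_arr C f \<in> hom b a" "inv_arr C f \<cdot> f = Idn C a" "f \<cdot> inv_arr C f = Idn C b"
    by simp_all
qed

lemma isomorphismI:
  assumes "f \<in> hom a b" "g \<in> hom b a" "g \<cdot> f = Idn C a" "f \<cdot> g = Idn C b"
  shows "isomorphism C f"
  using assms hom_arr unfolding isomorphism_def by fastforce

lemma left_right_inverse_eq:
  assumes f: "f \<in> hom a b" and g: "g \<in> hom b a" "g \<cdot> f = Idn C a" and h: "h \<in> hom b a" "f \<cdot> h = Idn C b"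
  shows "g = h"
  using assoc[OF g(1) f h(1)] g h id_l id_r by metis

lemma isomorphism_left_right:
  assumes f: "f \<in> hom a b" and g: "g \<in> hom b a" "g \<cdot> f = Idn C a" and h: "h \<in> hom b a" "f \<cdot> h = Idn C b"
  shows "isomorphism C f"
  using left_right_inverse_eq[OF assms] isomorphismI[OF f g] h by simp

lemma isomorphism_comp:
  assumes f: "f \<in> hom a b" "isomorphism C f" and g: "g \<in> hom b c" "isomorphism C g"
  shows "isomorphism C (g \<cdot> f)"
proof (rule isomorphismI)
  let ?f = "inv_arr C f" and ?g = "inv_arr C g"
  note F = inv_arr[OF f] and G = inv_arr[OF g]
  show "g \<cdot> f \<in> hom a c" "?f \<cdot> ?g \<in> hom c a"
    using f g F G by blast+
  have "(?f \<cdot> ?g) \<cdot> g \<cdot> f = ?f \<cdot> (?g \<cdot> g) \<cdot> f"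
    using assoc[OF F(1) G(1) comp_hom[OF g(1) f(1)]] assoc[OF G(1) g(1) f(1)] by simp
  then show "(?f \<cdot> ?g) \<cdot> g \<cdot> f = Idn C a"
    using F(2) G(2) id_l[OF f(1)] by simp
  have "(g \<cdot> f) \<cdot> ?f \<cdot> ?g = g \<cdot> (f \<cdot> ?f) \<cdot> ?g"
    using assoc[OF g(1) f(1) comp_hom[OF F(1) G(1)]] assoc[OF f(1) F(1) G(1)] by simp
  then show "(g \<cdot> f) \<cdot> ?f \<cdot> ?g = Idn C c"
    using F(3) G(3) id_l[OF G(1)] by simp
qed

lemma isomorphism_inv_arr:
  assumes "f \<in> hom a b" "isomorphism C f"
  shows "isomorphism C (inv_arr C f)"
  using inv_arr[OF assms] assms(1) isomorphismI by blast

text \<open>The shape of two-out-of-six in which factorizations with retractions enter below.\<close>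

lemma isomorphism_two_of_six:
  assumes a: "a \<in> hom A B" and b: "b \<in> hom B D" and c: "c \<in> hom D B" and q: "q \<in> hom D A"
    and qba: "q \<cdot> b \<cdot> a = Idn C A" and cb: "c \<cdot> b = Idn C B" and iso: "isomorphism C q"
  shows "isomorphism C a"
proof -
  note Q = inv_arr[OF q iso]
  have ba: "b \<cdot> a = inv_arr C q"
    using left_right_inverse_eq[OF q Q(1,2) comp_hom[OF b a] qba] by simp
  \<comment> \<open>c is a left inverse of b, and a q is a right inverse because b a is the inverse
    of q.\<close>
  have "isomorphism C b"
  proof (rule isomorphism_left_right[OF b c cb])
    show "a \<cdot> q \<in> hom D B" using a q by blast
    show "b \<cdot> a \<cdot> q = Idn C D"
      using assoc[OF b a q] ba Q(2) by simp
  qed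
  note B = inv_arr[OF b this]
  have "a = inv_arr C b \<cdot> inv_arr C q"
    using assoc[OF B(1) b a] B(2) id_l[OF a] ba by simp
  then show ?thesis
    using isomorphism_comp[OF Q(1) isomorphism_inv_arr[OF q iso] B(1) isomorphism_inv_arr[OF b]]
      \<open>isomorphism C b\<close> by simp
qed

end

section \<open>Functors and natural transformations\<close>

lemma functor_hom:
  "is_functor C D F \<Longrightarrow> f \<in> homset C a b \<Longrightarrow> far F f \<in> homset D (fob F a) (fob F b)"
  unfolding is_functor_def homset_def by auto

lemma functor_obj: "is_functor C D F \<Longrightarrow> a \<in> Obj C \<Longrightarrow> fob F a \<in> Obj D"
  unfolding is_functor_def by blast

lemma functor_id: "is_functor C D F \<Longrightarrow> a \<in> Obj C \<Longrightarrow> far F (Idn C a) = Idn D (fob F a)"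
  unfolding is_functor_def by blast

lemma functor_cmp:
  "is_functor C D F \<Longrightarrow> f \<in> homset C a b \<Longrightarrow> g \<in> homset C b c \<Longrightarrow>
   far F (Cmp C g f) = Cmp D (far F g) (far F f)"
  unfolding is_functor_def homset_def by auto

lemma functor_comp:
  assumes "is_functor C D F" "is_functor D E G"
  shows "is_functor C E (comp_func G F)"
  using assms unfolding is_functor_def comp_func_def homset_def by auto

lemma functor_id_func: "category C \<Longrightarrow> is_functor C C id_func"
  unfolding is_functor_def id_func_def category_def homset_def by auto

lemma nat_trans_hom: "nat_trans C D F G \<eta> \<Longrightarrow> a \<in> Obj C \<Longrightarrow> \<eta> a \<in> homset D (fob F a) (fob G a)"
  unfolding nat_trans_def by blast

lemma nat_trans_sq:
  "nat_trans C D F G \<eta> \<Longrightarrow> f \<in> homset C a b \<Longrightarrow> Cmp D (\<eta> b) (far F f) = Cmp D (far G f) (\<eta> a)"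
  unfolding nat_trans_def homset_def by auto

lemma (in categ) nat_transI:
  assumes "\<And>a. a \<in> Obj C \<Longrightarrow> \<eta> a \<in> homset D (fob F a) (fob G a)"
    and "\<And>f a b. f \<in> hom a b \<Longrightarrow> Cmp D (\<eta> b) (far F f) = Cmp D (far G f) (\<eta> a)"
  shows "nat_trans C D F G \<eta>"
  unfolding nat_trans_def using assms arr_hom by blast

lemma (in categ) functorI:
  assumes "\<And>a. a \<in> Obj C \<Longrightarrow> fob F a \<in> Obj D"
    and "\<And>a. a \<in> Obj C \<Longrightarrow> far F (Idn C a) = Idn D (fob F a)"
    and "\<And>f a b. f \<in> hom a b \<Longrightarrow> far F f \<in> homset D (fob F a) (fob F b)"
    and "\<And>f g a b c. f \<in> hom a b \<Longrightarrow> g \<in> hom b c \<Longrightarrow> far F (g \<cdot> f) = Cmp D (far F g) (far F f)"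
  shows "is_functor C D F"
  unfolding is_functor_def using assms arr_hom by metis

subsection \<open>Zigzags\<close>

locale localized = categ C for C :: "('o, 'm) cat" +
  fixes W :: "'m set"
  assumes W_arr: "W \<subseteq> Arr C"
begin

abbreviation "H \<equiv> localization C W"
abbreviation "Ho \<equiv> loc_func C W"
abbreviation "zz \<equiv> zigzag C W"

text \<open>The equivalence relation behind \<open>zigzag_class\<close>. Both words of a step must
  be zigzags from a to b, so the class of a zigzag consists of zigzags with the same ends.\<close>

definition zrel :: "'o \<Rightarrow> 'o \<Rightarrow> (('m + 'm) list \<times> ('m + 'm) list) set" where
  "zrel a b = {(us, vs). zz a us b \<and> zz a vs b \<and> (zigzag_step C W us vs \<or> zigzag_step C W vs us)}\<^sup>*"

definition cl :: "'o \<Rightarrow> 'o \<Rightarrow> ('m + 'm) list \<Rightarrow> ('o, 'm) loc_arr" where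
  "cl a b xs = (a, zigzag_class C W a b xs, b)"

lemma zigzag_class_zrel: "zigzag_class C W a b xs = zrel a b `` {xs}"
  unfolding zigzag_class_def zrel_def ..

lemma zz_obj: "zz a xs b \<Longrightarrow> a \<in> Obj C \<and> b \<in> Obj C"
proof (induction xs arbitrary: a)
  case (Cons x xs)
  then have "x \<in> Inl ` Arr C \<union> Inr ` (W \<inter> Arr C)" "letter_dom C x = a" "b \<in> Obj C"
    by auto
  then show ?case by auto
qed auto

lemma zz_append: "zz a (xs @ ys) c \<longleftrightarrow> (\<exists>b. zz a xs b \<and> zz b ys c)"
proof (induction xs arbitrary: a)
  case Nil
  then show ?case using zz_obj by auto
qed auto

lemma zrel_refl [simp]: "(xs, xs) \<in> zrel a b"
  unfolding zrel_def by simp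

lemma zrel_sym: "(xs, ys) \<in> zrel a b \<Longrightarrow> (ys, xs) \<in> zrel a b"
proof -
  have "sym {(us, vs). zz a us b \<and> zz a vs b \<and> (zigzag_step C W us vs \<or> zigzag_step C W vs us)}"
    by (auto intro: symI)
  from sym_rtrancl[OF this] show "(xs, ys) \<in> zrel a b \<Longrightarrow> (ys, xs) \<in> zrel a b"
    unfolding zrel_def sym_def by blast
qed

lemma zrel_trans: "(xs, ys) \<in> zrel a b \<Longrightarrow> (ys, zs) \<in> zrel a b \<Longrightarrow> (xs, zs) \<in> zrel a b"
  unfolding zrel_def by (rule rtrancl_trans)

lemma zrel_zz: "(xs, ys) \<in> zrel a b \<Longrightarrow> zz a xs b \<Longrightarrow> zz a ys b"
  unfolding zrel_def by (erule rtranclE) auto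

lemma cl_eq_iff: "cl a b xs = cl a b ys \<longleftrightarrow> (xs, ys) \<in> zrel a b"
  unfolding cl_def zigzag_class_zrel using zrel_refl zrel_sym zrel_trans by blast

text \<open>Every rewriting rule already carries a context on both sides, which absorbs a larger
  one. This is what makes the relation a congruence for concatenation.\<close>

lemma step_context: "zigzag_step C W us vs \<Longrightarrow> zigzag_step C W (p @ us @ q) (p @ vs @ q)"
proof (induction rule: zigzag_step.induct)
  case (1 a xs ys)
  then show ?case using zigzag_step.intros(1)[of a C W "p @ xs" "ys @ q"] by simp
next
  case (2 f g xs ys)
  then show ?case using zigzag_step.intros(2)[of f C g W "p @ xs" "ys @ q"] by simp
next
  case (3 w xs ys)
  then show ?case using zigzag_step.intros(3)[of w W C "p @ xs" "ys @ q"] by simp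
next
  case (4 w xs ys)
  then show ?case using zigzag_step.intros(4)[of w W C "p @ xs" "ys @ q"] by simp
qed

lemma zrel_context:
  assumes "(us, vs) \<in> zrel b c" "zz a p b" "zz c q d"
  shows "(p @ us @ q, p @ vs @ q) \<in> zrel a d"
  using assms(1) unfolding zrel_def
proof (induction rule: rtrancl_induct)
  case (step ys zs)
  have "zz a (p @ xs @ q) d" if "zz b xs c" for xs
    using that assms(2,3) zz_append by blast
  then show ?case
    using step step_context by (intro rtrancl_into_rtrancl[OF step.IH]) auto
qed simp

lemma H_Obj [simp]: "Obj H = Obj C"
  and H_Dom [simp]: "Dom H (cl a b xs) = a"
  and H_Cod [simp]: "Cod H (cl a b xs) = b"
  and H_Idn: "Idn H a = cl a a []"
  unfolding localization_def cl_def by simp_all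

lemma H_homE:
  assumes "f \<in> homset H a b"
  obtains xs where "zz a xs b" "f = cl a b xs"
  using assms unfolding homset_def localization_def cl_def by fastforce

lemma cl_hom: "zz a xs b \<Longrightarrow> cl a b xs \<in> homset H a b"
  unfolding homset_def localization_def cl_def by auto

text \<open>The union in the definition of composition runs over all pairs of representatives. It
  collapses to a single class because representatives may be exchanged one factor at a time inside
  the concatenated word.\<close>

lemma H_Cmp:
  assumes xs: "zz a xs b" and ys: "zz b ys c"
  shows "Cmp H (cl b c ys) (cl a b xs) = cl a c (xs @ ys)"
proof -
  have eq: "zigzag_class C W a c (us @ vs) = zigzag_class C W a c (xs @ ys)"
    if "us \<in> zigzag_class C W a b xs" "vs \<in> zigzag_class C W b c ys" for us vs
  proof -
    have us: "(xs, us) \<in> zrel a b" and vs: "(ys, vs) \<in> zrel b c"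
      using that unfolding zigzag_class_zrel by auto
    have "(xs @ ys, us @ ys) \<in> zrel a c"
      using zrel_context[OF us, of a "[]" ys c] ys zz_obj[OF xs] by simp
    moreover have "(us @ ys, us @ vs) \<in> zrel a c"
      using zrel_context[OF vs, of a us "[]" c] zrel_zz[OF us xs] zz_obj[OF ys] by simp
    ultimately have "cl a c (xs @ ys) = cl a c (us @ vs)"
      unfolding cl_eq_iff by (rule zrel_trans)
    then show ?thesis unfolding cl_def by simp
  qed
  have "xs \<in> zigzag_class C W a b xs" "ys \<in> zigzag_class C W b c ys"
    unfolding zigzag_class_zrel by auto
  then have "(\<Union>us\<in>zigzag_class C W a b xs. \<Union>vs\<in>zigzag_class C W b c ys. zigzag_class C W a c (us @ vs)) =
      zigzag_class C W a c (xs @ ys)"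
    using eq by blast
  then show ?thesis
    unfolding cl_def localization_def by simp
qed

lemma H_category: "category H"
proof -
  have dc: "Dom H f \<in> Obj H \<and> Cod H f \<in> Obj H" if "f \<in> Arr H" for f
    using that zz_obj unfolding localization_def by fastforce
  have h: "f \<in> homset H (Dom H f) (Cod H f)" if "f \<in> Arr H" for f
    using that unfolding homset_def by simp
  have idh: "Idn H a \<in> homset H a a" if "a \<in> Obj H" for a
    using that unfolding H_Idn by (intro cl_hom) simp
  have comp: "Cmp H g f \<in> homset H a c" if "f \<in> homset H a b" "g \<in> homset H b c" for f g a b c
  proof -
    obtain xs ys where "zz a xs b" "f = cl a b xs" "zz b ys c" "g = cl b c ys"
      using \<open>f \<in> homset H a b\<close> \<open>g \<in> homset H b c\<close> by (elim H_homE)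
    then show ?thesis
      using H_Cmp cl_hom zz_append by metis
  qed
  have ident: "Cmp H f (Idn H a) = f \<and> Cmp H (Idn H b) f = f" if f: "f \<in> homset H a b" for f a b
  proof -
    obtain xs where xs: "zz a xs b" "f = cl a b xs"
      using f by (rule H_homE)
    then show ?thesis
      using H_Cmp[OF _ xs(1), of a "[]"] H_Cmp[OF xs(1), of "[]"] zz_obj[OF xs(1)]
      by (simp add: H_Idn)
  qed
  have ass: "Cmp H k (Cmp H g f) = Cmp H (Cmp H k g) f"
    if f: "f \<in> homset H a b" and g: "g \<in> homset H b c" and k: "k \<in> homset H c d" for f g k a b c d
  proof -
    obtain xs ys zs where "zz a xs b" "f = cl a b xs" "zz b ys c" "g = cl b c ys"
      "zz c zs d" "k = cl c d zs"
      using f g k by (elim H_homE)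
    moreover from this have "zz a (xs @ ys) c" "zz b (ys @ zs) d"
      using zz_append by blast+
    ultimately show ?thesis by (simp add: H_Cmp)
  qed
  have hc: "f \<in> homset H (Dom H f) b" if "f \<in> Arr H" "Cod H f = b" for f b
    using h[OF that(1)] unfolding that(2) .
  show ?thesis
    unfolding category_def
  proof (intro conjI ballI impI)
    fix f assume f: "f \<in> Arr H"
    show "Dom H f \<in> Obj H" "Cod H f \<in> Obj H" using dc[OF f] by auto
    show "Cmp H f (Idn H (Dom H f)) = f" "Cmp H (Idn H (Cod H f)) f = f"
      using ident[OF h[OF f]] by auto
    fix g assume g: "g \<in> Arr H" and fg: "Cod H f = Dom H g"
    show "Cmp H g f \<in> homset H (Dom H f) (Cod H g)"
      by (rule comp[OF hc[OF f fg] h[OF g]])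
    fix k assume k: "k \<in> Arr H" and gk: "Cod H g = Dom H k"
    show "Cmp H k (Cmp H g f) = Cmp H (Cmp H k g) f"
      by (rule ass[OF hc[OF f fg] hc[OF g gk] h[OF k]])
  qed (rule idh)
qed

sublocale H: categ H
  by standard (rule H_category)

lemma Ho_fob [simp]: "fob Ho a = a"
  unfolding loc_func_def by simp

lemma Ho_far: "f \<in> hom a b \<Longrightarrow> far Ho f = cl a b [Inl f]"
  unfolding loc_func_def cl_def by simp

lemma zz_arr: "f \<in> hom a b \<Longrightarrow> zz a [Inl f] b"
  using hom_obj hom_arr by fastforce

lemma zz_inv: "w \<in> hom a b \<Longrightarrow> w \<in> W \<Longrightarrow> zz b [Inr w] a"
  using hom_obj hom_arr by fastforce

lemma step_zrel: "zigzag_step C W us vs \<Longrightarrow> zz a us b \<Longrightarrow> zz a vs b \<Longrightarrow> (us, vs) \<in> zrel a b"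
  unfolding zrel_def by (intro r_into_rtrancl) auto

lemma Ho_functor: "is_functor C H Ho"
proof (rule functorI)
  show "far Ho (Idn C a) = Idn H (fob Ho a)" if a: "a \<in> Obj C" for a
  proof -
    have "zigzag_step C W [Inl (Idn C a)] []"
      using zigzag_step.intros(1)[OF a, of W "[]" "[]"] by simp
    from step_zrel[OF this zz_arr[OF id_hom[OF a]]] a show ?thesis
      using Ho_far[OF id_hom[OF a]] by (simp add: H_Idn cl_eq_iff)
  qed
  show "far Ho f \<in> homset H (fob Ho a) (fob Ho b)" if "f \<in> hom a b" for f a b
    using that Ho_far cl_hom zz_arr by simp
  show "far Ho (g \<cdot> f) = Cmp H (far Ho g) (far Ho f)" if f: "f \<in> hom a b" and g: "g \<in> hom b c" for f g a b c
  proof -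
    have gf: "g \<cdot> f \<in> hom a c" using f g by blast
    have "zz a [Inl f, Inl g] c"
      using zz_append[of a "[Inl f]" "[Inl g]" c] zz_arr f g by fastforce
    moreover have "zigzag_step C W [Inl f, Inl g] [Inl (g \<cdot> f)]"
      using zigzag_step.intros(2)[of f C g W "[]" "[]"] hom_arr f g by simp
    ultimately have "([Inl f, Inl g], [Inl (g \<cdot> f)]) \<in> zrel a c"
      using step_zrel zz_arr[OF gf] by blast
    then have "cl a c [Inl (g \<cdot> f)] = cl a c [Inl f, Inl g]"
      using zrel_sym cl_eq_iff by blast
    then show ?thesis
      using H_Cmp[OF zz_arr[OF f] zz_arr[OF g]] Ho_far f g gf by simp
  qed
qed simp

lemma Ho_hom: "f \<in> hom a b \<Longrightarrow> far Ho f \<in> homset H a b"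
  using functor_hom[OF Ho_functor] by simp

lemma Ho_cmp: "f \<in> hom a b \<Longrightarrow> g \<in> hom b c \<Longrightarrow> far Ho (g \<cdot> f) = Cmp H (far Ho g) (far Ho f)"
  using functor_cmp[OF Ho_functor] by simp

lemma Ho_id: "a \<in> Obj C \<Longrightarrow> far Ho (Idn C a) = Idn H a"
  using functor_id[OF Ho_functor] by simp

lemma Ho_inverse:
  assumes w: "w \<in> hom a b" "w \<in> W"
  shows "cl b a [Inr w] \<in> homset H b a" "Cmp H (cl b a [Inr w]) (far Ho w) = Idn H a"
    "Cmp H (far Ho w) (cl b a [Inr w]) = Idn H b"
proof -
  have ab: "a \<in> Obj C" "b \<in> Obj C" using hom_obj w(1) by auto
  note zw = zz_arr[OF w(1)] and zi = zz_inv[OF w]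
  show "cl b a [Inr w] \<in> homset H b a" using cl_hom[OF zi] .
  have "zz a ([Inl w] @ [Inr w]) a" "zz b ([Inr w] @ [Inl w]) b"
    using zz_append zw zi by blast+
  moreover have "zigzag_step C W [Inl w, Inr w] []" "zigzag_step C W [Inr w, Inl w] []"
    using zigzag_step.intros(3,4)[of w W C "[]" "[]"] w by auto
  ultimately have "([Inl w, Inr w], []) \<in> zrel a a" "([Inr w, Inl w], []) \<in> zrel b b"
    using step_zrel ab by auto
  then show "Cmp H (cl b a [Inr w]) (far Ho w) = Idn H a"
    "Cmp H (far Ho w) (cl b a [Inr w]) = Idn H b"
    using H_Cmp[OF zw zi] H_Cmp[OF zi zw] Ho_far[OF w(1)] by (simp_all add: H_Idn cl_eq_iff)
qed

lemma Ho_isomorphism: "w \<in> W \<Longrightarrow> isomorphism H (far Ho w)"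
  using H.isomorphismI[OF Ho_hom Ho_inverse] arr_hom W_arr by blast

lemma inv_Ho: "w \<in> hom a b \<Longrightarrow> w \<in> W \<Longrightarrow> inv_arr H (far Ho w) = cl b a [Inr w]"
  using H.left_right_inverse_eq[OF Ho_hom H.inv_arr(1,2)[OF Ho_hom Ho_isomorphism] Ho_inverse(1,3)]
  by simp

text \<open>Words are read from the source, so removing the first letter splits off a factor on the
  right of a composite. Induction on words thereby becomes induction on arrows, which is how
  naturality over the localization is reduced to arrows of C.\<close>

lemma H_induct [consumes 1, case_names Id Arr Inv]:
  assumes "f \<in> homset H a b"
    and "\<And>a. a \<in> Obj C \<Longrightarrow> P a a (Idn H a)"
    and "\<And>f g a b c. f \<in> hom a b \<Longrightarrow> g \<in> homset H b c \<Longrightarrow> P b c g \<Longrightarrow> P a c (Cmp H g (far Ho f))"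
    and "\<And>w g a b c. w \<in> hom a b \<Longrightarrow> w \<in> W \<Longrightarrow> g \<in> homset H a c \<Longrightarrow> P a c g \<Longrightarrow>
           P b c (Cmp H g (inv_arr H (far Ho w)))"
  shows "P a b f"
proof -
  have "P a b (cl a b xs)" if "zz a xs b" for xs
    using that
  proof (induction xs arbitrary: a)
    case Nil
    then show ?case using assms(2)[of a] by (auto simp: H_Idn)
  next
    case (Cons x xs)
    then have zx: "zz (letter_cod C x) xs b" by simp
    note IH = Cons.IH[OF zx]
    show ?case
    proof (cases x)
      case (Inl g)
      then have g: "g \<in> hom a (Cod C g)" using Cons.prems arr_hom by auto
      have "zz (Cod C g) xs b" "P (Cod C g) b (cl (Cod C g) b xs)" using zx IH Inl by auto
      from assms(3)[OF g cl_hom[OF this(1)] this(2)] H_Cmp[OF zz_arr[OF g] this(1)] show ?thesis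
        using Inl Ho_far[OF g] by simp
    next
      case (Inr w)
      then have w: "w \<in> hom (Dom C w) a" "w \<in> W" using Cons.prems arr_hom by auto
      have "zz (Dom C w) xs b" "P (Dom C w) b (cl (Dom C w) b xs)" using zx IH Inr by auto
      from assms(4)[OF w cl_hom[OF this(1)] this(2)] H_Cmp[OF zz_inv[OF w] this(1)] show ?thesis
        using Inr inv_Ho[OF w] by simp
    qed
  qed
  with assms(1) H_homE show ?thesis by metis
qed

text \<open>Commuting squares paste along composition, and a square over an invertible arrow also
  commutes for the inverse. So naturality on the images of arrows of C spreads along
  zigzags.\<close>

lemma nat_trans_localized:
  assumes F: "is_functor H H F" and G: "is_functor H H G"
    and \<eta>: "\<And>a. a \<in> Obj C \<Longrightarrow> \<eta> a \<in> homset H (fob F a) (fob G a)"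
    and sq: "\<And>f a b. f \<in> hom a b \<Longrightarrow> Cmp H (\<eta> b) (far F (far Ho f)) = Cmp H (far G (far Ho f)) (\<eta> a)"
  shows "nat_trans H H F G \<eta>"
proof (rule H.nat_transI)
  show "\<eta> a \<in> homset H (fob F a) (fob G a)" if "a \<in> Obj H" for a
    using \<eta> that by simp
  have paste: "Cmp H (\<eta> c) (far F (Cmp H g f)) = Cmp H (far G (Cmp H g f)) (\<eta> a)"
    if f: "f \<in> homset H a b" and g: "g \<in> homset H b c"
      and sf: "Cmp H (\<eta> b) (far F f) = Cmp H (far G f) (\<eta> a)"
      and sg: "Cmp H (\<eta> c) (far F g) = Cmp H (far G g) (\<eta> b)" for f g a b c
  proof -
    have obj: "a \<in> Obj C" "b \<in> Obj C" "c \<in> Obj C" using H.hom_obj[OF f] H.hom_obj[OF g] by auto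
    note h = functor_hom[OF F f] functor_hom[OF F g] functor_hom[OF G f] functor_hom[OF G g]
      \<eta>[OF obj(1)] \<eta>[OF obj(2)] \<eta>[OF obj(3)]
    have "Cmp H (\<eta> c) (far F (Cmp H g f)) = Cmp H (Cmp H (\<eta> c) (far F g)) (far F f)"
      using functor_cmp[OF F f g] H.assoc[OF h(7,2,1)] by simp
    also have "\<dots> = Cmp H (far G g) (Cmp H (\<eta> b) (far F f))"
      using sg H.assoc[OF h(4,6,1)] by simp
    also have "\<dots> = Cmp H (far G (Cmp H g f)) (\<eta> a)"
      using sf functor_cmp[OF G f g] H.assoc[OF h(4,3,5)] by simp
    finally show ?thesis .
  qed
  show "Cmp H (\<eta> b) (far F f) = Cmp H (far G f) (\<eta> a)" if "f \<in> homset H a b" for f a b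
    using that
  proof (induction rule: H_induct)
    case (Id a)
    then show ?case
      using functor_id[OF F, of a] functor_id[OF G, of a] H.id_l[OF \<eta>] H.id_r[OF \<eta>] by simp
  next
    case (Arr f g a b c)
    then show ?case using paste[OF Ho_hom[OF Arr(1)] Arr(2)] sq by blast
  next
    case (Inv w g a b c)
    note w = Ho_hom[OF Inv(1)] and i = H.inv_arr[OF Ho_hom[OF Inv(1)] Ho_isomorphism[OF Inv(2)]]
    have obj: "a \<in> Obj C" "b \<in> Obj C" using hom_obj[OF Inv(1)] by auto
    let ?w = "far Ho w" and ?i = "inv_arr H (far Ho w)"
    have Fi: "far F ?i \<in> homset H (fob F b) (fob F a)" and Gi: "far G ?i \<in> homset H (fob G b) (fob G a)"
      and Fw: "far F ?w \<in> homset H (fob F a) (fob F b)" and Gw: "far G ?w \<in> homset H (fob G a) (fob G b)"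
      using functor_hom[OF F] functor_hom[OF G] w i(1) by auto
    note ea = \<eta>[OF obj(1)] and eb = \<eta>[OF obj(2)]
    \<comment> \<open>The identity G(i) G(w) is inserted on the left; naturality at w then exchanges
      \<eta> a for \<eta> b, and F(w) F(i) cancels.\<close>
    have "Cmp H (\<eta> a) (far F ?i) = Cmp H (Cmp H (far G ?i) (far G ?w)) (Cmp H (\<eta> a) (far F ?i))"
      using functor_cmp[OF G w i(1)] i(2) functor_id[OF G, of a] obj H.id_l[OF H.comp_hom[OF ea Fi]] by simp
    also have "\<dots> = Cmp H (far G ?i) (Cmp H (Cmp H (far G ?w) (\<eta> a)) (far F ?i))"
      using H.assoc[OF Gi Gw H.comp_hom[OF ea Fi]] H.assoc[OF Gw ea Fi] by simp
    also have "\<dots> = Cmp H (far G ?i) (Cmp H (\<eta> b) (Cmp H (far F ?w) (far F ?i)))"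
      using sq[OF Inv(1)] H.assoc[OF eb Fw Fi] by simp
    also have "\<dots> = Cmp H (far G ?i) (\<eta> b)"
      using functor_cmp[OF F i(1) w] i(3) functor_id[OF F, of b] obj H.id_r[OF eb] by simp
    finally show ?case using paste[OF i(1) Inv(3)] Inv(4) by blast
  qed
qed

text \<open>The uniqueness half of the universal property of the localization, from which the
  uniqueness of the functors on the homotopy category follows.\<close>

lemma functor_eq_localized:
  assumes F: "is_functor H H F" and G: "is_functor H H G"
    and eq: "functor_eq C (comp_func F Ho) (comp_func G Ho)"
  shows "functor_eq H F G"
proof -
  have o: "fob F a = fob G a" if "a \<in> Obj C" for a
    using eq that unfolding functor_eq_def comp_func_def by simp
  have a: "far F (far Ho f) = far G (far Ho f)" if "f \<in> hom a b" for f a b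
    using eq hom_arr[OF that] unfolding functor_eq_def comp_func_def by simp
  \<comment> \<open>equality on arrows is naturality of the identities\<close>
  have "nat_trans H H F G (\<lambda>a. Idn H (fob F a))"
  proof (rule nat_trans_localized[OF F G])
    show "Idn H (fob F a) \<in> homset H (fob F a) (fob G a)" if "a \<in> Obj C" for a
      using functor_obj[OF F, of a] that o by simp
    show "Cmp H (Idn H (fob F b)) (far F (far Ho f)) = Cmp H (far G (far Ho f)) (Idn H (fob F a))"
      if f: "f \<in> hom a b" for f a b
      using H.id_l[OF functor_hom[OF F Ho_hom[OF f]]] H.id_r[OF functor_hom[OF F Ho_hom[OF f]]]
        a[OF f] by simp
  qed
  then have "far F f = far G f" if f: "f \<in> homset H a b" for f a b
    using nat_trans_sq[OF _ f] H.id_l[OF functor_hom[OF F f]] H.id_r[OF functor_hom[OF G f]]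
      o H.hom_obj[OF f] by fastforce
  then show ?thesis
    unfolding functor_eq_def using o H.arr_hom by (metis H_Obj)
qed

end

subsection \<open>Functors inverting weak equivalences\<close>

text \<open>The object argument matters only at the end of the word, where it selects the identity;
  each letter replaces it by its own target.\<close>

primrec zigzag_eval ::
  "('o, 'm) cat \<Rightarrow> ('p, 'n) cat \<Rightarrow> ('o, 'm, 'p, 'n) func \<Rightarrow> 'o \<Rightarrow> ('m + 'm) list \<Rightarrow> 'n" where
  "zigzag_eval C D F a [] = Idn D (fob F a)"
| "zigzag_eval C D F a (x # xs) =
     Cmp D (zigzag_eval C D F (letter_cod C x) xs)
       (case x of Inl f \<Rightarrow> far F f | Inr w \<Rightarrow> inv_arr D (far F w))"

text \<open>A class is evaluated on an arbitrary representative. If F inverts W, then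
  \<open>ev_zrel\<close> shows that the choice does not affect the value.\<close>

definition localized_func ::
  "('o, 'm) cat \<Rightarrow> ('p, 'n) cat \<Rightarrow> ('o, 'm, 'p, 'n) func \<Rightarrow> ('o, ('o, 'm) loc_arr, 'p, 'n) func" where
  "localized_func C D F =
     \<lparr>fob = fob F, far = \<lambda>(a, p, b). zigzag_eval C D F a (SOME xs. xs \<in> p)\<rparr>"

locale inverting_functor = localized C W + D: categ D
  for C :: "('o, 'm) cat" and W and D :: "('p, 'n) cat" +
  fixes F :: "('o, 'm, 'p, 'n) func"
  assumes F: "is_functor C D F"
    and inverts_W: "\<And>w. w \<in> W \<Longrightarrow> isomorphism D (far F w)"
begin

abbreviation "ev \<equiv> zigzag_eval C D F"

lemma letter_hom:
  assumes "x \<in> Inl ` Arr C \<union> Inr ` (W \<inter> Arr C)"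
  shows "(case x of Inl f \<Rightarrow> far F f | Inr w \<Rightarrow> inv_arr D (far F w)) \<in>
    homset D (fob F (letter_dom C x)) (fob F (letter_cod C x))"
  using assms functor_hom[OF F arr_hom] D.inv_arr(1)[OF functor_hom[OF F arr_hom] inverts_W] by auto

lemma ev_hom: "zz a xs b \<Longrightarrow> ev a xs \<in> homset D (fob F a) (fob F b)"
proof (induction xs arbitrary: a)
  case Nil
  then show ?case using functor_obj[OF F] by auto
next
  case (Cons x xs)
  then show ?case using letter_hom[of x] by auto
qed

lemma ev_append:
  assumes "zz a xs b" "zz b ys c"
  shows "ev a (xs @ ys) = Cmp D (ev b ys) (ev a xs)"
  using assms(1)
proof (induction xs arbitrary: a)
  case Nil
  then show ?case using D.id_r[OF ev_hom[OF assms(2)]] by simp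
next
  case (Cons x xs)
  then have zx: "zz (letter_cod C x) xs b" by simp
  show ?case
    using Cons.prems Cons.IH[OF zx] D.assoc[OF ev_hom[OF assms(2)] ev_hom[OF zx] letter_hom[of x]] by simp
qed

lemma ev_step:
  assumes "zigzag_step C W us vs" "zz a us b" "zz a vs b"
  shows "ev a us = ev a vs"
proof -
  \<comment> \<open>Evaluation turns concatenation into composition, so only the rewritten middle
    fragment has to be compared, between whatever objects it connects.\<close>
  have core: "ev a (xs @ m @ ys) = ev a (xs @ m' @ ys)"
    if us: "zz a (xs @ m @ ys) b"
      and red: "\<And>c d. zz c m d \<Longrightarrow> zz c m' d \<and> ev c m = ev c m'" for xs m m' ys
  proof -
    obtain c d where z: "zz a xs c" "zz c m d" "zz d ys b"
      using us zz_append by metis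
    moreover from this red have "zz c m' d" "ev c m = ev c m'" by blast+
    moreover from calculation have "zz c (m @ ys) b" "zz c (m' @ ys) b"
      using zz_append by blast+
    ultimately show ?thesis by (simp add: ev_append)
  qed
  show ?thesis
    using assms(1,2)
  proof (induction rule: zigzag_step.induct)
    case (1 e xs ys)
    have "zz c [] d \<and> ev c [Inl (Idn C e)] = ev c []" if "zz c [Inl (Idn C e)] d" for c d
    proof -
      have "c = e" "d = e" using that id_hom[OF \<open>e \<in> Obj C\<close>] by auto
      then show ?thesis
        using \<open>e \<in> Obj C\<close> functor_id[OF F \<open>e \<in> Obj C\<close>] id_hom[OF \<open>e \<in> Obj C\<close>]
          D.id_l[OF D.id_hom[OF functor_obj[OF F \<open>e \<in> Obj C\<close>]]]
          hom_cod[OF id_hom[OF \<open>e \<in> Obj C\<close>]] by simp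
    qed
    then show ?case using core[of xs "[Inl (Idn C e)]" ys "[]"] 1 by simp
  next
    case (2 f g xs ys)
    have f: "f \<in> hom (Dom C f) (Cod C f)" and g: "g \<in> hom (Cod C f) (Cod C g)"
      using 2(1-3) unfolding homset_def by auto
    have "zz c [Inl (g \<cdot> f)] d \<and> ev c [Inl f, Inl g] = ev c [Inl (g \<cdot> f)]"
      if "zz c [Inl f, Inl g] d" for c d
    proof -
      have cd: "c = Dom C f" "d = Cod C g" using that by auto
      have "ev c [Inl f, Inl g] = Cmp D (far F g) (far F f)"
        using D.id_l[OF functor_hom[OF F g]] 2 by simp
      moreover have "ev c [Inl (g \<cdot> f)] = far F (g \<cdot> f)"
        using D.id_l[OF functor_hom[OF F comp_hom[OF g f]]] comp_hom[OF g f] by simp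
      ultimately show ?thesis
        using zz_arr[OF comp_hom[OF g f]] cd functor_cmp[OF F f g] hom_obj[OF g] by simp
    qed
    then show ?case using core[of xs "[Inl f, Inl g]" ys "[Inl (g \<cdot> f)]"] 2 by simp
  next
    case (3 w xs ys)
    have w: "w \<in> hom (Dom C w) (Cod C w)" using 3 arr_hom W_arr by blast
    note i = D.inv_arr[OF functor_hom[OF F w] inverts_W[OF 3(1)]]
    have "zz c [] d \<and> ev c [Inl w, Inr w] = ev c []" if "zz c [Inl w, Inr w] d" for c d
      using that D.id_l[OF i(1)] i(2) hom_obj[OF w] by auto
    then show ?case using core[of xs "[Inl w, Inr w]" ys "[]"] 3 by simp
  next
    case (4 w xs ys)
    have w: "w \<in> hom (Dom C w) (Cod C w)" using 4 arr_hom W_arr by blast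
    note i = D.inv_arr[OF functor_hom[OF F w] inverts_W[OF 4(1)]]
    have "zz c [] d \<and> ev c [Inr w, Inl w] = ev c []" if "zz c [Inr w, Inl w] d" for c d
      using that D.id_l[OF functor_hom[OF F w]] i(3) hom_obj[OF w] by auto
    then show ?case using core[of xs "[Inr w, Inl w]" ys "[]"] 4 by simp
  qed
qed

lemma ev_zrel: "(us, vs) \<in> zrel a b \<Longrightarrow> ev a us = ev a vs"
  unfolding zrel_def
proof (induction rule: rtrancl_induct)
  case (step ys zs)
  then show ?case using ev_step[of ys zs a b] ev_step[of zs ys a b] by auto
qed simp

abbreviation "F' \<equiv> localized_func C D F"

lemma far_cl: "far F' (cl a b xs) = ev a xs"
proof -
  have "(SOME ys. ys \<in> zigzag_class C W a b xs) \<in> zigzag_class C W a b xs"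
    by (rule someI[of _ xs]) (simp add: zigzag_class_zrel)
  then have "(xs, SOME ys. ys \<in> zigzag_class C W a b xs) \<in> zrel a b"
    by (simp add: zigzag_class_zrel)
  from ev_zrel[OF this] show ?thesis
    unfolding localized_func_def cl_def by simp
qed

lemma fob_F' [simp]: "fob F' a = fob F a"
  unfolding localized_func_def by simp

lemma localized_functor: "is_functor H D F'"
proof (rule H.functorI)
  show "fob F' a \<in> Obj D" if "a \<in> Obj H" for a
    using functor_obj[OF F] that by simp
  show "far F' (Idn H a) = Idn D (fob F' a)" for a
    by (simp add: H_Idn far_cl)
  show "far F' f \<in> homset D (fob F' a) (fob F' b)" if "f \<in> homset H a b" for f a b
    using that ev_hom far_cl by (auto elim: H_homE)
  show "far F' (Cmp H g f) = Cmp D (far F' g) (far F' f)"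
    if f: "f \<in> homset H a b" and g: "g \<in> homset H b c" for f g a b c
  proof -
    obtain xs ys where "zz a xs b" "f = cl a b xs" "zz b ys c" "g = cl b c ys"
      using f g by (elim H_homE)
    then show ?thesis by (simp add: H_Cmp far_cl ev_append)
  qed
qed

lemma far_F'_Ho: "f \<in> hom a b \<Longrightarrow> far F' (far Ho f) = far F f"
  using Ho_far far_cl D.id_l[OF functor_hom[OF F]] by simp

end

section \<open>Limits of pointed simplicial presheaves\<close>

lemma universe_infinite: "grothendieck_universe \<UU> \<Longrightarrow> \<exists>A\<in>\<UU>. infinite A"
  unfolding grothendieck_universe_def by (elim conjE)

lemma universe_subset: "grothendieck_universe \<UU> \<Longrightarrow> A \<in> \<UU> \<Longrightarrow> B \<subseteq> A \<Longrightarrow> B \<in> \<UU>"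
  unfolding grothendieck_universe_def by (elim conjE) simp

lemma universe_UN:
  "grothendieck_universe \<UU> \<Longrightarrow> A \<in> \<UU> \<Longrightarrow> (\<And>a. a \<in> A \<Longrightarrow> F a \<in> \<UU>) \<Longrightarrow> (\<Union>a\<in>A. F a) \<in> \<UU>"
  unfolding grothendieck_universe_def by (elim conjE) simp

lemma universe_Pow:
  "grothendieck_universe \<UU> \<Longrightarrow> A \<in> \<UU> \<Longrightarrow> \<exists>B\<in>\<UU>. \<exists>e :: 'u set \<Rightarrow> 'u. inj_on e (Pow A) \<and> e ` Pow A \<subseteq> B"
  for \<UU> :: "'u set set"
  unfolding grothendieck_universe_def by (elim conjE) simp

text \<open>
  If the infinite small set \<open>B\<close> contains all entries, then a sequence is a subset of
  \<open>\<nat> \<times> B\<close>, hence of \<open>B \<times> B \<cong> B\<close>.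
\<close>

lemma universe_sequences:
  fixes S :: "nat \<Rightarrow> 'u set"
  assumes U: "grothendieck_universe \<UU>" and S: "\<And>n. S n \<in> \<UU>"
  obtains e :: "(nat \<Rightarrow> 'u) \<Rightarrow> 'u" where "inj_on e {x. \<forall>n. x n \<in> S n}" "e ` {x. \<forall>n. x n \<in> S n} \<in> \<UU>"
proof -
  note sub = universe_subset[OF U] and union = universe_UN[OF U]
  obtain A where A: "A \<in> \<UU>" "infinite A"
    using universe_infinite[OF U] by blast
  obtain \<iota> :: "nat \<Rightarrow> 'u" where \<iota>: "inj \<iota>" "range \<iota> \<subseteq> A"
    using infinite_countable_subset[OF A(2)] by blast
  \<comment> \<open>Unions in the universe are indexed by small sets of elements of the type, so the
    naturals are replaced by their copy under \<iota> inside A.\<close>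
  have "(\<Union>a\<in>range \<iota>. S (inv_into UNIV \<iota> a)) \<in> \<UU>"
    using sub[OF A(1) \<iota>(2)] S by (rule union)
  moreover have "(\<Union>a\<in>range \<iota>. S (inv_into UNIV \<iota> a)) = (\<Union>n. S n)"
    using \<iota>(1) by simp
  ultimately have S': "(\<Union>n. S n) \<in> \<UU>" by simp
  define B where "B = A \<union> (\<Union>n. S n)"
  \<comment> \<open>A binary union also needs a small index set; its two elements must differ for
    the case distinction to reach both sets.\<close>
  have ne: "\<iota> 1 \<noteq> \<iota> 0" using \<iota>(1) by (simp add: inj_eq)
  have "(\<Union>a\<in>{\<iota> 0, \<iota> 1}. if a = \<iota> 0 then A else (\<Union>n. S n)) \<in> \<UU>"
    using sub[OF A(1), of "{\<iota> 0, \<iota> 1}"] \<iota>(2) A(1) S' by (intro union) auto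
  then have B: "B \<in> \<UU>"
    unfolding B_def using ne by simp
  have "infinite B" using A(2) unfolding B_def by simp
  from card_of_Times_same_infinite[OF this] obtain g where g: "bij_betw g (B \<times> B) B"
    using card_of_ordIso by blast
  obtain D e where D: "D \<in> \<UU>" and e: "inj_on e (Pow B)" "e ` Pow B \<subseteq> D"
    using universe_Pow[OF U B] by blast
  define G where "G x = g ` range (\<lambda>n. (\<iota> n, x n))" for x :: "nat \<Rightarrow> 'u"
  have sub_B: "range (\<lambda>n. (\<iota> n, x n)) \<subseteq> B \<times> B" if "\<forall>n. x n \<in> S n" for x
    using that \<iota>(2) unfolding B_def by auto
  have G_B: "G x \<in> Pow B" if "\<forall>n. x n \<in> S n" for x
    using sub_B[OF that] g unfolding G_def bij_betw_def by blast
  have "x = y" if x: "\<forall>n. x n \<in> S n" and y: "\<forall>n. y n \<in> S n" and eq: "G x = G y" for x y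
  proof
    fix n
    have "range (\<lambda>n. (\<iota> n, x n)) = range (\<lambda>n. (\<iota> n, y n))"
      using eq sub_B[OF x] sub_B[OF y] g unfolding G_def bij_betw_def
      by (meson inj_on_image_eq_iff)
    then have "(\<iota> n, x n) \<in> range (\<lambda>n. (\<iota> n, y n))" by blast
    then show "x n = y n" using \<iota>(1) by (auto dest: injD)
  qed
  then have "inj_on (e \<circ> G) {x. \<forall>n. x n \<in> S n}"
    using e(1) G_B unfolding inj_on_def by auto
  moreover have "(e \<circ> G) ` {x. \<forall>n. x n \<in> S n} \<in> \<UU>"
    using e(2) G_B by (intro sub[OF D]) auto
  ultimately show thesis by (rule that)
qed

section \<open>Maps of presheaves through their components\<close>

definition component :: "('o, 'f, 'u) psarr \<Rightarrow> 'o \<Rightarrow> nat \<Rightarrow> 'u \<Rightarrow> 'u" where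
  "component F = fst (snd F)"

text \<open>The normal form of an arrow. Because \<open>psh_arr\<close> prescribes
  \<open>undefined\<close> off the domain, arrows with equal components on the domain are
  equal.\<close>

definition psh_map ::
  "('o, 'f) cat \<Rightarrow> ('o, 'f, 'u) spsh \<Rightarrow> ('o \<Rightarrow> nat \<Rightarrow> 'u \<Rightarrow> 'u) \<Rightarrow> ('o, 'f, 'u) spsh \<Rightarrow> ('o, 'f, 'u) psarr"
  where
  "psh_map C A \<phi> B = (A, \<lambda>V n x. if V \<in> Obj C \<and> x \<in> val A V n then \<phi> V n x else undefined, B)"

lemma component_psh_map [simp]:
  "V \<in> Obj C \<Longrightarrow> x \<in> val A V n \<Longrightarrow> component (psh_map C A \<phi> B) V n x = \<phi> V n x"
  unfolding component_def psh_map_def by simp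

lemma psh_homI:
  assumes "is_spsh \<UU> C A" "is_spsh \<UU> C B"
    and "\<And>V n x. V \<in> Obj C \<Longrightarrow> x \<in> val A V n \<Longrightarrow> \<phi> V n x \<in> val B V n"
    and "\<And>V n. V \<in> Obj C \<Longrightarrow> \<phi> V n (bpt A V n) = bpt B V n"
    and "\<And>f \<theta> x. f \<in> Arr C \<Longrightarrow> \<theta> \<in> Arr Delta \<Longrightarrow> x \<in> val A (Cod C f) (Cod Delta \<theta>) \<Longrightarrow>
      \<phi> (Dom C f) (Dom Delta \<theta>) (act A f \<theta> x) = act B f \<theta> (\<phi> (Cod C f) (Cod Delta \<theta>) x)"
    and "\<And>f. f \<in> Arr C \<Longrightarrow> Dom C f \<in> Obj C \<and> Cod C f \<in> Obj C"
  shows "psh_map C A \<phi> B \<in> homset (psh_cat \<UU> C) A B"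
proof -
  have "bpt A V n \<in> val A V n" if "V \<in> Obj C" for V n
    using assms(1) that unfolding is_spsh_def by blast
  moreover have "act A f \<theta> x \<in> val A (Dom C f) (Dom Delta \<theta>)"
    if "f \<in> Arr C" "\<theta> \<in> Arr Delta" "x \<in> val A (Cod C f) (Cod Delta \<theta>)" for f \<theta> x
    using assms(1) that unfolding is_spsh_def by blast
  ultimately show ?thesis
    using assms unfolding homset_def psh_cat_def psh_arr_def psh_map_def by auto
qed

lemma psh_homD:
  assumes "F \<in> homset (psh_cat \<UU> C) A B"
  shows "F = psh_map C A (component F) B" "is_spsh \<UU> C A" "is_spsh \<UU> C B"
    and "V \<in> Obj C \<Longrightarrow> x \<in> val A V n \<Longrightarrow> component F V n x \<in> val B V n"
    and "V \<in> Obj C \<Longrightarrow> component F V n (bpt A V n) = bpt B V n"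
    and "f \<in> Arr C \<Longrightarrow> \<theta> \<in> Arr Delta \<Longrightarrow> x \<in> val A (Cod C f) (Cod Delta \<theta>) \<Longrightarrow>
      component F (Dom C f) (Dom Delta \<theta>) (act A f \<theta> x) =
      act B f \<theta> (component F (Cod C f) (Cod Delta \<theta>) x)"
proof -
  obtain \<phi> where F: "F = (A, \<phi>, B)" "psh_arr \<UU> C (A, \<phi>, B)"
    using assms unfolding homset_def psh_cat_def by (cases F) auto
  then have "\<phi> V n x = undefined" if "\<not> (V \<in> Obj C \<and> x \<in> val A V n)" for V n x
    using that unfolding psh_arr_def by blast
  then show "F = psh_map C A (component F) B"
    using F unfolding psh_map_def component_def by fastforce
  show "is_spsh \<UU> C A" "is_spsh \<UU> C B"
    "V \<in> Obj C \<Longrightarrow> x \<in> val A V n \<Longrightarrow> component F V n x \<in> val B V n"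
    "V \<in> Obj C \<Longrightarrow> component F V n (bpt A V n) = bpt B V n"
    "f \<in> Arr C \<Longrightarrow> \<theta> \<in> Arr Delta \<Longrightarrow> x \<in> val A (Cod C f) (Cod Delta \<theta>) \<Longrightarrow>
      component F (Dom C f) (Dom Delta \<theta>) (act A f \<theta> x) =
      act B f \<theta> (component F (Cod C f) (Cod Delta \<theta>) x)"
    using F unfolding component_def psh_arr_def by auto
qed

lemma psh_map_cong:
  assumes "\<And>V n x. V \<in> Obj C \<Longrightarrow> x \<in> val A V n \<Longrightarrow> \<phi> V n x = \<psi> V n x"
  shows "psh_map C A \<phi> B = psh_map C A \<psi> B"
proof -
  have "(\<lambda>V n x. if V \<in> Obj C \<and> x \<in> val A V n then \<phi> V n x else undefined) =
      (\<lambda>V n x. if V \<in> Obj C \<and> x \<in> val A V n then \<psi> V n x else undefined)"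
    by (rule ext)+ (simp add: assms)
  then show ?thesis unfolding psh_map_def by simp
qed

lemma psh_hom_eqI:
  assumes "F \<in> homset (psh_cat \<UU> C) A B" "G \<in> homset (psh_cat \<UU> C) A B"
    and "\<And>V n x. V \<in> Obj C \<Longrightarrow> x \<in> val A V n \<Longrightarrow> component F V n x = component G V n x"
  shows "F = G"
  by (rule trans[OF psh_homD(1)[OF assms(1)] trans[OF psh_map_cong psh_homD(1)[OF assms(2), symmetric]]])
    (rule assms(3))

lemma psh_Cmp:
  assumes "F \<in> homset (psh_cat \<UU> C) A B" "G \<in> homset (psh_cat \<UU> C) B D"
  shows "Cmp (psh_cat \<UU> C) G F = psh_map C A (\<lambda>V n x. component G V n (component F V n x)) D"
proof -
  obtain \<phi> \<psi> where "F = (A, \<phi>, B)" "G = (B, \<psi>, D)"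
    using assms unfolding homset_def psh_cat_def by (cases F; cases G) auto
  then show ?thesis
    unfolding psh_cat_def psh_map_def component_def by (simp cong: if_cong)
qed

lemma psh_Idn: "Idn (psh_cat \<UU> C) A = psh_map C A (\<lambda>V n x. x) A"
  unfolding psh_cat_def psh_map_def by simp

lemma psh_Obj: "A \<in> Obj (psh_cat \<UU> C) \<longleftrightarrow> is_spsh \<UU> C A"
  unfolding psh_cat_def by simp

text \<open>
  Forming limits of presheaves uses only sources and targets in the index category, so that the
  category axioms for \<open>Sm X\<close> do not have to be verified.
\<close>

locale presheaves =
  fixes \<UU> :: "'u set set" and C :: "('o, 'f) cat" and enc :: "'f option \<Rightarrow> 'u"
  assumes universe: "grothendieck_universe \<UU>"
    and enc_small: "range enc \<in> \<UU>"
    and Arr_Obj: "\<And>f. f \<in> Arr C \<Longrightarrow> Dom C f \<in> Obj C \<and> Cod C f \<in> Obj C"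
    and Idn_ends: "\<And>V. V \<in> Obj C \<Longrightarrow> Dom C (Idn C V) = V \<and> Cod C (Idn C V) = V"
    and Cmp_ends: "\<And>f g. f \<in> Arr C \<Longrightarrow> g \<in> Arr C \<Longrightarrow> Cod C f = Dom C g \<Longrightarrow>
      Dom C (Cmp C g f) = Dom C f \<and> Cod C (Cmp C g f) = Cod C g"
begin

abbreviation "M \<equiv> psh_cat \<UU> C"

lemma psh_comp:
  assumes F: "F \<in> homset M A B" and G: "G \<in> homset M B D"
  shows "Cmp M G F \<in> homset M A D"
  unfolding psh_Cmp[OF F G] using psh_homD[OF F] psh_homD[OF G] Arr_Obj
  by (intro psh_homI) auto

lemma component_Cmp:
  assumes "F \<in> homset M A B" "G \<in> homset M B D" "V \<in> Obj C" "x \<in> val A V n"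
  shows "component (Cmp M G F) V n x = component G V n (component F V n x)"
  unfolding psh_Cmp[OF assms(1,2)] using assms(3,4) by simp

lemma component_Idn [simp]:
  "V \<in> Obj C \<Longrightarrow> x \<in> val A V n \<Longrightarrow> component (Idn M A) V n x = x"
  unfolding psh_Idn by simp

lemma psh_id: "A \<in> Obj M \<Longrightarrow> Idn M A \<in> homset M A A"
  unfolding psh_Idn psh_Obj using Arr_Obj by (intro psh_homI) auto

lemma psh_category: "category M"
proof -
  have hom: "F \<in> homset M (Dom M F) (Cod M F)" if "F \<in> Arr M" for F
    using that unfolding homset_def by simp
  have obj: "A \<in> Obj M" "B \<in> Obj M" if "F \<in> homset M A B" for F A B
    using psh_homD(2,3)[OF that] unfolding psh_Obj by auto
  have il: "Cmp M (Idn M B) F = F" and ir: "Cmp M F (Idn M A) = F" if F: "F \<in> homset M A B" for F A B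
    using psh_id[OF obj(1)[OF F]] psh_id[OF obj(2)[OF F]] F
    by (auto intro!: psh_hom_eqI[of _ \<UU> C A B] psh_comp simp: component_Cmp psh_homD(4))
  have assoc: "Cmp M K (Cmp M G F) = Cmp M (Cmp M K G) F"
    if F: "F \<in> homset M A B" and G: "G \<in> homset M B D" and K: "K \<in> homset M D E" for F G K A B D E
  proof (rule psh_hom_eqI)
    note GF = psh_comp[OF F G] and KG = psh_comp[OF G K]
    show "Cmp M K (Cmp M G F) \<in> homset M A E" "Cmp M (Cmp M K G) F \<in> homset M A E"
      using psh_comp[OF GF K] psh_comp[OF F KG] .
    show "component (Cmp M K (Cmp M G F)) V n x = component (Cmp M (Cmp M K G) F) V n x"
      if "V \<in> Obj C" "x \<in> val A V n" for V n x
      using component_Cmp[OF GF K that] component_Cmp[OF F KG that] component_Cmp[OF F G that]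
        component_Cmp[OF G K that(1) psh_homD(4)[OF F that]] by simp
  qed
  have end_hom: "F \<in> homset M (Dom M F) B" if "F \<in> Arr M" "Cod M F = B" for F B
    using hom[OF that(1)] unfolding that(2) .
  show ?thesis
    unfolding category_def
  proof (intro conjI ballI impI)
    fix F assume F: "F \<in> Arr M"
    show "Dom M F \<in> Obj M" "Cod M F \<in> Obj M" using obj[OF hom[OF F]] by auto
    show "Cmp M F (Idn M (Dom M F)) = F" "Cmp M (Idn M (Cod M F)) F = F"
      using il[OF hom[OF F]] ir[OF hom[OF F]] by auto
    fix G assume G: "G \<in> Arr M" and FG: "Cod M F = Dom M G"
    show "Cmp M G F \<in> homset M (Dom M F) (Cod M G)"
      by (rule psh_comp[OF end_hom[OF F FG] hom[OF G]])
    fix K assume K: "K \<in> Arr M" and GK: "Cod M G = Dom M K"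
    show "Cmp M K (Cmp M G F) = Cmp M (Cmp M K G) F"
      by (rule assoc[OF end_hom[OF F FG] end_hom[OF G GK] hom[OF K]])
  qed (rule psh_id)
qed

lemma star_Obj: "star enc \<in> Obj M"
proof -
  have "{enc None} \<in> \<UU>"
    using universe_subset[OF universe enc_small] by simp
  then show ?thesis
    unfolding psh_Obj is_spsh_def star_def by simp
qed

lemma bang_hom: "A \<in> Obj M \<Longrightarrow> bang C enc A \<in> homset M A (star enc)"
proof -
  assume A: "A \<in> Obj M"
  have "psh_map C A (\<lambda>V n x. enc None) (star enc) \<in> homset M A (star enc)"
    using A star_Obj Arr_Obj unfolding psh_Obj by (intro psh_homI) (auto simp: star_def)
  then show ?thesis unfolding psh_map_def bang_def .
qed

lemma bang_unique:
  assumes "F \<in> homset M A (star enc)"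
  shows "F = bang C enc A"
proof (rule psh_hom_eqI[OF assms bang_hom])
  show "A \<in> Obj M" using psh_homD(2)[OF assms] psh_Obj by blast
  then show "component F V n x = component (bang C enc A) V n x"
    if "V \<in> Obj C" "x \<in> val A V n" for V n x
    using psh_homD(4)[OF assms that] psh_homD(4)[OF bang_hom that] by (simp add: star_def)
qed

subsection \<open>Subobjects of countable products\<close>

text \<open>Towers and pullbacks are both instances of this construction: the subobject of a
  countable product cut out by a condition Q that contains the base points and is stable under the
  structure maps. Its elements have to be of type 'u and to form small sets, so sequences are
  replaced by codes.\<close>

lemma sequence_limit:
  fixes Q :: "'o \<Rightarrow> nat \<Rightarrow> (nat \<Rightarrow> 'u) \<Rightarrow> bool"
  assumes T: "\<And>n. T n \<in> Obj M"
    and Q_bpt: "\<And>V m. V \<in> Obj C \<Longrightarrow> Q V m (\<lambda>n. bpt (T n) V m)"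
    and Q_act: "\<And>f \<theta> x. f \<in> Arr C \<Longrightarrow> \<theta> \<in> Arr Delta \<Longrightarrow> (\<And>n. x n \<in> val (T n) (Cod C f) (Cod Delta \<theta>)) \<Longrightarrow>
      Q (Cod C f) (Cod Delta \<theta>) x \<Longrightarrow> Q (Dom C f) (Dom Delta \<theta>) (\<lambda>n. act (T n) f \<theta> (x n))"
  obtains L \<pi> where "\<And>n. \<pi> n \<in> homset M L (T n)"
    and "\<And>V m y. V \<in> Obj C \<Longrightarrow> y \<in> val L V m \<Longrightarrow> Q V m (\<lambda>n. component (\<pi> n) V m y)"
    and "\<And>K \<kappa>. (\<And>n. \<kappa> n \<in> homset M K (T n)) \<Longrightarrow>
      (\<And>V m y. V \<in> Obj C \<Longrightarrow> y \<in> val K V m \<Longrightarrow> Q V m (\<lambda>n. component (\<kappa> n) V m y)) \<Longrightarrow>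
      \<exists>!h. h \<in> homset M K L \<and> (\<forall>n. Cmp M (\<pi> n) h = \<kappa> n)"
proof -
  have T_spsh: "is_spsh \<UU> C (T n)" for n using T psh_Obj by blast
  have T_small: "val (T n) V m \<in> \<UU>" and T_bpt: "bpt (T n) V m \<in> val (T n) V m"
    if "V \<in> Obj C" for n V m
    using T_spsh[of n] that unfolding is_spsh_def by blast+
  have T_act: "act (T n) f \<theta> x \<in> val (T n) (Dom C f) (Dom Delta \<theta>)"
    if "f \<in> Arr C" "\<theta> \<in> Arr Delta" "x \<in> val (T n) (Cod C f) (Cod Delta \<theta>)" for n f \<theta> x
    using T_spsh[of n] that unfolding is_spsh_def by blast
  have T_act_bpt: "act (T n) f \<theta> (bpt (T n) (Cod C f) (Cod Delta \<theta>)) = bpt (T n) (Dom C f) (Dom Delta \<theta>)"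
    if "f \<in> Arr C" "\<theta> \<in> Arr Delta" for n f \<theta>
    using T_spsh[of n] that unfolding is_spsh_def by blast
  have T_act_id: "act (T n) (Idn C V) (Idn Delta m) x = x" if "V \<in> Obj C" "x \<in> val (T n) V m" for n V m x
    using T_spsh[of n] that unfolding is_spsh_def by blast
  have T_act_cmp: "act (T n) (Cmp C g f) (Cmp Delta \<eta> \<theta>) x = act (T n) f \<theta> (act (T n) g \<eta> x)"
    if "f \<in> Arr C" "g \<in> Arr C" "\<theta> \<in> Arr Delta" "\<eta> \<in> Arr Delta" "Cod C f = Dom C g"
      "Cod Delta \<theta> = Dom Delta \<eta>" "x \<in> val (T n) (Cod C g) (Cod Delta \<eta>)" for n f g \<theta> \<eta> x
    using T_spsh[of n] that unfolding is_spsh_def by blast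
  define S where "S V m = {x. (\<forall>n. x n \<in> val (T n) V m) \<and> Q V m x}" for V m
  have "\<exists>e. inj_on e (S V m) \<and> e ` S V m \<in> \<UU>" if V: "V \<in> Obj C" for V m
  proof -
    obtain e where e: "inj_on e {x. \<forall>n. x n \<in> val (T n) V m}" "e ` {x. \<forall>n. x n \<in> val (T n) V m} \<in> \<UU>"
      using universe_sequences[OF universe, of "\<lambda>n. val (T n) V m"] T_small[OF V] by blast
    have "S V m \<subseteq> {x. \<forall>n. x n \<in> val (T n) V m}" unfolding S_def by blast
    moreover from this have "e ` S V m \<in> \<UU>"
      using universe_subset[OF universe e(2)] by (simp add: image_mono)
    ultimately show ?thesis
      using e(1) inj_on_subset by blast
  qed
  \<comment> \<open>The codes are chosen separately for each V and m and need not be compatible with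
    restriction. Hence the structure maps of L decode, act on every entry and encode again.\<close>
  then obtain e where e: "\<And>V m. V \<in> Obj C \<Longrightarrow> inj_on (e V m) (S V m)"
    and e_small: "\<And>V m. V \<in> Obj C \<Longrightarrow> e V m ` S V m \<in> \<UU>"
    by metis
  define dec where "dec V m = inv_into (S V m) (e V m)" for V m
  have dec_e [simp]: "dec V m (e V m x) = x" if "V \<in> Obj C" "x \<in> S V m" for V m x
    unfolding dec_def using e that by simp
  define L :: "('o, 'f, 'u) spsh" where
    "L = \<lparr>val = \<lambda>V m. e V m ` S V m, bpt = \<lambda>V m. e V m (\<lambda>n. bpt (T n) V m),
      act = \<lambda>f \<theta> y. e (Dom C f) (Dom Delta \<theta>)
        (\<lambda>n. act (T n) f \<theta> (dec (Cod C f) (Cod Delta \<theta>) y n))\<rparr>"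
  have val_L: "val L V m = e V m ` S V m" and bpt_L: "bpt L V m = e V m (\<lambda>n. bpt (T n) V m)" for V m
    unfolding L_def by simp_all
  have act_L: "act L f \<theta> y = e (Dom C f) (Dom Delta \<theta>)
      (\<lambda>n. act (T n) f \<theta> (dec (Cod C f) (Cod Delta \<theta>) y n))" for f \<theta> y
    unfolding L_def by simp
  have bpt_S: "(\<lambda>n. bpt (T n) V m) \<in> S V m" if "V \<in> Obj C" for V m
    using that T_bpt Q_bpt unfolding S_def by blast
  have act_S: "(\<lambda>n. act (T n) f \<theta> (x n)) \<in> S (Dom C f) (Dom Delta \<theta>)"
    if "f \<in> Arr C" "\<theta> \<in> Arr Delta" "x \<in> S (Cod C f) (Cod Delta \<theta>)" for f \<theta> x
    using that T_act Q_act unfolding S_def by blast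
  have act_Le: "act L f \<theta> (e (Cod C f) (Cod Delta \<theta>) x) =
      e (Dom C f) (Dom Delta \<theta>) (\<lambda>n. act (T n) f \<theta> (x n))"
    if "f \<in> Arr C" "x \<in> S (Cod C f) (Cod Delta \<theta>)" for f \<theta> x
    unfolding act_L using that Arr_Obj by simp
  have Delta_ends: "Dom Delta (Idn Delta m) = m" "Cod Delta (Idn Delta m) = m" for m
    unfolding Delta_def by simp_all
  have Delta_cmp: "Dom Delta (Cmp Delta \<eta> \<theta>) = Dom Delta \<theta>" "Cod Delta (Cmp Delta \<eta> \<theta>) = Cod Delta \<eta>"
    for \<eta> \<theta>
    unfolding Delta_def by (simp_all split: prod.splits)
  have L: "is_spsh \<UU> C L"
    unfolding is_spsh_def
  proof (intro conjI ballI allI impI)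
    fix V m assume V: "V \<in> Obj C"
    show "val L V m \<in> \<UU>" "bpt L V m \<in> val L V m"
      using e_small V bpt_S unfolding val_L bpt_L by auto
    show "act L (Idn C V) (Idn Delta m) y = y" if "y \<in> val L V m" for y
    proof -
      from that obtain x where x: "x \<in> S V m" "y = e V m x" unfolding val_L by blast
      then have "x n \<in> val (T n) V m" for n unfolding S_def by blast
      then show ?thesis
        unfolding act_L using x V Idn_ends[OF V] T_act_id[OF V] by (simp add: Delta_ends)
    qed
  next
    fix f \<theta> assume f: "f \<in> Arr C" and \<theta>: "\<theta> \<in> Arr Delta"
    show "act L f \<theta> \<in> val L (Cod C f) (Cod Delta \<theta>) \<rightarrow> val L (Dom C f) (Dom Delta \<theta>)"
      unfolding val_L using act_Le[OF f, of _ \<theta>] act_S[OF f \<theta>] by auto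
    show "act L f \<theta> (bpt L (Cod C f) (Cod Delta \<theta>)) = bpt L (Dom C f) (Dom Delta \<theta>)"
      unfolding bpt_L using act_Le[OF f] bpt_S Arr_Obj[OF f] T_act_bpt[OF f \<theta>] by simp
  next
    fix f g \<theta> \<eta> y
    assume f: "f \<in> Arr C" and g: "g \<in> Arr C" and \<theta>: "\<theta> \<in> Arr Delta" and \<eta>: "\<eta> \<in> Arr Delta"
      and fg: "Cod C f = Dom C g" and \<theta>\<eta>: "Cod Delta \<theta> = Dom Delta \<eta>"
      and "y \<in> val L (Cod C g) (Cod Delta \<eta>)"
    then obtain x where x: "x \<in> S (Cod C g) (Cod Delta \<eta>)" "y = e (Cod C g) (Cod Delta \<eta>) x"
      unfolding val_L by blast
    then have xn: "x n \<in> val (T n) (Cod C g) (Cod Delta \<eta>)" for n unfolding S_def by blast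
    have "act L (Cmp C g f) (Cmp Delta \<eta> \<theta>) y =
        e (Dom C f) (Dom Delta \<theta>) (\<lambda>n. act (T n) f \<theta> (act (T n) g \<eta> (x n)))"
      unfolding act_L using x Cmp_ends[OF f g fg] Arr_Obj[OF g] T_act_cmp[OF f g \<theta> \<eta> fg \<theta>\<eta> xn]
      by (simp add: Delta_cmp)
    also have "\<dots> = act L f \<theta> (act L g \<eta> y)"
      using x act_Le[OF g x(1)] act_Le[OF f, of _ \<theta>] act_S[OF g \<eta> x(1)] fg \<theta>\<eta> by simp
    finally show "act L (Cmp C g f) (Cmp Delta \<eta> \<theta>) y = act L f \<theta> (act L g \<eta> y)" .
  qed
  define \<pi> where "\<pi> n = psh_map C L (\<lambda>V m y. dec V m y n) (T n)" for n
  have \<pi>: "\<pi> n \<in> homset M L (T n)" for n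
    unfolding \<pi>_def
  proof (rule psh_homI[OF L T_spsh])
    show "dec V m y n \<in> val (T n) V m" if "V \<in> Obj C" "y \<in> val L V m" for V m y
      using that unfolding val_L S_def by (auto simp: dec_e[unfolded S_def])
    show "dec V m (bpt L V m) n = bpt (T n) V m" if "V \<in> Obj C" for V m
      using that bpt_S unfolding bpt_L by simp
    show "dec (Dom C f) (Dom Delta \<theta>) (act L f \<theta> y) n = act (T n) f \<theta> (dec (Cod C f) (Cod Delta \<theta>) y n)"
      if "f \<in> Arr C" "\<theta> \<in> Arr Delta" "y \<in> val L (Cod C f) (Cod Delta \<theta>)" for f \<theta> y
      using that act_S[OF that(1,2)] Arr_Obj[OF that(1)] unfolding val_L by (auto simp: act_Le)
  qed (rule Arr_Obj)
  have comp_\<pi>: "component (\<pi> n) V m (e V m x) = x n" if "V \<in> Obj C" "x \<in> S V m" for n V m x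
    unfolding \<pi>_def using that by (simp add: val_L)
  show thesis
  proof (rule that)
    show "\<pi> n \<in> homset M L (T n)" for n by (rule \<pi>)
    show "Q V m (\<lambda>n. component (\<pi> n) V m y)" if V: "V \<in> Obj C" and y: "y \<in> val L V m" for V m y
    proof -
      obtain x where x: "x \<in> S V m" "y = e V m x" using y unfolding val_L by blast
      then show ?thesis using comp_\<pi>[OF V x(1)] unfolding S_def by simp
    qed
    fix K \<kappa> assume \<kappa>: "\<And>n. \<kappa> n \<in> homset M K (T n)"
      and Q: "\<And>V m y. V \<in> Obj C \<Longrightarrow> y \<in> val K V m \<Longrightarrow> Q V m (\<lambda>n. component (\<kappa> n) V m y)"
    have S: "(\<lambda>n. component (\<kappa> n) V m y) \<in> S V m" if "V \<in> Obj C" "y \<in> val K V m" for V m y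
      using psh_homD(4)[OF \<kappa> that] Q[OF that] unfolding S_def by simp
    define h where "h = psh_map C K (\<lambda>V m y. e V m (\<lambda>n. component (\<kappa> n) V m y)) L"
    have h: "h \<in> homset M K L"
      unfolding h_def
    proof (rule psh_homI[OF psh_homD(2)[OF \<kappa>] L])
      show "e V m (\<lambda>n. component (\<kappa> n) V m y) \<in> val L V m" if "V \<in> Obj C" "y \<in> val K V m" for V m y
        unfolding val_L using S[OF that] by blast
      show "e V m (\<lambda>n. component (\<kappa> n) V m (bpt K V m)) = bpt L V m" if "V \<in> Obj C" for V m
        unfolding bpt_L using psh_homD(5)[OF \<kappa> that] by simp
      show "e (Dom C f) (Dom Delta \<theta>) (\<lambda>n. component (\<kappa> n) (Dom C f) (Dom Delta \<theta>) (act K f \<theta> y)) =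
          act L f \<theta> (e (Cod C f) (Cod Delta \<theta>) (\<lambda>n. component (\<kappa> n) (Cod C f) (Cod Delta \<theta>) y))"
        if f: "f \<in> Arr C" and \<theta>: "\<theta> \<in> Arr Delta" and y: "y \<in> val K (Cod C f) (Cod Delta \<theta>)" for f \<theta> y
        using act_Le[OF f S] Arr_Obj[OF f] y psh_homD(6)[OF \<kappa> f \<theta> y] by simp
    qed (rule Arr_Obj)
    show "\<exists>!h. h \<in> homset M K L \<and> (\<forall>n. Cmp M (\<pi> n) h = \<kappa> n)"
    proof (rule ex1I[of _ h])
      have "Cmp M (\<pi> n) h = \<kappa> n" for n
      proof (rule psh_hom_eqI[OF psh_comp[OF h \<pi>] \<kappa>])
        show "component (Cmp M (\<pi> n) h) V m y = component (\<kappa> n) V m y"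
          if "V \<in> Obj C" "y \<in> val K V m" for V m y
          using component_Cmp[OF h \<pi> that] comp_\<pi>[OF that(1) S[OF that]] that unfolding h_def by simp
      qed
      with h show "h \<in> homset M K L \<and> (\<forall>n. Cmp M (\<pi> n) h = \<kappa> n)" by blast
      fix k assume k: "k \<in> homset M K L \<and> (\<forall>n. Cmp M (\<pi> n) k = \<kappa> n)"
      show "k = h"
      proof (rule psh_hom_eqI[OF _ h])
        show kh: "k \<in> homset M K L" using k by blast
        fix V m y assume V: "V \<in> Obj C" and y: "y \<in> val K V m"
        obtain x where x: "x \<in> S V m" "component k V m y = e V m x"
          using psh_homD(4)[OF kh V y] unfolding val_L by blast
        have "component (\<kappa> n) V m y = x n" for n
          using component_Cmp[OF kh \<pi>[of n] V y] k x comp_\<pi>[OF V x(1)] by simp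
        then show "component k V m y = component h V m y"
          using x V y unfolding h_def by simp
      qed
    qed
  qed
qed

text \<open>The condition imposed on sequences is compatibility with the maps d. Sequences start at
  0 and towers at 1, hence the shift to \<open>T (Suc n)\<close> and the projections
  \<open>\<pi> (n - 1)\<close>.\<close>

lemma tower_limit_exists:
  assumes d: "\<And>n. n \<ge> 1 \<Longrightarrow> d n \<in> homset M (T (Suc n)) (T n)"
  shows "\<exists>L \<pi>. tower_limit M T d L \<pi>"
proof -
  have dS: "d (Suc n) \<in> homset M (T (Suc (Suc n))) (T (Suc n))" for n
    using d[of "Suc n"] by simp
  obtain L \<pi> where \<pi>: "\<And>n. \<pi> n \<in> homset M L (T (Suc n))"
    and Q: "\<And>V m y n. V \<in> Obj C \<Longrightarrow> y \<in> val L V m \<Longrightarrow>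
      component (d (Suc n)) V m (component (\<pi> (Suc n)) V m y) = component (\<pi> n) V m y"
    and univ: "\<And>K \<kappa>. (\<And>n. \<kappa> n \<in> homset M K (T (Suc n))) \<Longrightarrow>
      (\<And>V m y. V \<in> Obj C \<Longrightarrow> y \<in> val K V m \<Longrightarrow>
        \<forall>n. component (d (Suc n)) V m (component (\<kappa> (Suc n)) V m y) = component (\<kappa> n) V m y) \<Longrightarrow>
      \<exists>!h. h \<in> homset M K L \<and> (\<forall>n. Cmp M (\<pi> n) h = \<kappa> n)"
  proof (rule sequence_limit[of "\<lambda>n. T (Suc n)"
        "\<lambda>V m x. \<forall>n. component (d (Suc n)) V m (x (Suc n)) = x n"])
    show "T (Suc n) \<in> Obj M" for n
      using psh_homD(3)[OF dS] by (simp add: psh_Obj)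
    show "\<forall>n. component (d (Suc n)) V m (bpt (T (Suc (Suc n))) V m) = bpt (T (Suc n)) V m"
      if "V \<in> Obj C" for V m
      using psh_homD(5)[OF dS that] by blast
    show "\<forall>n. component (d (Suc n)) (Dom C f) (Dom Delta \<theta>) (act (T (Suc (Suc n))) f \<theta> (x (Suc n))) =
        act (T (Suc n)) f \<theta> (x n)"
      if f: "f \<in> Arr C" "\<theta> \<in> Arr Delta" and x: "\<And>n. x n \<in> val (T (Suc n)) (Cod C f) (Cod Delta \<theta>)"
        and eq: "\<forall>n. component (d (Suc n)) (Cod C f) (Cod Delta \<theta>) (x (Suc n)) = x n" for f \<theta> x
    proof
      fix n
      show "component (d (Suc n)) (Dom C f) (Dom Delta \<theta>) (act (T (Suc (Suc n))) f \<theta> (x (Suc n))) =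
          act (T (Suc n)) f \<theta> (x n)"
        unfolding psh_homD(6)[OF dS f x] spec[OF eq] ..
    qed
  qed blast
  show ?thesis
  proof (intro exI)
    show "tower_limit M T d L (\<lambda>n. \<pi> (n - 1))"
      unfolding tower_limit_def
    proof (intro conjI allI impI)
      have "Cmp M (d (Suc n)) (\<pi> (Suc n)) = \<pi> n" for n
        using component_Cmp[OF \<pi> dS] Q
        by (intro psh_hom_eqI[OF psh_comp[OF \<pi> dS] \<pi>]) simp
      then show "tower_cone M T d L (\<lambda>n. \<pi> (n - 1))"
        unfolding tower_cone_def using \<pi> psh_homD(2)[OF \<pi>]
        by (auto simp: psh_Obj Suc_le_eq gr0_conv_Suc)
      fix K \<kappa> assume "tower_cone M T d K \<kappa>"
      then have \<kappa>: "\<kappa> n \<in> homset M K (T n)" and eq: "Cmp M (d n) (\<kappa> (Suc n)) = \<kappa> n" if "n \<ge> 1" for n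
        using that unfolding tower_cone_def by auto
      have \<kappa>S: "\<kappa> (Suc n) \<in> homset M K (T (Suc n))" for n using \<kappa> by simp
      have "\<exists>!h. h \<in> homset M K L \<and> (\<forall>n. Cmp M (\<pi> n) h = \<kappa> (Suc n))"
        using component_Cmp[OF \<kappa>S dS] eq by (intro univ \<kappa>S) (metis le_add1 plus_1_eq_Suc)
      moreover have "(\<forall>n\<ge>1. Cmp M (\<pi> (n - 1)) h = \<kappa> n) \<longleftrightarrow> (\<forall>n. Cmp M (\<pi> n) h = \<kappa> (Suc n))" for h
        by (metis One_nat_def Suc_le_D diff_Suc_1 le_add1 plus_1_eq_Suc)
      ultimately show "\<exists>!h. h \<in> homset M K L \<and> (\<forall>n\<ge>1. Cmp M (\<pi> (n - 1)) h = \<kappa> n)"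
        by simp
    qed
  qed
qed

end

section \<open>Pullbacks of presheaves\<close>

definition is_pullback :: "('o, 'm) cat \<Rightarrow> 'm \<Rightarrow> 'm \<Rightarrow> 'o \<Rightarrow> 'm \<Rightarrow> 'm \<Rightarrow> bool" where
  "is_pullback C f g P p q \<longleftrightarrow> p \<in> homset C P (Dom C f) \<and> q \<in> homset C P (Dom C g) \<and>
     Cmp C f p = Cmp C g q \<and>
     (\<forall>K u v. u \<in> homset C K (Dom C f) \<longrightarrow> v \<in> homset C K (Dom C g) \<longrightarrow> Cmp C f u = Cmp C g v \<longrightarrow>
        (\<exists>!h. h \<in> homset C K P \<and> Cmp C p h = u \<and> Cmp C q h = v))"

context presheaves
begin

text \<open>A pair is stored as a sequence whose entry 0 lies in A and whose later entries are one
  repeated element of B. The countable construction then applies, and \<open>\<pi>S\<close>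
  identifies the repeated projections.\<close>

lemma pullback_exists:
  assumes f: "f \<in> homset M A D" and g: "g \<in> homset M B D"
  shows "\<exists>P p q. is_pullback M f g P p q"
proof -
  define T where "T n = (if n = 0 then A else B)" for n :: nat
  have T: "T n \<in> Obj M" for n
    unfolding T_def using psh_homD(2)[OF f] psh_homD(2)[OF g] by (simp add: psh_Obj)
  note F = psh_homD(4-6)[OF f] and G = psh_homD(4-6)[OF g]
  obtain P \<pi> where \<pi>: "\<And>n. \<pi> n \<in> homset M P (T n)"
    and Q: "\<And>V m y. V \<in> Obj C \<Longrightarrow> y \<in> val P V m \<Longrightarrow>
      component f V m (component (\<pi> 0) V m y) = component g V m (component (\<pi> 1) V m y)"
    and Q': "\<And>V m y n. V \<in> Obj C \<Longrightarrow> y \<in> val P V m \<Longrightarrow>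
      component (\<pi> (Suc n)) V m y = component (\<pi> 1) V m y"
    and univ: "\<And>K \<kappa>. (\<And>n. \<kappa> n \<in> homset M K (T n)) \<Longrightarrow>
      (\<And>V m y. V \<in> Obj C \<Longrightarrow> y \<in> val K V m \<Longrightarrow>
        component f V m (component (\<kappa> 0) V m y) = component g V m (component (\<kappa> 1) V m y) \<and>
        (\<forall>n. component (\<kappa> (Suc n)) V m y = component (\<kappa> 1) V m y)) \<Longrightarrow>
      \<exists>!h. h \<in> homset M K P \<and> (\<forall>n. Cmp M (\<pi> n) h = \<kappa> n)"
  proof (rule sequence_limit[of T "\<lambda>V m x. component f V m (x 0) = component g V m (x 1) \<and>
        (\<forall>n. x (Suc n) = x 1)", OF T])
    show "component f V m (bpt (T 0) V m) = component g V m (bpt (T 1) V m) \<and>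
        (\<forall>n. bpt (T (Suc n)) V m = bpt (T 1) V m)" if "V \<in> Obj C" for V m
      using F(2)[OF that] G(2)[OF that] unfolding T_def by simp
    fix h \<theta> x assume h: "h \<in> Arr C" "\<theta> \<in> Arr Delta" and x: "\<And>n. x n \<in> val (T n) (Cod C h) (Cod Delta \<theta>)"
      and Q: "component f (Cod C h) (Cod Delta \<theta>) (x 0) = component g (Cod C h) (Cod Delta \<theta>) (x 1) \<and>
        (\<forall>n. x (Suc n) = x 1)"
    then have "act (T (Suc n)) h \<theta> (x (Suc n)) = act (T 1) h \<theta> (x 1)" for n
      unfolding T_def by (metis nat.simps(3) One_nat_def)
    with Q show "component f (Dom C h) (Dom Delta \<theta>) (act (T 0) h \<theta> (x 0)) =
        component g (Dom C h) (Dom Delta \<theta>) (act (T 1) h \<theta> (x 1)) \<and>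
        (\<forall>n. act (T (Suc n)) h \<theta> (x (Suc n)) = act (T 1) h \<theta> (x 1))"
      using F(3)[OF h, of "x 0"] G(3)[OF h, of "x 1"] x[of 0] x[of 1] by (simp add: T_def)
  qed blast
  have p: "\<pi> 0 \<in> homset M P A" and q: "\<pi> (Suc n) \<in> homset M P B" for n
    using \<pi>[of 0] \<pi>[of "Suc n"] unfolding T_def by auto
  note q1 = q[of 0, folded One_nat_def]
  have \<pi>S: "\<pi> (Suc n) = \<pi> 1" for n
    by (rule psh_hom_eqI[OF q q1]) (rule Q')
  have dom: "Dom M f = A" "Dom M g = B"
    using f g unfolding homset_def by auto
  have "is_pullback M f g P (\<pi> 0) (\<pi> 1)"
    unfolding is_pullback_def dom
  proof (intro conjI allI impI)
    show "Cmp M f (\<pi> 0) = Cmp M g (\<pi> 1)"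
      using component_Cmp[OF p f] component_Cmp[OF q1 g] Q
      by (intro psh_hom_eqI[OF psh_comp[OF p f] psh_comp[OF q1 g]]) simp
    fix K u v assume u: "u \<in> homset M K A" and v: "v \<in> homset M K B" and eq: "Cmp M f u = Cmp M g v"
    define \<kappa> where "\<kappa> n = (if n = 0 then u else v)" for n :: nat
    have "\<exists>!h. h \<in> homset M K P \<and> (\<forall>n. Cmp M (\<pi> n) h = \<kappa> n)"
    proof (rule univ)
      show "\<kappa> n \<in> homset M K (T n)" for n unfolding \<kappa>_def T_def using u v by simp
      show "component f V m (component (\<kappa> 0) V m y) = component g V m (component (\<kappa> 1) V m y) \<and>
        (\<forall>n. component (\<kappa> (Suc n)) V m y = component (\<kappa> 1) V m y)"
        if "V \<in> Obj C" "y \<in> val K V m" for V m y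
        using component_Cmp[OF u f that] component_Cmp[OF v g that] eq unfolding \<kappa>_def by simp
    qed
    moreover have "(\<forall>n. Cmp M (\<pi> n) h = \<kappa> n) \<longleftrightarrow> Cmp M (\<pi> 0) h = u \<and> Cmp M (\<pi> 1) h = v" for h
      unfolding \<kappa>_def using \<pi>S by (metis nat.exhaust nat.simps(3) One_nat_def)
    ultimately show "\<exists>!h. h \<in> homset M K P \<and> Cmp M (\<pi> 0) h = u \<and> Cmp M (\<pi> 1) h = v"
      by simp
  qed (use p q1 in simp_all)
  then show ?thesis by blast
qed

end

section \<open>Towers and their limits\<close>

locale tower_complete = categ C for C :: "('o, 'm) cat" +
  fixes st :: 'o and tm :: "'o \<Rightarrow> 'm"
  assumes tm_hom: "\<And>A. A \<in> Obj C \<Longrightarrow> tm A \<in> hom A st"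
    and tm_unique: "\<And>f A. f \<in> hom A st \<Longrightarrow> f = tm A"
    and st_obj: "st \<in> Obj C"
    and tower_limits: "\<And>T d. (\<And>n. n \<ge> 1 \<Longrightarrow> d n \<in> hom (T (Suc n)) (T n)) \<Longrightarrow> \<exists>L \<pi>. tower_limit C T d L \<pi>"
begin

lemma tm_eq: "f \<in> hom A st \<Longrightarrow> g \<in> hom A st \<Longrightarrow> f = g"
  using tm_unique by metis

lemma tower_limitD:
  assumes "tower_limit C T d L \<pi>"
  shows "L \<in> Obj C" "n \<ge> 1 \<Longrightarrow> \<pi> n \<in> hom L (T n)" "n \<ge> 1 \<Longrightarrow> d n \<cdot> \<pi> (Suc n) = \<pi> n"
  using assms unfolding tower_limit_def tower_cone_def by auto

lemma tower_limit_ex: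
  assumes L: "tower_limit C T d L \<pi>" and K: "K \<in> Obj C"
    and \<kappa>: "\<And>n. n \<ge> 1 \<Longrightarrow> \<kappa> n \<in> hom K (T n)" "\<And>n. n \<ge> 1 \<Longrightarrow> d n \<cdot> \<kappa> (Suc n) = \<kappa> n"
  obtains h where "h \<in> hom K L" "\<And>n. n \<ge> 1 \<Longrightarrow> \<pi> n \<cdot> h = \<kappa> n"
proof -
  have "tower_cone C T d K \<kappa>" using K \<kappa> unfolding tower_cone_def by blast
  then show thesis using L that unfolding tower_limit_def by blast
qed

text \<open>Both maps mediate for the cone formed by the composites of the projections with k, so
  the uniqueness clause of the limit applies.\<close>

lemma tower_limit_eqI:
  assumes L: "tower_limit C T d L \<pi>" and d: "\<And>n. n \<ge> 1 \<Longrightarrow> d n \<in> hom (T (Suc n)) (T n)"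
    and h: "h \<in> hom K L" and k: "k \<in> hom K L" and eq: "\<And>n. n \<ge> 1 \<Longrightarrow> \<pi> n \<cdot> h = \<pi> n \<cdot> k"
  shows "h = k"
proof -
  have "d n \<cdot> \<pi> (Suc n) \<cdot> k = \<pi> n \<cdot> k" if "n \<ge> 1" for n
  proof -
    have S: "\<pi> (Suc n) \<in> hom L (T (Suc n))" using tower_limitD(2)[OF L] by simp
    show ?thesis using assoc[OF d[OF that] S k] tower_limitD(3)[OF L that] by simp
  qed
  moreover have "\<pi> n \<cdot> k \<in> hom K (T n)" if "n \<ge> 1" for n
    using comp_hom[OF tower_limitD(2)[OF L that] k] .
  moreover have "K \<in> Obj C" using hom_obj[OF k] by blast
  ultimately have "tower_cone C T d K (\<lambda>n. \<pi> n \<cdot> k)"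
    unfolding tower_cone_def by blast
  then have "\<exists>!h. h \<in> hom K L \<and> (\<forall>n\<ge>1. \<pi> n \<cdot> h = \<pi> n \<cdot> k)"
    using L unfolding tower_limit_def by simp
  moreover have "\<forall>n\<ge>1. \<pi> n \<cdot> h = \<pi> n \<cdot> k" using eq by blast
  ultimately show ?thesis using h k by blast
qed

lemma limit_map_ex:
  assumes L: "tower_limit C T d L \<pi>" and L': "tower_limit C T' d' L' \<pi>'"
    and d: "\<And>n. n \<ge> 1 \<Longrightarrow> d n \<in> hom (T (Suc n)) (T n)" and d': "\<And>n. n \<ge> 1 \<Longrightarrow> d' n \<in> hom (T' (Suc n)) (T' n)"
    and f: "\<And>n. n \<ge> 1 \<Longrightarrow> f n \<in> hom (T n) (T' n)"
    and sq: "\<And>n. n \<ge> 1 \<Longrightarrow> d' n \<cdot> f (Suc n) = f n \<cdot> d n"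
  obtains h where "h \<in> hom L L'" "\<And>n. n \<ge> 1 \<Longrightarrow> \<pi>' n \<cdot> h = f n \<cdot> \<pi> n"
proof (rule tower_limit_ex[OF L' tower_limitD(1)[OF L]])
  fix n :: nat assume n: "n \<ge> 1"
  have S: "\<pi> (Suc n) \<in> hom L (T (Suc n))" "f (Suc n) \<in> hom (T (Suc n)) (T' (Suc n))"
    using tower_limitD(2)[OF L] f by simp_all
  show "f n \<cdot> \<pi> n \<in> hom L (T' n)"
    using comp_hom[OF f[OF n] tower_limitD(2)[OF L n]] .
  show "d' n \<cdot> f (Suc n) \<cdot> \<pi> (Suc n) = f n \<cdot> \<pi> n"
    using assoc[OF d'[OF n] S(2,1)] sq[OF n] assoc[OF f[OF n] d[OF n] S(1)] tower_limitD(3)[OF L n]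
    by simp
qed (rule that)

text \<open>One limit is chosen for each object. Maps between the chosen limits come from the
  universal property, and the functor laws hold because both sides have the same
  projections.\<close>

lemma limit_functor:
  assumes F: "\<And>n. n \<ge> 1 \<Longrightarrow> is_functor C C (F n)"
    and d: "\<And>n. n \<ge> 1 \<Longrightarrow> nat_trans C C (F (Suc n)) (F n) (d n)"
  obtains L \<pi> where "is_functor C C L" "\<And>n. n \<ge> 1 \<Longrightarrow> nat_trans C C L (F n) (\<pi> n)"
    "\<And>A. A \<in> Obj C \<Longrightarrow> tower_limit C (\<lambda>n. fob (F n) A) (\<lambda>n. d n A) (fob L A) (\<lambda>n. \<pi> n A)"
proof -
  have dh: "d n A \<in> hom (fob (F (Suc n)) A) (fob (F n) A)" if "n \<ge> 1" "A \<in> Obj C" for n A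
    using nat_trans_hom[OF d[OF that(1)] that(2)] .
  have "\<exists>L \<pi>. tower_limit C (\<lambda>n. fob (F n) A) (\<lambda>n. d n A) L \<pi>" if "A \<in> Obj C" for A
    using dh that by (intro tower_limits) auto
  then obtain Lo \<pi> where L: "\<And>A. A \<in> Obj C \<Longrightarrow> tower_limit C (\<lambda>n. fob (F n) A) (\<lambda>n. d n A) (Lo A) (\<pi> A)"
    by metis
  have "\<exists>h. h \<in> hom (Lo A) (Lo B) \<and> (\<forall>n\<ge>1. \<pi> B n \<cdot> h = far (F n) f \<cdot> \<pi> A n)"
    if f: "f \<in> hom A B" for f A B
  proof -
    have A: "A \<in> Obj C" and B: "B \<in> Obj C" using hom_obj[OF f] by auto
    show ?thesis
    proof (rule limit_map_ex[OF L[OF A] L[OF B] dh dh functor_hom[OF F f]])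
      show "d n B \<cdot> far (F (Suc n)) f = far (F n) f \<cdot> d n A" if "n \<ge> 1" for n
        using nat_trans_sq[OF d[OF that] f] .
    qed (use A B in blast)+
  qed
  then have "\<exists>h. \<forall>f\<in>Arr C. h f \<in> hom (Lo (Dom C f)) (Lo (Cod C f)) \<and>
      (\<forall>n\<ge>1. \<pi> (Cod C f) n \<cdot> h f = far (F n) f \<cdot> \<pi> (Dom C f) n)"
    using arr_hom by (intro bchoice) blast
  then obtain La where "\<forall>f\<in>Arr C. La f \<in> hom (Lo (Dom C f)) (Lo (Cod C f)) \<and>
      (\<forall>n\<ge>1. \<pi> (Cod C f) n \<cdot> La f = far (F n) f \<cdot> \<pi> (Dom C f) n)"
    by blast
  then have La: "La f \<in> hom (Lo A) (Lo B)" and La_sq: "n \<ge> 1 \<Longrightarrow> \<pi> B n \<cdot> La f = far (F n) f \<cdot> \<pi> A n"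
    if "f \<in> hom A B" for f A B n
    using that unfolding homset_def by auto
  have \<pi>h: "\<pi> A n \<in> hom (Lo A) (fob (F n) A)" if "n \<ge> 1" "A \<in> Obj C" for n A
    using tower_limitD(2)[OF L[OF that(2)] that(1)] .
  define LF :: "('o, 'm, 'o, 'm) func" where "LF = \<lparr>fob = Lo, far = La\<rparr>"
  have fob: "fob LF = Lo" and far: "far LF = La" unfolding LF_def by simp_all
  show thesis
  proof (rule that)
    show "is_functor C C LF"
    proof (rule functorI, unfold fob far)
      show Lo: "Lo A \<in> Obj C" if "A \<in> Obj C" for A
        using tower_limitD(1)[OF L[OF that]] .
      show "La (Idn C A) = Idn C (Lo A)" if A: "A \<in> Obj C" for A
      proof (rule tower_limit_eqI[OF L[OF A] dh[OF _ A]])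
        show "\<pi> A n \<cdot> La (Idn C A) = \<pi> A n \<cdot> Idn C (Lo A)" if n: "n \<ge> 1" for n
          using La_sq[OF id_hom[OF A] n] functor_id[OF F[OF n] A] id_l[OF \<pi>h[OF n A]] id_r[OF \<pi>h[OF n A]]
          by simp
      qed (use La[OF id_hom[OF A]] Lo[OF A] in auto)
      show "La f \<in> hom (Lo A) (Lo B)" if "f \<in> hom A B" for f A B
        using La[OF that] .
      show "La (g \<cdot> f) = La g \<cdot> La f" if f: "f \<in> hom A B" and g: "g \<in> hom B D" for f g A B D
      proof -
        have A: "A \<in> Obj C" and B: "B \<in> Obj C" and D: "D \<in> Obj C" using hom_obj[OF f] hom_obj[OF g] by auto
        show ?thesis
        proof (rule tower_limit_eqI[OF L[OF D] dh[OF _ D] La[OF comp_hom[OF g f]] comp_hom[OF La[OF g] La[OF f]]])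
          fix n :: nat assume n: "n \<ge> 1"
          note Ff = functor_hom[OF F[OF n] f] and Fg = functor_hom[OF F[OF n] g]
          have "\<pi> D n \<cdot> La g \<cdot> La f = far (F n) g \<cdot> \<pi> B n \<cdot> La f"
            using assoc[OF \<pi>h[OF n D] La[OF g] La[OF f]] assoc[OF Fg \<pi>h[OF n B] La[OF f]] La_sq[OF g n] by simp
          also have "\<dots> = far (F n) (g \<cdot> f) \<cdot> \<pi> A n"
            using La_sq[OF f n] assoc[OF Fg Ff \<pi>h[OF n A]] functor_cmp[OF F[OF n] f g] by simp
          finally show "\<pi> D n \<cdot> La (g \<cdot> f) = \<pi> D n \<cdot> La g \<cdot> La f"
            using La_sq[OF comp_hom[OF g f] n] by simp
        qed
      qed
    qed
    show "nat_trans C C LF (F n) (\<lambda>A. \<pi> A n)" if n: "n \<ge> 1" for n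
      using \<pi>h[OF n] La_sq[OF _ n] by (intro nat_transI) (simp_all add: fob far)
    show "tower_limit C (\<lambda>n. fob (F n) A) (\<lambda>n. d n A) (fob LF A) (\<lambda>n. \<pi> A n)" if "A \<in> Obj C" for A
      using L[OF that] unfolding fob .
  qed
qed

text \<open>Naturality of the map into the limit is tested on the projections, where it becomes
  naturality of the given cone.\<close>

lemma limit_cone_nat_trans:
  assumes F: "\<And>n. n \<ge> 1 \<Longrightarrow> is_functor C C (F n)"
    and d: "\<And>n. n \<ge> 1 \<Longrightarrow> nat_trans C C (F (Suc n)) (F n) (d n)"
    and L: "is_functor C C L" and \<pi>: "\<And>n. n \<ge> 1 \<Longrightarrow> nat_trans C C L (F n) (\<pi> n)"
    and lim: "\<And>A. A \<in> Obj C \<Longrightarrow> tower_limit C (\<lambda>n. fob (F n) A) (\<lambda>n. d n A) (fob L A) (\<lambda>n. \<pi> n A)"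
    and e: "\<And>n. n \<ge> 1 \<Longrightarrow> nat_trans C C id_func (F n) (e n)"
    and de: "\<And>n A. n \<ge> 1 \<Longrightarrow> A \<in> Obj C \<Longrightarrow> d n A \<cdot> e (Suc n) A = e n A"
  obtains k where "nat_trans C C id_func L k" "\<And>n A. n \<ge> 1 \<Longrightarrow> A \<in> Obj C \<Longrightarrow> \<pi> n A \<cdot> k A = e n A"
proof -
  have eh: "e n A \<in> hom A (fob (F n) A)" if "n \<ge> 1" "A \<in> Obj C" for n A
    using nat_trans_hom[OF e[OF that(1)] that(2)] by (simp add: id_func_def)
  have "\<exists>h. h \<in> hom A (fob L A) \<and> (\<forall>n\<ge>1. \<pi> n A \<cdot> h = e n A)" if A: "A \<in> Obj C" for A
    by (rule tower_limit_ex[OF lim[OF A] A eh[OF _ A] de[OF _ A]]) auto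
  then obtain k where k: "\<And>A. A \<in> Obj C \<Longrightarrow> k A \<in> hom A (fob L A)"
    and \<pi>k: "\<And>n A. n \<ge> 1 \<Longrightarrow> A \<in> Obj C \<Longrightarrow> \<pi> n A \<cdot> k A = e n A"
    by metis
  show thesis
  proof (rule that)
    show "nat_trans C C id_func L k"
    proof (rule nat_transI; simp only: id_func_def func.simps id_apply)
      show "k A \<in> hom A (fob L A)" if "A \<in> Obj C" for A
        using k[OF that] .
      show "k B \<cdot> f = far L f \<cdot> k A" if f: "f \<in> hom A B" for f A B
      proof -
        have A: "A \<in> Obj C" and B: "B \<in> Obj C" using hom_obj[OF f] by auto
        note Lf = functor_hom[OF L f]
        show ?thesis
        proof (rule tower_limit_eqI[OF lim[OF B] nat_trans_hom[OF d B] comp_hom[OF k[OF B] f] comp_hom[OF Lf k[OF A]]])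
          fix n :: nat assume n: "n \<ge> 1"
          note \<pi>A = nat_trans_hom[OF \<pi>[OF n] A] and \<pi>B = nat_trans_hom[OF \<pi>[OF n] B]
          note Ff = functor_hom[OF F[OF n] f]
          have "\<pi> n B \<cdot> k B \<cdot> f = e n B \<cdot> f"
            using assoc[OF \<pi>B k[OF B] f] \<pi>k[OF n B] by simp
          also have "\<dots> = far (F n) f \<cdot> e n A"
            using nat_trans_sq[OF e[OF n] f] by (simp add: id_func_def)
          also have "\<dots> = far (F n) f \<cdot> \<pi> n A \<cdot> k A"
            using \<pi>k[OF n A] by simp
          also have "\<dots> = \<pi> n B \<cdot> far L f \<cdot> k A"
            using assoc[OF Ff \<pi>A k[OF A]] assoc[OF \<pi>B Lf k[OF A]] nat_trans_sq[OF \<pi>[OF n] f] by simp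
          finally show "\<pi> n B \<cdot> k B \<cdot> f = \<pi> n B \<cdot> far L f \<cdot> k A" .
        qed
      qed
    qed
  qed (rule \<pi>k)
qed

end

section \<open>Lifting properties and model structures\<close>

context categ
begin

lemma rlpI:
  assumes "p \<in> hom X Y" "S \<subseteq> Arr C"
    and "\<And>i A B u v. i \<in> S \<Longrightarrow> i \<in> hom A B \<Longrightarrow> u \<in> hom A X \<Longrightarrow> v \<in> hom B Y \<Longrightarrow> v \<cdot> i = p \<cdot> u \<Longrightarrow>
      \<exists>h \<in> hom B X. h \<cdot> i = u \<and> p \<cdot> h = v"
  shows "p \<in> rlp C S"
  using assms(1) unfolding rlp_def has_lift_def
  by (auto simp: hom_arr intro!: assms(3) arr_hom subsetD[OF assms(2)])

lemma rlpD:
  assumes p: "p \<in> rlp C S" "p \<in> hom X Y" and i: "i \<in> S" "i \<in> hom A B"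
    and sq: "u \<in> hom A X" "v \<in> hom B Y" "v \<cdot> i = p \<cdot> u"
  obtains h where "h \<in> hom B X" "h \<cdot> i = u" "p \<cdot> h = v"
proof -
  have "has_lift C i p" using p(1) i(1) unfolding rlp_def by blast
  then show thesis
    using that sq unfolding has_lift_def hom_dom[OF p(2)] hom_cod[OF p(2)] hom_dom[OF i(2)] hom_cod[OF i(2)]
    by blast
qed

lemma rlp_id: "A \<in> Obj C \<Longrightarrow> S \<subseteq> Arr C \<Longrightarrow> Idn C A \<in> rlp C S"
proof (rule rlpI[OF id_hom])
  fix i X Y u v
  assume "i \<in> hom X Y" and u: "u \<in> hom X A" and v: "v \<in> hom Y A" and "v \<cdot> i = Idn C A \<cdot> u"
  then have "v \<cdot> i = u \<and> Idn C A \<cdot> v = v"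
    using id_l[OF u] id_l[OF v] by simp
  with v show "\<exists>h\<in>hom Y A. h \<cdot> i = u \<and> Idn C A \<cdot> h = v" by blast
qed

lemma rlp_comp:
  assumes p: "p \<in> rlp C S" "p \<in> hom X Y" and q: "q \<in> rlp C S" "q \<in> hom Y Z" and S: "S \<subseteq> Arr C"
  shows "q \<cdot> p \<in> rlp C S"
proof (rule rlpI[OF comp_hom[OF q(2) p(2)] S])
  fix i A B u v
  assume i: "i \<in> S" "i \<in> hom A B" and u: "u \<in> hom A X" and v: "v \<in> hom B Z" and sq: "v \<cdot> i = (q \<cdot> p) \<cdot> u"
  then have "v \<cdot> i = q \<cdot> p \<cdot> u" using assoc[OF q(2) p(2) u] by simp
  from rlpD[OF q i comp_hom[OF p(2) u] v this]
  obtain k where k: "k \<in> hom B Y" "k \<cdot> i = p \<cdot> u" "q \<cdot> k = v" .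
  from rlpD[OF p i u k(1,2)]
  obtain h where h: "h \<in> hom B X" "h \<cdot> i = u" "p \<cdot> h = k" .
  then have "(q \<cdot> p) \<cdot> h = v" using assoc[OF q(2) p(2) h(1)] k(3) by simp
  with h show "\<exists>h\<in>hom B X. h \<cdot> i = u \<and> (q \<cdot> p) \<cdot> h = v" by blast
qed

lemma is_pullbackD:
  assumes "is_pullback C f g P p q" "f \<in> hom X Z" "g \<in> hom Y Z"
  shows "p \<in> hom P X" "q \<in> hom P Y" "f \<cdot> p = g \<cdot> q"
  using assms unfolding is_pullback_def by simp_all

lemma pullback_ex:
  assumes "is_pullback C f g P p q" "f \<in> hom X Z" "g \<in> hom Y Z"
    and "u \<in> hom K X" "v \<in> hom K Y" "f \<cdot> u = g \<cdot> v"
  obtains h where "h \<in> hom K P" "p \<cdot> h = u" "q \<cdot> h = v"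
proof -
  have "\<exists>!h. h \<in> homset C K P \<and> Cmp C p h = u \<and> Cmp C q h = v"
    using assms unfolding is_pullback_def by simp
  then show thesis using that by blast
qed

lemma pullback_eqI:
  assumes P: "is_pullback C f g P p q" and f: "f \<in> hom X Z" and g: "g \<in> hom Y Z"
    and h: "h \<in> hom K P" and k: "k \<in> hom K P" and eq: "p \<cdot> h = p \<cdot> k" "q \<cdot> h = q \<cdot> k"
  shows "h = k"
proof -
  note D = is_pullbackD[OF P f g]
  have "f \<cdot> p \<cdot> k = g \<cdot> q \<cdot> k"
    using assoc[OF f D(1) k] assoc[OF g D(2) k] D(3) by simp
  then have "\<exists>!h. h \<in> homset C K P \<and> Cmp C p h = p \<cdot> k \<and> Cmp C q h = q \<cdot> k"
    using P comp_hom[OF D(1) k] comp_hom[OF D(2) k] f g unfolding is_pullback_def by simp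
  then show ?thesis using h k eq by blast
qed

lemma is_pullback_sym: "is_pullback C f g P p q \<Longrightarrow> is_pullback C g f P q p"
proof -
  assume P: "is_pullback C f g P p q"
  have "(k \<in> homset C K P \<and> Cmp C q k = v \<and> Cmp C p k = u) = (k \<in> homset C K P \<and> Cmp C p k = u \<and> Cmp C q k = v)"
    for k K u v by blast
  with P show ?thesis unfolding is_pullback_def by simp
qed

lemma rlp_base_change:
  assumes P: "is_pullback C f g P p q" and f: "f \<in> hom X Z" and g: "g \<in> hom Y Z"
    and fS: "f \<in> rlp C S" and S: "S \<subseteq> Arr C"
  shows "q \<in> rlp C S"
proof -
  note D = is_pullbackD[OF P f g]
  show ?thesis
  proof (rule rlpI[OF D(2) S])
    fix i A B u v
    assume i: "i \<in> S" "i \<in> hom A B" and u: "u \<in> hom A P" and v: "v \<in> hom B Y" and sq: "v \<cdot> i = q \<cdot> u"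
    have "(g \<cdot> v) \<cdot> i = f \<cdot> p \<cdot> u"
      using assoc[OF g v i(2)] sq assoc[OF g D(2) u] assoc[OF f D(1) u] D(3) by simp
    from rlpD[OF fS f i comp_hom[OF D(1) u] comp_hom[OF g v] this]
    obtain k where k: "k \<in> hom B X" "k \<cdot> i = p \<cdot> u" "f \<cdot> k = g \<cdot> v" .
    from pullback_ex[OF P f g k(1) v k(3)]
    obtain h where h: "h \<in> hom B P" "p \<cdot> h = k" "q \<cdot> h = v" .
    have "h \<cdot> i = u"
      using assoc[OF D(1) h(1) i(2)] assoc[OF D(2) h(1) i(2)] h k(2) sq
      by (intro pullback_eqI[OF P f g comp_hom[OF h(1) i(2)] u]) simp_all
    with h show "\<exists>h\<in>hom B P. h \<cdot> i = u \<and> q \<cdot> h = v" by blast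
  qed
qed

lemma rlp_antimono: "S \<subseteq> S' \<Longrightarrow> rlp C S' \<subseteq> rlp C S"
  unfolding rlp_def by blast

end

text \<open>The fibrations appear as a lifting class instead of a parameter, which is how they are
  defined both in the motivic structure and in its localizations.\<close>

locale model = categ C for C :: "('o, 'm) cat" +
  fixes W Cf :: "'m set" and \<alpha> \<gamma> :: "'m ffact"
  assumes ms: "model_structure C W Cf (rlp C (Cf \<inter> W)) \<alpha> \<gamma>"
begin

lemma W_closed: "subcategory_closed C W"
  using ms unfolding model_structure_def by (elim conjE)

lemma Cf_closed: "subcategory_closed C Cf"
  using ms unfolding model_structure_def by (elim conjE)

lemma W_arr: "W \<subseteq> Arr C" and Cf_arr: "Cf \<subseteq> Arr C"
  using W_closed Cf_closed unfolding subcategory_closed_def by simp_all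

lemma W_id: "A \<in> Obj C \<Longrightarrow> Idn C A \<in> W"
  using W_closed unfolding subcategory_closed_def by simp

lemma W_comp: "f \<in> hom A B \<Longrightarrow> g \<in> hom B D \<Longrightarrow> f \<in> W \<Longrightarrow> g \<in> W \<Longrightarrow> g \<cdot> f \<in> W"
  using W_closed unfolding subcategory_closed_def by simp

lemma W_right: "f \<in> hom A B \<Longrightarrow> g \<in> hom B D \<Longrightarrow> f \<in> W \<Longrightarrow> g \<cdot> f \<in> W \<Longrightarrow> g \<in> W"
  and W_left: "f \<in> hom A B \<Longrightarrow> g \<in> hom B D \<Longrightarrow> g \<in> W \<Longrightarrow> g \<cdot> f \<in> W \<Longrightarrow> f \<in> W"
proof -
  have "\<forall>f\<in>Arr C. \<forall>g\<in>Arr C. Cod C f = Dom C g \<longrightarrow>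
      (f \<in> W \<and> g \<cdot> f \<in> W \<longrightarrow> g \<in> W) \<and> (g \<in> W \<and> g \<cdot> f \<in> W \<longrightarrow> f \<in> W)"
    using ms unfolding model_structure_def by (elim conjE)
  then show "f \<in> hom A B \<Longrightarrow> g \<in> hom B D \<Longrightarrow> f \<in> W \<Longrightarrow> g \<cdot> f \<in> W \<Longrightarrow> g \<in> W"
    "f \<in> hom A B \<Longrightarrow> g \<in> hom B D \<Longrightarrow> g \<in> W \<Longrightarrow> g \<cdot> f \<in> W \<Longrightarrow> f \<in> W"
    unfolding homset_def by (simp_all only: mem_Collect_eq) metis+
qed

lemma functorial: "functorial_factorization C \<alpha>" "functorial_factorization C \<gamma>"
  using ms unfolding model_structure_def by simp_all

lemma lft_rgt: "f \<in> Arr C \<Longrightarrow>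
    lft \<alpha> f \<in> Cf \<and> rgt \<alpha> f \<in> W \<and> lft \<gamma> f \<in> Cf \<inter> W \<and> rgt \<gamma> f \<in> rlp C (Cf \<inter> W)"
  using ms unfolding model_structure_def by simp

lemma factorization:
  assumes "functorial_factorization C \<phi>" "f \<in> hom A B"
  obtains X where "lft \<phi> f \<in> hom A X" "rgt \<phi> f \<in> hom X B" "rgt \<phi> f \<cdot> lft \<phi> f = f"
  using assms unfolding functorial_factorization_def homset_def by auto

text \<open>Together with \<open>rlp_Cf_W\<close> this describes trivial fibrations through Cf
  alone, which allows them to be moved from one structure of a family to another.\<close>

lemma trivial_fibration_rlp:
  assumes "p \<in> rlp C (Cf \<inter> W)" "p \<in> W"
  shows "p \<in> rlp C Cf"
proof -
  have "\<forall>i\<in>Cf. \<forall>p\<in>rlp C (Cf \<inter> W). i \<in> W \<or> p \<in> W \<longrightarrow> has_lift C i p"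
    using ms unfolding model_structure_def by (elim conjE)
  moreover have "p \<in> Arr C" using assms(1) unfolding rlp_def by simp
  ultimately show ?thesis using assms unfolding rlp_def by blast
qed

text \<open>By the retract argument \<open>p\<close> is a retract of the trivial fibration in its factorization.\<close>

lemma rlp_Cf_W:
  assumes p: "p \<in> rlp C Cf"
  shows "p \<in> W"
proof -
  have pa: "p \<in> Arr C" using p unfolding rlp_def by simp
  define X Y where "X = Dom C p" and "Y = Cod C p"
  have ph: "p \<in> hom X Y" unfolding X_def Y_def using arr_hom[OF pa] .
  from factorization[OF functorial(1) ph]
  obtain E where l: "lft \<alpha> p \<in> hom X E" and r: "rgt \<alpha> p \<in> hom E Y" and rl: "rgt \<alpha> p \<cdot> lft \<alpha> p = p" .
  have lC: "lft \<alpha> p \<in> Cf" and rW: "rgt \<alpha> p \<in> W" using lft_rgt[OF pa] by auto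
  have X: "X \<in> Obj C" and Y: "Y \<in> Obj C" using hom_obj[OF ph] by auto
  have "rgt \<alpha> p \<cdot> lft \<alpha> p = p \<cdot> Idn C X" using rl id_r[OF ph] by simp
  from rlpD[OF p ph lC l id_hom[OF X] r this]
  obtain h where h: "h \<in> hom E X" "h \<cdot> lft \<alpha> p = Idn C X" "p \<cdot> h = rgt \<alpha> p" .
  have "is_retract C p (rgt \<alpha> p)"
    unfolding is_retract_def hom_dom[OF ph] hom_cod[OF ph] hom_dom[OF r] hom_cod[OF r]
    using l h rl Y id_hom[OF Y] id_l[OF id_hom[OF Y]] id_l[OF ph] id_l[OF r]
    by (intro exI[of _ "lft \<alpha> p"] exI[of _ h] exI[of _ "Idn C Y"]) simp
  moreover have "\<forall>f\<in>Arr C. \<forall>g\<in>Arr C. is_retract C f g \<longrightarrow> (g \<in> W \<longrightarrow> f \<in> W)"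
    using ms unfolding model_structure_def by simp
  ultimately show ?thesis using pa hom_arr[OF r] rW by blast
qed

end

section \<open>Towers of fibrations\<close>

text \<open>
  A family of model structures with the same cofibrations, hence with the same trivial fibrations.
  A fibration tower has its map to level \<open>n\<close> fibrant in the \<open>n\<close>-th structure, and a weak
  equivalence of such towers has its component at level \<open>n + 1\<close> in the \<open>n\<close>-th structure.
\<close>

locale model_family = tower_complete C st tm
  for C :: "('o, 'm) cat" and st and tm :: "'o \<Rightarrow> 'm" +
  fixes W :: "nat \<Rightarrow> 'm set" and Cf :: "'m set" and \<alpha> \<gamma> :: "nat \<Rightarrow> 'm ffact"
  assumes mss: "\<And>n. model_structure C (W n) Cf (rlp C (Cf \<inter> W n)) (\<alpha> n) (\<gamma> n)"
    and pullbacks: "\<And>f g A B D. f \<in> homset C A D \<Longrightarrow> g \<in> homset C B D \<Longrightarrow> \<exists>P p q. is_pullback C f g P p q"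
begin

sublocale M: model C "W n" Cf "\<alpha> n" "\<gamma> n" for n
  by standard (rule mss)

definition fibration_tower :: "(nat \<Rightarrow> 'o) \<Rightarrow> (nat \<Rightarrow> 'm) \<Rightarrow> bool" where
  "fibration_tower T d \<longleftrightarrow> T 0 = st \<and> (\<forall>n. d n \<in> hom (T (Suc n)) (T n) \<and> d n \<in> rlp C (Cf \<inter> W n))"

definition tower_map ::
  "(nat \<Rightarrow> 'o) \<Rightarrow> (nat \<Rightarrow> 'm) \<Rightarrow> (nat \<Rightarrow> 'o) \<Rightarrow> (nat \<Rightarrow> 'm) \<Rightarrow> (nat \<Rightarrow> 'm) \<Rightarrow> bool" where
  "tower_map T d S e f \<longleftrightarrow> (\<forall>n. f n \<in> hom (T n) (S n) \<and> e n \<cdot> f (Suc n) = f n \<cdot> d n)"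

definition tower_weq ::
  "(nat \<Rightarrow> 'o) \<Rightarrow> (nat \<Rightarrow> 'm) \<Rightarrow> (nat \<Rightarrow> 'o) \<Rightarrow> (nat \<Rightarrow> 'm) \<Rightarrow> (nat \<Rightarrow> 'm) \<Rightarrow> bool" where
  "tower_weq T d S e f \<longleftrightarrow> tower_map T d S e f \<and> (\<forall>n. f (Suc n) \<in> W n)"

text \<open>
  The map \<open>q' : X' \<rightarrow> S'\<close> lying over \<open>q : X \<rightarrow> S\<close> is such that \<open>X' \<rightarrow> S' \<times>\<^bsub>S\<^esub> X\<close> is a trivial fibration.
\<close>

definition corner_lift :: "'o \<Rightarrow> 'o \<Rightarrow> 'm \<Rightarrow> 'o \<Rightarrow> 'o \<Rightarrow> 'm \<Rightarrow> 'm \<Rightarrow> 'm \<Rightarrow> bool" where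
  "corner_lift X' X p S' S e q' q \<longleftrightarrow>
     (\<forall>j A B u v w. j \<in> Cf \<longrightarrow> j \<in> hom A B \<longrightarrow> u \<in> hom A X' \<longrightarrow> v \<in> hom B S' \<longrightarrow> w \<in> hom B X \<longrightarrow>
        q' \<cdot> u = v \<cdot> j \<longrightarrow> p \<cdot> u = w \<cdot> j \<longrightarrow> e \<cdot> v = q \<cdot> w \<longrightarrow>
        (\<exists>h \<in> hom B X'. h \<cdot> j = u \<and> q' \<cdot> h = v \<and> p \<cdot> h = w))"

text \<open>The step of a Reedy factorization from level n to level n + 1. The pullback E of e and q
  is the relative matching object, and T' \<rightarrow> E is factored in the n-th structure as a
  trivial cofibration followed by a fibration. The second factor is trivial because f' is a weak
  equivalence and E \<rightarrow> S' is a base change of the trivial fibration q.\<close>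

lemma corner_step:
  assumes d: "d \<in> hom T' T" and e: "e \<in> hom S' S" "e \<in> rlp C (Cf \<inter> W n)"
    and f': "f' \<in> hom T' S'" "f' \<in> W n" and f: "f \<in> hom T S" and sq: "e \<cdot> f' = f \<cdot> d"
    and i: "i \<in> hom T X" and q: "q \<in> hom X S" "q \<in> rlp C Cf" and qi: "q \<cdot> i = f"
  obtains X' i' q' p where "i' \<in> hom T' X'" "i' \<in> Cf" "i' \<in> W n" "q' \<in> hom X' S'" "q' \<in> rlp C Cf"
    "q' \<cdot> i' = f'" "p \<in> hom X' X" "p \<in> rlp C (Cf \<inter> W n)" "p \<cdot> i' = i \<cdot> d" "e \<cdot> q' = q \<cdot> p"
    "corner_lift X' X p S' S e q' q"
proof -
  note CfA = M.Cf_arr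
  have CW: "Cf \<inter> W n \<subseteq> Arr C" using CfA by blast
  obtain E a b where E: "is_pullback C e q E a b" using pullbacks[OF e(1) q(1)] by blast
  note D = is_pullbackD[OF E e(1) q(1)]
  have b: "b \<in> rlp C (Cf \<inter> W n)" using rlp_base_change[OF E e(1) q(1) e(2) CW] .
  have a: "a \<in> rlp C Cf" using rlp_base_change[OF is_pullback_sym[OF E] q(1) e(1) q(2) CfA] .
  have "e \<cdot> f' = q \<cdot> i \<cdot> d" using sq qi assoc[OF q(1) i d] by simp
  from pullback_ex[OF E e(1) q(1) f'(1) comp_hom[OF i d] this]
  obtain m where m: "m \<in> hom T' E" "a \<cdot> m = f'" "b \<cdot> m = i \<cdot> d" .
  \<comment> \<open>The factorization starting with a trivial cofibration is chosen so that i' has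
    lifts against the fibrations of the n-th structure; the retraction is built from such
    lifts.\<close>
  from M.factorization[OF M.functorial(2) m(1)]
  obtain X' where X': "lft (\<gamma> n) m \<in> hom T' X'" "rgt (\<gamma> n) m \<in> hom X' E" "rgt (\<gamma> n) m \<cdot> lft (\<gamma> n) m = m" .
  define i' r where "i' = lft (\<gamma> n) m" and "r = rgt (\<gamma> n) m"
  have i': "i' \<in> hom T' X'" and r: "r \<in> hom X' E" and ri: "r \<cdot> i' = m"
    using X' unfolding i'_def r_def by auto
  have i'C: "i' \<in> Cf" and i'W: "i' \<in> W n" and rF: "r \<in> rlp C (Cf \<inter> W n)"
    using M.lft_rgt[OF hom_arr[OF m(1)], of n] unfolding i'_def r_def by auto
  have q'i': "(a \<cdot> r) \<cdot> i' = f'" using assoc[OF D(1) r i'] ri m(2) by simp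
  \<comment> \<open>Two out of three is applied first to (a r) i' = f' and then to a r, where a is a
    weak equivalence as a member of \<open>rlp C Cf\<close>.\<close>
  have "a \<cdot> r \<in> W n"
    using M.W_right[OF i' comp_hom[OF D(1) r] i'W] q'i' f'(2) by simp
  then have "r \<in> W n"
    using M.W_left[OF r D(1) M.rlp_Cf_W[OF a]] by simp
  then have rC: "r \<in> rlp C Cf" using M.trivial_fibration_rlp[OF rF] by simp
  show thesis
  proof (rule that[of i' X' "a \<cdot> r" "b \<cdot> r", OF i' i'C i'W comp_hom[OF D(1) r] _ q'i' comp_hom[OF D(2) r]])
    show "a \<cdot> r \<in> rlp C Cf" using rlp_comp[OF rC r a D(1) CfA] .
    show "b \<cdot> r \<in> rlp C (Cf \<inter> W n)" using rlp_comp[OF rF r b D(2) CW] .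
    show "(b \<cdot> r) \<cdot> i' = i \<cdot> d" using assoc[OF D(2) r i'] ri m(3) by simp
    show "e \<cdot> a \<cdot> r = q \<cdot> b \<cdot> r" using assoc[OF e(1) D(1) r] assoc[OF q(1) D(2) r] D(3) by simp
    show "corner_lift X' X (b \<cdot> r) S' S e (a \<cdot> r) q"
      unfolding corner_lift_def
    proof (intro allI impI)
      fix j A B u v w
      assume j: "j \<in> Cf" "j \<in> hom A B" and u: "u \<in> hom A X'" and v: "v \<in> hom B S'" and w: "w \<in> hom B X"
        and eqs: "(a \<cdot> r) \<cdot> u = v \<cdot> j" "(b \<cdot> r) \<cdot> u = w \<cdot> j" "e \<cdot> v = q \<cdot> w"
      \<comment> \<open>The pair (v, w) is a map into the pullback E, and lifting it through r is
        the required corner lift.\<close>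
      from pullback_ex[OF E e(1) q(1) v w eqs(3)]
      obtain z where z: "z \<in> hom B E" "a \<cdot> z = v" "b \<cdot> z = w" .
      have "z \<cdot> j = r \<cdot> u"
        using assoc[OF D(1) r u] assoc[OF D(2) r u] assoc[OF D(1) z(1) j(2)] assoc[OF D(2) z(1) j(2)] eqs z
        by (intro pullback_eqI[OF E e(1) q(1) comp_hom[OF z(1) j(2)] comp_hom[OF r u]]) simp_all
      from rlpD[OF rC r j u z(1) this]
      obtain h where h: "h \<in> hom B X'" "h \<cdot> j = u" "r \<cdot> h = z" .
      then show "\<exists>h \<in> hom B X'. h \<cdot> j = u \<and> (a \<cdot> r) \<cdot> h = v \<and> (b \<cdot> r) \<cdot> h = w"
        using assoc[OF D(1) r h(1)] assoc[OF D(2) r h(1)] z by auto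
    qed
  qed
qed

lemma fibration_towerD:
  assumes "fibration_tower T d"
  shows "T 0 = st" "d n \<in> hom (T (Suc n)) (T n)" "d n \<in> rlp C (Cf \<inter> W n)"
  using assms unfolding fibration_tower_def by auto

lemma tower_mapD:
  assumes "tower_map T d S e f"
  shows "f n \<in> hom (T n) (S n)" "e n \<cdot> f (Suc n) = f n \<cdot> d n"
  using assms unfolding tower_map_def by auto

lemma tower_weqD:
  assumes "tower_weq T d S e f"
  shows "tower_map T d S e f" "f (Suc n) \<in> W n"
  using assms unfolding tower_weq_def by auto

text \<open>Iteration of \<open>corner_step\<close>. Each stage keeps q in \<open>rlp C Cf\<close>,
  since the next stage takes a base change of it.\<close>

lemma tower_factorization:
  assumes T: "fibration_tower T d" and S: "fibration_tower S e" and f: "tower_weq T d S e f"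
  obtains X p i q where "fibration_tower X p" "tower_weq T d X p i" "\<And>n. i (Suc n) \<in> Cf"
    "tower_map X p S e q" "\<And>n. q n \<cdot> i n = f n"
    "\<And>n. corner_lift (X (Suc n)) (X n) (p n) (S (Suc n)) (S n) (e n) (q (Suc n)) (q n)"
proof -
  note fm = tower_mapD[OF tower_weqD(1)[OF f]]
  \<comment> \<open>Level n + 1 is built over the choice made at level n, so dependent choice is
    used on triples (X, i, q). The transition map p belongs to two consecutive stages and is
    extracted from \<open>rel\<close> afterwards.\<close>
  define stage where "stage n x \<longleftrightarrow> (case x of (X, i, q) \<Rightarrow> i \<in> hom (T n) X \<and> q \<in> hom X (S n) \<and>
    q \<in> rlp C Cf \<and> q \<cdot> i = f n \<and> (n = 0 \<longrightarrow> X = st))" for n x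
  define rel where "rel n x x' \<longleftrightarrow> (case x of (X, i, q) \<Rightarrow> case x' of (X', i', q') \<Rightarrow>
    i' \<in> Cf \<and> i' \<in> W n \<and> (\<exists>p. p \<in> hom X' X \<and> p \<in> rlp C (Cf \<inter> W n) \<and> p \<cdot> i' = i \<cdot> d n \<and>
      e n \<cdot> q' = q \<cdot> p \<and> corner_lift X' X p (S (Suc n)) (S n) (e n) q' q))" for n x x'
  \<comment> \<open>f 0 is an endomorphism of the terminal object, so level 0 can be factored by
    identities.\<close>
  have f0: "f 0 = Idn C st"
    using fm(1)[of 0] tm_eq[OF _ id_hom[OF st_obj]] fibration_towerD(1)[OF T] fibration_towerD(1)[OF S] by simp
  have "stage 0 (st, Idn C st, Idn C st)"
    unfolding stage_def using fibration_towerD(1)[OF T] fibration_towerD(1)[OF S] f0 id_hom[OF st_obj]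
      id_l[OF id_hom[OF st_obj]] rlp_id[OF st_obj M.Cf_arr] by simp
  moreover have "\<exists>x'. stage (Suc n) x' \<and> rel n x x'" if stage: "stage n x" for n x
  proof -
    obtain X i q where x: "x = (X, i, q)" by (cases x)
    have i: "i \<in> hom (T n) X" and q: "q \<in> hom X (S n)" "q \<in> rlp C Cf" and qi: "q \<cdot> i = f n"
      using stage unfolding x stage_def by auto
    obtain X' i' q' p where "i' \<in> hom (T (Suc n)) X'" "i' \<in> Cf" "i' \<in> W n" "q' \<in> hom X' (S (Suc n))"
      "q' \<in> rlp C Cf" "q' \<cdot> i' = f (Suc n)" "p \<in> hom X' X" "p \<in> rlp C (Cf \<inter> W n)" "p \<cdot> i' = i \<cdot> d n"
      "e n \<cdot> q' = q \<cdot> p" "corner_lift X' X p (S (Suc n)) (S n) (e n) q' q"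
      by (rule corner_step[OF fibration_towerD(2)[OF T] fibration_towerD(2,3)[OF S] fm(1)
            tower_weqD(2)[OF f] fm(1) fm(2) i q qi])
    then have "stage (Suc n) (X', i', q')" "rel n x (X', i', q')"
      unfolding stage_def rel_def x by auto
    then show ?thesis by blast
  qed
  ultimately obtain F where F: "\<And>n. stage n (F n)" "\<And>n. rel n (F n) (F (Suc n))"
    using dependent_nat_choice[of stage rel] by metis
  define X i q where "X n = fst (F n)" and "i n = fst (snd (F n))" and "q n = snd (snd (F n))" for n
  have Fn: "F n = (X n, i n, q n)" for n unfolding X_def i_def q_def by simp
  have i: "i n \<in> hom (T n) (X n)" and q: "q n \<in> hom (X n) (S n)" and qi: "q n \<cdot> i n = f n" for n
    using F(1)[of n] unfolding Fn stage_def by auto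
  have X0: "X 0 = st" using F(1)[of 0] unfolding Fn stage_def by auto
  have iC: "i (Suc n) \<in> Cf" and iW: "i (Suc n) \<in> W n" for n
    using F(2)[of n] unfolding Fn rel_def by auto
  have "\<exists>p. p \<in> hom (X (Suc n)) (X n) \<and> p \<in> rlp C (Cf \<inter> W n) \<and> p \<cdot> i (Suc n) = i n \<cdot> d n \<and>
      e n \<cdot> q (Suc n) = q n \<cdot> p \<and>
      corner_lift (X (Suc n)) (X n) p (S (Suc n)) (S n) (e n) (q (Suc n)) (q n)" for n
    using F(2)[of n] unfolding Fn rel_def by auto
  then obtain p where p: "\<And>n. p n \<in> hom (X (Suc n)) (X n)" "\<And>n. p n \<in> rlp C (Cf \<inter> W n)"
    "\<And>n. p n \<cdot> i (Suc n) = i n \<cdot> d n" "\<And>n. e n \<cdot> q (Suc n) = q n \<cdot> p n"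
    "\<And>n. corner_lift (X (Suc n)) (X n) (p n) (S (Suc n)) (S n) (e n) (q (Suc n)) (q n)"
    by metis
  show thesis
  proof (rule that)
    show "fibration_tower X p" unfolding fibration_tower_def using X0 p(1,2) by blast
    show "tower_weq T d X p i" unfolding tower_weq_def tower_map_def using i p(3) iW by blast
    show "tower_map X p S e q" unfolding tower_map_def using q p(4) by blast
  qed (rule iC qi p(5))+
qed

text \<open>i (Suc n) is a trivial cofibration and d n a fibration for the same class W n. So the
  identity of T (Suc n) extends along i (Suc n) to a map over the retraction found at level n. By
  two out of three the retraction is again a weak equivalence of towers, ready to be factored in its
  turn.\<close>

lemma tower_retraction:
  assumes T: "fibration_tower T d" and X: "fibration_tower X p" and i: "tower_weq T d X p i"
    and iC: "\<And>n. i (Suc n) \<in> Cf"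
  obtains r where "tower_weq X p T d r" "\<And>n. r n \<cdot> i n = Idn C (T n)"
proof -
  note im = tower_mapD[OF tower_weqD(1)[OF i]] and iW = tower_weqD(2)[OF i]
  note d = fibration_towerD[OF T] and p = fibration_towerD[OF X]
  have obj: "T n \<in> Obj C" for n using hom_obj[OF im(1)] by blast
  define stage where "stage n r \<longleftrightarrow> r \<in> hom (X n) (T n) \<and> r \<cdot> i n = Idn C (T n)" for n r
  define rel where "rel n r r' \<longleftrightarrow> d n \<cdot> r' = r \<cdot> p n" for n r r'
  have "stage 0 (Idn C st)"
    unfolding stage_def using d(1) p(1) id_hom[OF st_obj] im(1)[of 0]
      tm_eq[OF comp_hom[OF id_hom[OF st_obj]] id_hom[OF st_obj]] by simp
  moreover have "\<exists>r'. stage (Suc n) r' \<and> rel n r r'" if "stage n r" for n r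
  proof -
    have r: "r \<in> hom (X n) (T n)" "r \<cdot> i n = Idn C (T n)" using that unfolding stage_def by auto
    \<comment> \<open>The outer square of the lifting problem: r p i (Suc n) = r i d n, and r i = 1
      at level n.\<close>
    have "(r \<cdot> p n) \<cdot> i (Suc n) = d n"
      using assoc[OF r(1) p(2) im(1)] im(2)[of n] assoc[OF r(1) im(1) d(2)] r(2) id_l[OF d(2)[of n]] by simp
    then have "(r \<cdot> p n) \<cdot> i (Suc n) = d n \<cdot> Idn C (T (Suc n))"
      using id_r[OF d(2)[of n]] by simp
    from rlpD[OF d(3,2) _ im(1) id_hom[OF obj] comp_hom[OF r(1) p(2)] this]
    obtain r' where "r' \<in> hom (X (Suc n)) (T (Suc n))" "r' \<cdot> i (Suc n) = Idn C (T (Suc n))" "d n \<cdot> r' = r \<cdot> p n"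
      using iC iW by blast
    then show ?thesis unfolding stage_def rel_def by blast
  qed
  ultimately obtain r where r: "\<And>n. stage n (r n)" "\<And>n. rel n (r n) (r (Suc n))"
    using dependent_nat_choice[of stage rel] by metis
  have rh: "r n \<in> hom (X n) (T n)" and ri: "r n \<cdot> i n = Idn C (T n)" for n
    using r(1)[of n] unfolding stage_def by auto
  have "r (Suc n) \<in> W n" for n
    using M.W_right[OF im(1) rh iW] ri M.W_id[OF obj] by simp
  then have "tower_weq X p T d r"
    unfolding tower_weq_def tower_map_def using rh r(2) unfolding rel_def by blast
  then show thesis using ri by (rule that)
qed

text \<open>A lift into the limit is a compatible family of lifts. The corner condition extends a
  given lift from level n to level n + 1, whereas lifts found independently at each level need not
  be compatible.\<close>

lemma limit_trivial_fibration:
  assumes X: "fibration_tower X p" and S: "fibration_tower S e" and q: "tower_map X p S e q"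
    and corner: "\<And>n. corner_lift (X (Suc n)) (X n) (p n) (S (Suc n)) (S n) (e n) (q (Suc n)) (q n)"
    and LX: "tower_limit C X p LX \<pi>" and LS: "tower_limit C S e LS \<rho>"
    and Q: "Q \<in> hom LX LS" "\<And>n. n \<ge> 1 \<Longrightarrow> \<rho> n \<cdot> Q = q n \<cdot> \<pi> n"
  shows "Q \<in> rlp C Cf"
proof (rule rlpI[OF Q(1) M.Cf_arr])
  fix j A B u v
  assume j: "j \<in> Cf" "j \<in> hom A B" and u: "u \<in> hom A LX" and v: "v \<in> hom B LS" and sq: "v \<cdot> j = Q \<cdot> u"
  note p = fibration_towerD[OF X] and e = fibration_towerD[OF S] and qm = tower_mapD[OF q]
  note PX = tower_limitD[OF LX] and PS = tower_limitD[OF LS]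
  have A: "A \<in> Obj C" and B: "B \<in> Obj C" using hom_obj[OF j(2)] by auto
  \<comment> \<open>Limit cones start at level 1. The terminal maps supply level 0, where the
    induction over levels begins.\<close>
  define x y where "x n = (if n = 0 then tm A else \<pi> n \<cdot> u)" and "y n = (if n = 0 then tm B else \<rho> n \<cdot> v)" for n
  have x: "x n \<in> hom A (X n)" and y: "y n \<in> hom B (S n)" for n
    unfolding x_def y_def using tm_hom[OF A] tm_hom[OF B] p(1) e(1)
      comp_hom[OF PX(2) u] comp_hom[OF PS(2) v] by auto
  have px: "p n \<cdot> x (Suc n) = x n" for n
  proof (cases "n = 0")
    case True
    then show ?thesis using tm_eq[of "p n \<cdot> x (Suc n)" A "x n"] comp_hom[OF p(2)[of 0] x[of "Suc 0"]] x[of n] p(1) by simp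
  next
    case False
    then have "p n \<cdot> \<pi> (Suc n) \<cdot> u = \<pi> n \<cdot> u"
      using assoc[OF p(2)[of n] PX(2)[of "Suc n"] u] PX(3)[of n] by simp
    then show ?thesis unfolding x_def using False by simp
  qed
  have ey: "e n \<cdot> y (Suc n) = y n" for n
  proof (cases "n = 0")
    case True
    then show ?thesis using tm_eq[of "e n \<cdot> y (Suc n)" B "y n"] comp_hom[OF e(2)[of 0] y[of "Suc 0"]] y[of n] e(1) by simp
  next
    case False
    then have "e n \<cdot> \<rho> (Suc n) \<cdot> v = \<rho> n \<cdot> v"
      using assoc[OF e(2)[of n] PS(2)[of "Suc n"] v] PS(3)[of n] by simp
    then show ?thesis unfolding y_def using False by simp
  qed
  have qx: "q n \<cdot> x n = y n \<cdot> j" for n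
  proof (cases "n = 0")
    case True
    then show ?thesis
      using tm_eq[of "q n \<cdot> x n" A "y n \<cdot> j"] comp_hom[OF qm(1)[of 0] x[of 0]] comp_hom[OF y[of 0] j(2)] e(1) by simp
  next
    case False
    then have n: "n \<ge> 1" by simp
    have "q n \<cdot> \<pi> n \<cdot> u = \<rho> n \<cdot> Q \<cdot> u"
      using assoc[OF qm(1) PX(2)[OF n] u] assoc[OF PS(2)[OF n] Q(1) u] Q(2)[OF n] by simp
    also have "\<dots> = (\<rho> n \<cdot> v) \<cdot> j"
      using assoc[OF PS(2)[OF n] v j(2)] sq by simp
    finally show ?thesis unfolding x_def y_def using False by simp
  qed
  define stage where "stage n w \<longleftrightarrow> w \<in> hom B (X n) \<and> w \<cdot> j = x n \<and> q n \<cdot> w = y n" for n w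
  have "stage 0 (tm B)"
    unfolding stage_def using tm_hom[OF B] p(1) e(1)
      tm_eq[OF comp_hom[OF tm_hom[OF B] j(2)], of "x 0"] x[of 0] tm_eq[of "q 0 \<cdot> tm B" B "y 0"]
      comp_hom[OF qm(1)[of 0], of "tm B" B] y[of 0] by simp
  moreover have "\<exists>w'. stage (Suc n) w' \<and> p n \<cdot> w' = w" if "stage n w" for n w
  proof -
    have w: "w \<in> hom B (X n)" "w \<cdot> j = x n" "q n \<cdot> w = y n" using that unfolding stage_def by auto
    have "\<exists>h\<in>hom B (X (Suc n)). h \<cdot> j = x (Suc n) \<and> q (Suc n) \<cdot> h = y (Suc n) \<and> p n \<cdot> h = w"
      using corner[of n, unfolded corner_lift_def, rule_format, OF j x y w(1) qx] px[of n] ey[of n] w(2,3) by simp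
    then show ?thesis unfolding stage_def by blast
  qed
  ultimately obtain w where w: "\<And>n. stage n (w n)" "\<And>n. p n \<cdot> w (Suc n) = w n"
    using dependent_nat_choice[of stage "\<lambda>n w w'. p n \<cdot> w' = w"] by metis
  have wh: "w n \<in> hom B (X n)" and wj: "w n \<cdot> j = x n" and qw: "q n \<cdot> w n = y n" for n
    using w(1)[of n] unfolding stage_def by auto
  obtain h where h: "h \<in> hom B LX" "\<And>n. n \<ge> 1 \<Longrightarrow> \<pi> n \<cdot> h = w n"
    by (rule tower_limit_ex[OF LX B wh w(2)]) (rule that)
  have "h \<cdot> j = u"
  proof (rule tower_limit_eqI[OF LX p(2) comp_hom[OF h(1) j(2)] u])
    show "\<pi> n \<cdot> h \<cdot> j = \<pi> n \<cdot> u" if n: "n \<ge> 1" for n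
      using assoc[OF PX(2)[OF n] h(1) j(2)] h(2)[OF n] wj[of n] n unfolding x_def by simp
  qed
  moreover have "Q \<cdot> h = v"
  proof (rule tower_limit_eqI[OF LS e(2) comp_hom[OF Q(1) h(1)] v])
    show "\<rho> n \<cdot> Q \<cdot> h = \<rho> n \<cdot> v" if n: "n \<ge> 1" for n
      using assoc[OF PS(2)[OF n] Q(1) h(1)] assoc[OF qm(1) PX(2)[OF n] h(1)] Q(2)[OF n] h(2)[OF n]
        qw[of n] n unfolding y_def by simp
  qed
  ultimately show "\<exists>h\<in>hom B LX. h \<cdot> j = u \<and> Q \<cdot> h = v" using h(1) by blast
qed

lemma limit_tower_map:
  assumes X: "fibration_tower X p" and S: "fibration_tower S e" and q: "tower_map X p S e q"
    and LX: "tower_limit C X p LX \<pi>" and LS: "tower_limit C S e LS \<rho>"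
  obtains Q where "Q \<in> hom LX LS" "\<And>n. n \<ge> 1 \<Longrightarrow> \<rho> n \<cdot> Q = q n \<cdot> \<pi> n"
  by (rule limit_map_ex[OF LX LS fibration_towerD(2)[OF X] fibration_towerD(2)[OF S] tower_mapD[OF q]]) (rule that)

text \<open>
  A weak equivalence \<open>f\<close> of fibration towers factors as \<open>q i\<close>, where \<open>lim q\<close> is a trivial fibration
  and \<open>i\<close> has a retraction \<open>r\<close>.  Factoring \<open>r = q2 i2\<close> in the same way, \<open>lim i2\<close> has a left inverse,
  and by \<open>q2 i2 i = 1\<close> also a right inverse in the homotopy category.  No homotopies are needed.
\<close>

theorem limit_weq_isomorphism:
  assumes V: "rlp C Cf \<subseteq> V" "V \<subseteq> Arr C"
    and T: "fibration_tower T d" and S: "fibration_tower S e" and f: "tower_weq T d S e f"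
    and LT: "tower_limit C T d LT \<tau>" and LS: "tower_limit C S e LS \<sigma>"
    and h: "h \<in> hom LT LS" "\<And>n. n \<ge> 1 \<Longrightarrow> \<sigma> n \<cdot> h = f n \<cdot> \<tau> n"
  shows "isomorphism (localization C V) (far (loc_func C V) h)"
proof -
  interpret L: localized C V by standard (rule V(2))
  obtain X p i q where
    X: "fibration_tower X p" and i: "tower_weq T d X p i" and iC: "\<And>n. i (Suc n) \<in> Cf"
    and q: "tower_map X p S e q" and qi: "\<And>n. q n \<cdot> i n = f n"
    and qc: "\<And>n. corner_lift (X (Suc n)) (X n) (p n) (S (Suc n)) (S n) (e n) (q (Suc n)) (q n)"
    by (rule tower_factorization[OF T S f]) (rule that)
  obtain r where
    r: "tower_weq X p T d r" and ri: "\<And>n. r n \<cdot> i n = Idn C (T n)"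
    by (rule tower_retraction[OF T X i iC]) (rule that)
  obtain X2 p2 i2 q2 where
    X2: "fibration_tower X2 p2" and i2: "tower_weq X p X2 p2 i2" and i2C: "\<And>n. i2 (Suc n) \<in> Cf"
    and q2: "tower_map X2 p2 T d q2" and qi2: "\<And>n. q2 n \<cdot> i2 n = r n"
    and qc2: "\<And>n. corner_lift (X2 (Suc n)) (X2 n) (p2 n) (T (Suc n)) (T n) (d n) (q2 (Suc n)) (q2 n)"
    by (rule tower_factorization[OF X T r]) (rule that)
  obtain r2 where
    r2: "tower_weq X2 p2 X p r2" and ri2: "\<And>n. r2 n \<cdot> i2 n = Idn C (X n)"
    by (rule tower_retraction[OF X X2 i2 i2C]) (rule that)
  obtain LX \<xi> where LX: "tower_limit C X p LX \<xi>"
    using tower_limits[of p X] fibration_towerD(2)[OF X] by blast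
  obtain LX2 \<xi>2 where LX2: "tower_limit C X2 p2 LX2 \<xi>2"
    using tower_limits[of p2 X2] fibration_towerD(2)[OF X2] by blast
  note im = tower_weqD(1)[OF i] and i2m = tower_weqD(1)[OF i2] and r2m = tower_weqD(1)[OF r2]
  obtain I where
    I: "I \<in> hom LT LX" "\<And>n. n \<ge> 1 \<Longrightarrow> \<xi> n \<cdot> I = i n \<cdot> \<tau> n"
    by (rule limit_tower_map[OF T X im LT LX]) (rule that)
  obtain Q where
    Q: "Q \<in> hom LX LS" "\<And>n. n \<ge> 1 \<Longrightarrow> \<sigma> n \<cdot> Q = q n \<cdot> \<xi> n"
    by (rule limit_tower_map[OF X S q LX LS]) (rule that)
  obtain I2 where
    I2: "I2 \<in> hom LX LX2" "\<And>n. n \<ge> 1 \<Longrightarrow> \<xi>2 n \<cdot> I2 = i2 n \<cdot> \<xi> n"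
    by (rule limit_tower_map[OF X X2 i2m LX LX2]) (rule that)
  obtain Q2 where
    Q2: "Q2 \<in> hom LX2 LT" "\<And>n. n \<ge> 1 \<Longrightarrow> \<tau> n \<cdot> Q2 = q2 n \<cdot> \<xi>2 n"
    by (rule limit_tower_map[OF X2 T q2 LX2 LT]) (rule that)
  obtain R2 where
    R2: "R2 \<in> hom LX2 LX" "\<And>n. n \<ge> 1 \<Longrightarrow> \<xi> n \<cdot> R2 = r2 n \<cdot> \<xi>2 n"
    by (rule limit_tower_map[OF X2 X r2m LX2 LX]) (rule that)
  \<comment> \<open>Compatibility with the projections passes to composites, so the three identities
    between limit maps below can be read off level by level.\<close>
  have paste: "\<zeta> \<cdot> G \<cdot> F = (g \<cdot> f) \<cdot> \<theta>"
    if F: "F \<in> hom A B" and G: "G \<in> hom B D" and "\<eta> \<in> hom B b" "\<zeta> \<in> hom D c" and \<theta>: "\<theta> \<in> hom A a"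
      and f: "f \<in> hom a b" and g: "g \<in> hom b c"
      and "\<eta> \<cdot> F = f \<cdot> \<theta>" "\<zeta> \<cdot> G = g \<cdot> \<eta>"
    for F G A B D a b c f g \<theta> \<eta> \<zeta>
    using assoc[OF that(4) G F] assoc[OF g that(3) F] assoc[OF g f \<theta>] that(8,9) by simp
  note tT = fibration_towerD(2)[OF T] and tS = fibration_towerD(2)[OF S] and tX = fibration_towerD(2)[OF X]
  note l\<tau> = tower_limitD(2)[OF LT] and l\<sigma> = tower_limitD(2)[OF LS]
    and l\<xi> = tower_limitD(2)[OF LX] and l\<xi>2 = tower_limitD(2)[OF LX2]
  note hi = tower_mapD(1)[OF im] and hq = tower_mapD(1)[OF q] and hi2 = tower_mapD(1)[OF i2m]
    and hq2 = tower_mapD(1)[OF q2] and hr2 = tower_mapD(1)[OF r2m]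
  have QI: "Q \<cdot> I = h"
  proof (rule tower_limit_eqI[OF LS tS comp_hom[OF Q(1) I(1)] h(1)])
    show "\<sigma> n \<cdot> Q \<cdot> I = \<sigma> n \<cdot> h" if n: "n \<ge> 1" for n
      using paste[OF I(1) Q(1) l\<xi>[OF n] l\<sigma>[OF n] l\<tau>[OF n] hi hq I(2)[OF n] Q(2)[OF n]] qi h(2)[OF n] by simp
  qed
  have RI2: "R2 \<cdot> I2 = Idn C LX"
  proof (rule tower_limit_eqI[OF LX tX comp_hom[OF R2(1) I2(1)] id_hom[OF tower_limitD(1)[OF LX]]])
    show "\<xi> n \<cdot> R2 \<cdot> I2 = \<xi> n \<cdot> Idn C LX" if n: "n \<ge> 1" for n
      using paste[OF I2(1) R2(1) l\<xi>2[OF n] l\<xi>[OF n] l\<xi>[OF n] hi2 hr2 I2(2)[OF n] R2(2)[OF n]] ri2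
        id_l[OF l\<xi>[OF n]] id_r[OF l\<xi>[OF n]] by simp
  qed
  have QI2: "Q2 \<cdot> I2 \<cdot> I = Idn C LT"
  proof (rule tower_limit_eqI[OF LT tT comp_hom[OF Q2(1) comp_hom[OF I2(1) I(1)]] id_hom[OF tower_limitD(1)[OF LT]]])
    fix n :: nat assume n: "n \<ge> 1"
    have 1: "\<xi>2 n \<cdot> I2 \<cdot> I = (i2 n \<cdot> i n) \<cdot> \<tau> n"
      using paste[OF I(1) I2(1) l\<xi>[OF n] l\<xi>2[OF n] l\<tau>[OF n] hi hi2 I(2)[OF n] I2(2)[OF n]] .
    have "\<tau> n \<cdot> Q2 \<cdot> I2 \<cdot> I = (q2 n \<cdot> i2 n \<cdot> i n) \<cdot> \<tau> n"
      using paste[OF comp_hom[OF I2(1) I(1)] Q2(1) l\<xi>2[OF n] l\<tau>[OF n] l\<tau>[OF n] comp_hom[OF hi2 hi] hq2 1 Q2(2)[OF n]] .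
    then show "\<tau> n \<cdot> Q2 \<cdot> I2 \<cdot> I = \<tau> n \<cdot> Idn C LT"
      using assoc[OF hq2 hi2 hi] qi2 ri id_l[OF l\<tau>[OF n]] id_r[OF l\<tau>[OF n]] by simp
  qed
  have "isomorphism L.H (far L.Ho Q)"
    using limit_trivial_fibration[OF X S q qc LX LS Q] V(1) by (intro L.Ho_isomorphism) blast
  \<comment> \<open>I is the unknown map, I2 has the left inverse R2, and Q2 is inverted as a limit
    of corner-lifting maps, with Q2 I2 I = 1.\<close>
  moreover have "isomorphism L.H (far L.Ho I)"
  proof (rule L.H.isomorphism_two_of_six)
    show "isomorphism L.H (far L.Ho Q2)"
      using limit_trivial_fibration[OF X2 T q2 qc2 LX2 LT Q2] V(1) by (intro L.Ho_isomorphism) blast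
    show "far L.Ho I \<in> homset L.H LT LX" "far L.Ho I2 \<in> homset L.H LX LX2"
      "far L.Ho R2 \<in> homset L.H LX2 LX" "far L.Ho Q2 \<in> homset L.H LX2 LT"
      using L.Ho_hom I(1) I2(1) R2(1) Q2(1) by auto
    show "Cmp L.H (far L.Ho R2) (far L.Ho I2) = Idn L.H LX"
      using L.Ho_cmp[OF I2(1) R2(1)] RI2 L.Ho_id[OF tower_limitD(1)[OF LX]] by simp
    show "Cmp L.H (far L.Ho Q2) (Cmp L.H (far L.Ho I2) (far L.Ho I)) = Idn L.H LT"
      using L.Ho_cmp[OF comp_hom[OF I2(1) I(1)] Q2(1)] L.Ho_cmp[OF I(1) I2(1)] QI2
        L.Ho_id[OF tower_limitD(1)[OF LT]] by simp
  qed
  ultimately show ?thesis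
    using L.H.isomorphism_comp[OF L.Ho_hom[OF I(1)] _ L.Ho_hom[OF Q(1)]] L.Ho_cmp[OF I(1) Q(1)] QI by simp
qed

text \<open>The tower st, X, X, ... whose transition maps above the bottom are identities has limit
  X, so the limit statement applies. The result plays the role of Ken Brown's lemma, with an
  isomorphism in the localization as its conclusion.\<close>

lemma fibrant_weq_isomorphism:
  assumes V: "rlp C Cf \<subseteq> V" "V \<subseteq> Arr C" and const: "\<And>n. W n = W 0"
    and f: "f \<in> hom A B" "f \<in> W 0" and A: "tm A \<in> rlp C (Cf \<inter> W 0)" and B: "tm B \<in> rlp C (Cf \<inter> W 0)"
  shows "isomorphism (localization C V) (far (loc_func C V) f)"
proof -
  have obj: "A \<in> Obj C" "B \<in> Obj C" using hom_obj[OF f(1)] by auto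
  define T where "T X n = (if n = 0 then st else X)" for X :: 'o and n :: nat
  define d where "d X n = (if n = 0 then tm X else Idn C X)" for X and n :: nat
  have ft: "fibration_tower (T X) (d X)" if X: "X \<in> Obj C" "tm X \<in> rlp C (Cf \<inter> W 0)" for X
    unfolding fibration_tower_def
  proof (intro conjI allI)
    fix n
    have "Idn C X \<in> rlp C (Cf \<inter> W 0)" using rlp_id[OF X(1)] M.Cf_arr by blast
    then show "d X n \<in> rlp C (Cf \<inter> W n)"
      unfolding const[of n] d_def using X(2) by simp
    show "d X n \<in> hom (T X (Suc n)) (T X n)"
      unfolding d_def T_def using tm_hom[OF X(1)] id_hom[OF X(1)] by simp
  qed (simp add: T_def)
  have lim: "tower_limit C (T X) (d X) X (\<lambda>_. Idn C X)" if X: "X \<in> Obj C" for X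
    unfolding tower_limit_def
  proof (intro conjI allI impI)
    show "tower_cone C (T X) (d X) X (\<lambda>_. Idn C X)"
      unfolding tower_cone_def T_def d_def using X id_l[OF id_hom[OF X]] by simp
    fix K \<kappa> assume "tower_cone C (T X) (d X) K \<kappa>"
    then have \<kappa>: "\<kappa> n \<in> hom K X" "Idn C X \<cdot> \<kappa> (Suc n) = \<kappa> n" if "n \<ge> 1" for n
      using that unfolding tower_cone_def T_def d_def by auto
    have \<kappa>1: "\<kappa> n = \<kappa> 1" if "n \<ge> 1" for n
      using that
    proof (induction rule: dec_induct)
      case (step m)
      then show ?case using \<kappa>(2)[of m] id_l[OF \<kappa>(1)[of "Suc m"]] by simp
    qed simp
    show "\<exists>!h. h \<in> hom K X \<and> (\<forall>n\<ge>1. Idn C X \<cdot> h = \<kappa> n)"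
    proof (rule ex1I[of _ "\<kappa> 1"])
      have "Idn C X \<cdot> \<kappa> 1 = \<kappa> n" if "n \<ge> 1" for n
        using \<kappa>1[OF that] id_l[OF \<kappa>(1)[of 1]] by simp
      then show "\<kappa> 1 \<in> hom K X \<and> (\<forall>n\<ge>1. Idn C X \<cdot> \<kappa> 1 = \<kappa> n)"
        using \<kappa>(1)[of 1] by simp
      show "h = \<kappa> 1" if "h \<in> hom K X \<and> (\<forall>n\<ge>1. Idn C X \<cdot> h = \<kappa> n)" for h
        using that id_l[of h K X] by auto
    qed
  qed
  define g where "g n = (if n = 0 then Idn C st else f)" for n :: nat
  have weq: "tower_weq (T A) (d A) (T B) (d B) g"
    unfolding tower_weq_def tower_map_def
  proof (intro conjI allI)
    fix n
    show "g n \<in> hom (T A n) (T B n)" "g (Suc n) \<in> W n"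
      using f const[of n] id_hom[OF st_obj] unfolding g_def T_def by auto
    show "d B n \<cdot> g (Suc n) = g n \<cdot> d A n"
      using tm_eq[OF comp_hom[OF tm_hom[OF obj(2)] f(1)] tm_hom[OF obj(1)]] id_l[OF tm_hom[OF obj(1)]]
        id_l[OF f(1)] id_r[OF f(1)] unfolding g_def d_def by simp
  qed
  show ?thesis
    by (rule limit_weq_isomorphism[OF V ft[OF obj(1) A] ft[OF obj(2) B] weq lim[OF obj(1)] lim[OF obj(2)] f(1)])
      (use id_l[OF f(1)] id_r[OF f(1)] in \<open>simp add: g_def\<close>)
qed

end

section \<open>The tower of a sequence of functorial factorizations\<close>

locale slice_tower = tower_complete C st tm
  for C :: "('o, 'm) cat" and st and tm :: "'o \<Rightarrow> 'm" +
  fixes \<gamma> :: "nat \<Rightarrow> 'm ffact"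
  assumes ff: "\<And>n. functorial_factorization C (\<gamma> n)"
begin

abbreviation "\<tau> \<equiv> tau C tm \<gamma>"
abbreviation "\<tau>le \<equiv> tau_le tm \<gamma>"
abbreviation "\<nu> \<equiv> nu tm \<gamma>"

lemma ff_lft_rgt:
  assumes "f \<in> hom A B"
  shows "lft (\<gamma> n) f \<in> hom A (Cod C (lft (\<gamma> n) f))" "rgt (\<gamma> n) f \<in> hom (Cod C (lft (\<gamma> n) f)) B"
    "rgt (\<gamma> n) f \<cdot> lft (\<gamma> n) f = f" "mid (\<gamma> n) f f (Idn C A) (Idn C B) = Idn C (Cod C (lft (\<gamma> n) f))"
  using ff[of n] assms unfolding functorial_factorization_def homset_def by auto

lemma ff_mid:
  assumes "square C f g u v"
  shows "mid (\<gamma> n) f g u v \<in> hom (Cod C (lft (\<gamma> n) f)) (Cod C (lft (\<gamma> n) g))"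
    "mid (\<gamma> n) f g u v \<cdot> lft (\<gamma> n) f = lft (\<gamma> n) g \<cdot> u"
    "v \<cdot> rgt (\<gamma> n) f = rgt (\<gamma> n) g \<cdot> mid (\<gamma> n) f g u v"
  using ff[of n] assms unfolding functorial_factorization_def by auto

lemma ff_mid_comp:
  assumes "square C f g u v" "square C g h u' v'"
  shows "mid (\<gamma> n) f h (u' \<cdot> u) (v' \<cdot> v) = mid (\<gamma> n) g h u' v' \<cdot> mid (\<gamma> n) f g u v"
proof -
  have "\<forall>f g h u v u' v'. square C f g u v \<longrightarrow> square C g h u' v' \<longrightarrow>
      mid (\<gamma> n) f h (Cmp C u' u) (Cmp C v' v) = Cmp C (mid (\<gamma> n) g h u' v') (mid (\<gamma> n) f g u v)"
    using ff[of n] unfolding functorial_factorization_def by (elim conjE)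
  then show ?thesis using assms by simp
qed

lemma fob_\<tau>: "fob (\<tau> n) A = Cod C (\<tau>le n A)" and far_\<tau>: "far (\<tau> n) f = tau_arr C tm \<gamma> n f"
  unfolding tau_def by simp_all

lemma \<tau>_0: "A \<in> Obj C \<Longrightarrow> fob (\<tau> 0) A = st"
  using hom_cod[OF tm_hom] by (simp add: fob_\<tau>)

lemma \<tau>le_hom: "A \<in> Obj C \<Longrightarrow> \<tau>le n A \<in> hom A (fob (\<tau> n) A)"
proof (induction n)
  case 0
  then show ?case using tm_hom \<tau>_0 by simp
next
  case (Suc n)
  then show ?case using ff_lft_rgt(1)[of "\<tau>le n A"] by (simp add: fob_\<tau>)
qed

lemma \<nu>_hom: "A \<in> Obj C \<Longrightarrow> \<nu> n A \<in> hom (fob (\<tau> (Suc n)) A) (fob (\<tau> n) A)"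
  using ff_lft_rgt(2)[OF \<tau>le_hom] unfolding nu_def by (simp add: fob_\<tau>)

lemma \<nu>_\<tau>le: "A \<in> Obj C \<Longrightarrow> \<nu> n A \<cdot> \<tau>le (Suc n) A = \<tau>le n A"
  using ff_lft_rgt(3)[OF \<tau>le_hom] unfolding nu_def by simp

text \<open>The middle map of a functorial factorization is controlled only on commutative squares.
  So the square at level n must be known before anything can be said about the arrow part at level n
  + 1.\<close>

lemma \<tau>_square:
  assumes "f \<in> hom A B"
  shows "square C (\<tau>le n A) (\<tau>le n B) f (far (\<tau> n) f)"
proof (induction n)
  case 0
  have obj: "A \<in> Obj C" "B \<in> Obj C" using hom_obj[OF assms] by auto
  have "far (\<tau> 0) f = Idn C st" using assms hom_cod[OF tm_hom] obj by (simp add: far_\<tau>)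
  then show ?case
    unfolding square_def using assms hom_arr[OF tm_hom] obj id_hom[OF st_obj]
      tm_eq[OF comp_hom[OF id_hom[OF st_obj] tm_hom[OF obj(1)]] comp_hom[OF tm_hom[OF obj(2)] assms]]
    by (simp add: hom_dom[OF tm_hom] hom_cod[OF tm_hom])
next
  case (Suc n)
  have obj: "A \<in> Obj C" "B \<in> Obj C" using hom_obj[OF assms] by auto
  note A = \<tau>le_hom[OF obj(1), of "Suc n"] and B = \<tau>le_hom[OF obj(2), of "Suc n"]
  show ?case
    unfolding square_def hom_dom[OF A] hom_dom[OF B] hom_cod[OF A] hom_cod[OF B]
    using ff_mid(1,2)[OF Suc, of n] assms hom_arr[OF A] hom_arr[OF B]
    by (simp add: far_\<tau> fob_\<tau> hom_dom[OF assms] hom_cod[OF assms])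
qed

lemma \<tau>_hom:
  assumes "f \<in> hom A B"
  shows "far (\<tau> n) f \<in> hom (fob (\<tau> n) A) (fob (\<tau> n) B)" "far (\<tau> n) f \<cdot> \<tau>le n A = \<tau>le n B \<cdot> f"
  using \<tau>_square[OF assms, of n] unfolding square_def by (simp_all add: fob_\<tau>)

lemma \<tau>_Suc: "f \<in> hom A B \<Longrightarrow> far (\<tau> (Suc n)) f = mid (\<gamma> n) (\<tau>le n A) (\<tau>le n B) f (far (\<tau> n) f)"
  by (simp add: far_\<tau>)

lemma \<nu>_natural:
  assumes "f \<in> hom A B"
  shows "\<nu> n B \<cdot> far (\<tau> (Suc n)) f = far (\<tau> n) f \<cdot> \<nu> n A"
  using ff_mid(3)[OF \<tau>_square[OF assms], of n n] \<tau>_Suc[OF assms] unfolding nu_def by simp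

lemma \<tau>_functor: "is_functor C C (\<tau> n)"
proof (rule functorI)
  show obj: "fob (\<tau> n) A \<in> Obj C" if "A \<in> Obj C" for n A
    using hom_obj[OF \<tau>le_hom[OF that]] by blast
  show "far (\<tau> n) (Idn C A) = Idn C (fob (\<tau> n) A)" if A: "A \<in> Obj C" for A
  proof (induction n)
    case 0
    then show ?case using tm_eq[OF \<tau>_hom(1)[OF id_hom[OF A], of 0, unfolded \<tau>_0[OF A]] id_hom[OF st_obj]] \<tau>_0[OF A] by simp
  next
    case (Suc n)
    then show ?case
      using \<tau>_Suc[OF id_hom[OF A], of n] ff_lft_rgt(4)[OF \<tau>le_hom[OF A], of n n] by (simp add: fob_\<tau>)
  qed
  show "far (\<tau> n) f \<in> hom (fob (\<tau> n) A) (fob (\<tau> n) B)" if "f \<in> hom A B" for f A B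
    using \<tau>_hom(1)[OF that] .
  show "far (\<tau> n) (g \<cdot> f) = far (\<tau> n) g \<cdot> far (\<tau> n) f" if f: "f \<in> hom A B" and g: "g \<in> hom B D" for f g A B D
  proof (induction n)
    case 0
    have D: "D \<in> Obj C" using hom_obj[OF g] by blast
    show ?case
      using tm_eq \<tau>_hom(1)[OF comp_hom[OF g f], of 0] comp_hom[OF \<tau>_hom(1)[OF g, of 0] \<tau>_hom(1)[OF f, of 0]] \<tau>_0[OF D]
      by simp
  next
    case (Suc n)
    then show ?case
      using \<tau>_Suc[OF comp_hom[OF g f]] \<tau>_Suc[OF f] \<tau>_Suc[OF g] ff_mid_comp[OF \<tau>_square[OF f] \<tau>_square[OF g]] by simp
  qed
qed

lemma \<tau>le_nat_trans: "nat_trans C C id_func (\<tau> n) (\<tau>le n)"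
  using \<tau>le_hom \<tau>_hom(2) by (intro nat_transI) (simp_all add: id_func_def)

lemma \<nu>_nat_trans: "nat_trans C C (\<tau> (Suc n)) (\<tau> n) (\<nu> n)"
  using \<nu>_hom \<nu>_natural by (intro nat_transI) simp_all

lemma const_functor: "is_functor C C (const_func C st)"
  using st_obj id_hom[OF st_obj] id_l[OF id_hom[OF st_obj]]
  by (intro functorI) (simp_all add: const_func_def)

lemma tm_nat_trans:
  assumes "is_functor C C F"
  shows "nat_trans C C F (const_func C st) (\<lambda>A. tm (fob F A))"
proof (rule nat_transI; simp add: const_func_def)
  show "tm (fob F A) \<in> hom (fob F A) st" if "A \<in> Obj C" for A
    using tm_hom[OF functor_obj[OF assms that]] .
  show "tm (fob F B) \<cdot> far F f = Idn C st \<cdot> tm (fob F A)" if f: "f \<in> hom A B" for f A B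
  proof -
    have obj: "fob F A \<in> Obj C" "fob F B \<in> Obj C" using hom_obj[OF functor_hom[OF assms f]] by auto
    show ?thesis
      using tm_eq[OF comp_hom[OF tm_hom[OF obj(2)] functor_hom[OF assms f]] comp_hom[OF id_hom[OF st_obj] tm_hom[OF obj(1)]]] .
  qed
qed

end

section \<open>Induced functors on the homotopy category\<close>

context localized
begin

definition induces ::
  "('o, ('o, 'm) loc_arr, 'o, ('o, 'm) loc_arr) func \<Rightarrow> ('o, 'm, 'o, 'm) func \<Rightarrow> bool" where
  "induces F' F \<longleftrightarrow> is_functor H H F' \<and> (\<forall>a\<in>Obj C. fob F' a = fob F a) \<and>
     (\<forall>f\<in>Arr C. far F' (far Ho f) = far Ho (far F f))"

lemma induces_id: "induces id_func id_func"
  unfolding induces_def using functor_id_func[OF H_category] by (simp add: id_func_def)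

lemma induces_const:
  assumes "b \<in> Obj C"
  shows "induces (const_func H b) (const_func C b)"
proof -
  have "is_functor H H (const_func H b)"
    using assms H.id_hom[of b] H.id_l[OF H.id_hom[of b]]
    by (intro H.functorI) (simp_all add: const_func_def)
  then show ?thesis
    unfolding induces_def using Ho_id[OF assms] by (simp add: const_func_def)
qed

text \<open>The universal property is applied to \<open>Ho\<close> after F. It asks that F send W to
  maps invertible in H, which is weaker than preserving W.\<close>

lemma induces_ex:
  assumes F: "is_functor C C F" and W: "\<And>w. w \<in> W \<Longrightarrow> isomorphism H (far Ho (far F w))"
  shows "\<exists>F'. induces F' F"
proof -
  have inv: "inverting_functor C W H (comp_func Ho F)"
    using functor_comp[OF F Ho_functor] W by unfold_locales (simp_all add: comp_func_def)
  have "far (localized_func C H (comp_func Ho F)) (far Ho f) = far Ho (far F f)" if "f \<in> Arr C" for f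
    using inverting_functor.far_F'_Ho[OF inv arr_hom[OF that]] by (simp add: comp_func_def)
  then have "induces (localized_func C H (comp_func Ho F)) F"
    unfolding induces_def using inverting_functor.localized_functor[OF inv] inverting_functor.fob_F'[OF inv]
    by (simp add: comp_func_def)
  then show ?thesis by blast
qed

lemma induces_functor_eq:
  assumes "induces F' F"
  shows "functor_eq C (comp_func F' Ho) (comp_func Ho F)"
  using assms unfolding induces_def functor_eq_def comp_func_def by simp

lemma induces_unique:
  assumes F': "induces F' F" and G: "is_functor H H G" "functor_eq C (comp_func G Ho) (comp_func Ho F)"
  shows "functor_eq H G F'"
proof (rule functor_eq_localized[OF G(1)])
  show "is_functor H H F'" using F' unfolding induces_def by simp
  show "functor_eq C (comp_func G Ho) (comp_func F' Ho)"
    using G(2) induces_functor_eq[OF F'] unfolding functor_eq_def by simp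
qed

lemma induces_nat_trans:
  assumes F: "induces F' F" and G: "induces G' G"
    and FG: "is_functor C C F" "is_functor C C G" and \<eta>: "nat_trans C C F G \<eta>"
  shows "nat_trans H H F' G' (\<lambda>a. far Ho (\<eta> a))"
proof (rule nat_trans_localized)
  show "is_functor H H F'" "is_functor H H G'" using F G unfolding induces_def by auto
  show "far Ho (\<eta> a) \<in> homset H (fob F' a) (fob G' a)" if "a \<in> Obj C" for a
    using Ho_hom[OF nat_trans_hom[OF \<eta> that]] F G that unfolding induces_def by simp
  show "Cmp H (far Ho (\<eta> b)) (far F' (far Ho f)) = Cmp H (far G' (far Ho f)) (far Ho (\<eta> a))"
    if f: "f \<in> hom a b" for f a b
  proof -
    have ab: "a \<in> Obj C" "b \<in> Obj C" using hom_obj[OF f] by auto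
    have "far F' (far Ho f) = far Ho (far F f)" "far G' (far Ho f) = far Ho (far G f)"
      using F G hom_arr[OF f] unfolding induces_def by auto
    then show ?thesis
      using Ho_cmp[OF functor_hom[OF FG(1) f] nat_trans_hom[OF \<eta> ab(2)]]
        Ho_cmp[OF nat_trans_hom[OF \<eta> ab(1)] functor_hom[OF FG(2) f]] nat_trans_sq[OF \<eta> f] by simp
  qed
qed

end

section \<open>Slice towers in model categories\<close>

text \<open>V stands for the motivic weak equivalences, W n for those of the n-th localization. The
  inclusion of V makes fibrations of every level motivic fibrations; the decrease of W keeps
  fibrations of one level fibrations for the later structures.\<close>

locale slice_model = model_family C st tm W Cf \<alpha> \<gamma> + V: model C V Cf \<alpha>\<^sub>0 \<gamma>\<^sub>0
  for C :: "('o, 'm) cat" and st and tm :: "'o \<Rightarrow> 'm" and W :: "nat \<Rightarrow> 'm set" and Cf :: "'m set"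
    and \<alpha> \<gamma> :: "nat \<Rightarrow> 'm ffact" and V :: "'m set" and \<alpha>\<^sub>0 \<gamma>\<^sub>0 :: "'m ffact" +
  assumes V_W: "V \<subseteq> W n" and W_decreasing: "W (Suc n) \<subseteq> W n"
begin

sublocale slice_tower C st tm \<gamma>
  by standard (rule M.functorial(2))

sublocale localized C V
  by standard (rule V.W_arr)

lemma fibs_V: "rlp C (Cf \<inter> W n) \<subseteq> rlp C (Cf \<inter> V)"
  using V_W[of n] by (intro rlp_antimono) blast

lemma \<tau>le_W: "A \<in> Obj C \<Longrightarrow> \<tau>le (Suc n) A \<in> W n"
  and \<nu>_fib: "A \<in> Obj C \<Longrightarrow> \<nu> n A \<in> rlp C (Cf \<inter> W n)"
  using M.lft_rgt[OF hom_arr[OF \<tau>le_hom[of A n]], of n] unfolding nu_def by simp_all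

lemma \<tau>_fibration_tower: "A \<in> Obj C \<Longrightarrow> fibration_tower (\<lambda>n. fob (\<tau> n) A) (\<lambda>n. \<nu> n A)"
  unfolding fibration_tower_def using \<tau>_0 \<nu>_hom \<nu>_fib by simp

text \<open>In the naturality square of \<tau>le the map f and the two maps \<tau>le (Suc n) are
  weak equivalences of the n-th structure, and two out of three gives the fourth side.\<close>

lemma \<tau>_W:
  assumes f: "f \<in> hom A B" "f \<in> V"
  shows "far (\<tau> (Suc n)) f \<in> W n"
proof -
  have A: "A \<in> Obj C" and B: "B \<in> Obj C" using hom_obj[OF f(1)] by auto
  have "f \<in> W n" using f(2) V_W by blast
  then have "\<tau>le (Suc n) B \<cdot> f \<in> W n"
    using M.W_comp[OF f(1) \<tau>le_hom[OF B, of "Suc n"]] \<tau>le_W[OF B] hom_dom[OF \<tau>le_hom[OF B, of "Suc n"]]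
      hom_cod[OF f(1)] by simp
  then show ?thesis
    using M.W_right[OF \<tau>le_hom[OF A] \<tau>_hom(1)[OF f(1)] \<tau>le_W[OF A]] \<tau>_hom(2)[OF f(1), of "Suc n"] by simp
qed

lemma \<tau>_tower_weq:
  assumes f: "f \<in> hom A B" "f \<in> V"
  shows "tower_weq (\<lambda>n. fob (\<tau> n) A) (\<lambda>n. \<nu> n A) (\<lambda>n. fob (\<tau> n) B) (\<lambda>n. \<nu> n B) (\<lambda>n. far (\<tau> n) f)"
  unfolding tower_weq_def tower_map_def using \<tau>_W[OF f] \<tau>_hom(1)[OF f(1)] \<nu>_natural[OF f(1)] by blast

text \<open>The map to the terminal object is the composite of \<nu> n, ..., \<nu> 0. Each factor is
  a fibration for some W m with m \<le> n, hence for W n because the classes decrease.\<close>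

lemma tm_\<tau>_fib:
  assumes A: "A \<in> Obj C"
  shows "tm (fob (\<tau> (Suc n)) A) \<in> rlp C (Cf \<inter> W n)"
proof (induction n)
  case 0
  have "\<nu> 0 A = tm (fob (\<tau> (Suc 0)) A)"
    using \<nu>_hom[OF A, of 0] \<tau>_0[OF A] tm_unique by simp
  then show ?case using \<nu>_fib[OF A, of 0] by simp
next
  case (Suc n)
  have obj: "fob (\<tau> (Suc n)) A \<in> Obj C" using functor_obj[OF \<tau>_functor A] .
  have "rlp C (Cf \<inter> W n) \<subseteq> rlp C (Cf \<inter> W (Suc n))"
    using W_decreasing by (intro rlp_antimono) blast
  then have "tm (fob (\<tau> (Suc n)) A) \<in> rlp C (Cf \<inter> W (Suc n))" using Suc by blast
  from rlp_comp[OF \<nu>_fib[OF A] \<nu>_hom[OF A] this tm_hom[OF obj]] show ?case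
    using tm_unique[OF comp_hom[OF tm_hom[OF obj] \<nu>_hom[OF A, of "Suc n"]]] M.Cf_arr by auto
qed

lemma rlp_Cf_V: "rlp C Cf \<subseteq> V"
  using V.rlp_Cf_W by blast

lemma Ho_\<tau>_isomorphism:
  assumes f: "f \<in> V"
  shows "isomorphism H (far Ho (far (\<tau> (Suc n)) f))"
proof -
  \<comment> \<open>The family is frozen at the n-th structure, in which both objects are fibrant;
    the localization is still taken at V.\<close>
  interpret K: model_family C st tm "\<lambda>_. W n" Cf "\<lambda>_. \<alpha> n" "\<lambda>_. \<gamma> n"
    by unfold_locales (rule mss, rule pullbacks)
  have fh: "f \<in> hom (Dom C f) (Cod C f)" using f V.W_arr arr_hom by blast
  have obj: "Dom C f \<in> Obj C" "Cod C f \<in> Obj C" using hom_obj[OF fh] by auto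
  show ?thesis
    by (rule K.fibrant_weq_isomorphism[OF rlp_Cf_V V.W_arr refl \<tau>_hom(1)[OF fh] \<tau>_W[OF fh f]
          tm_\<tau>_fib[OF obj(1)] tm_\<tau>_fib[OF obj(2)]])
qed

lemma tower_part:
  obtains L \<pi> k where "is_functor C C L" "\<And>n. n \<ge> 1 \<Longrightarrow> nat_trans C C L (\<tau> n) (\<pi> n)"
    "\<And>A. A \<in> Obj C \<Longrightarrow> tower_limit C (\<lambda>n. fob (\<tau> n) A) (\<lambda>n. \<nu> n A) (fob L A) (\<lambda>n. \<pi> n A)"
    "nat_trans C C id_func L k" "\<And>n A. n \<ge> 1 \<Longrightarrow> A \<in> Obj C \<Longrightarrow> \<pi> n A \<cdot> k A = \<tau>le n A"
proof -
  obtain L \<pi> where L: "is_functor C C L" "\<And>n. n \<ge> 1 \<Longrightarrow> nat_trans C C L (\<tau> n) (\<pi> n)"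
    "\<And>A. A \<in> Obj C \<Longrightarrow> tower_limit C (\<lambda>n. fob (\<tau> n) A) (\<lambda>n. \<nu> n A) (fob L A) (\<lambda>n. \<pi> n A)"
    by (rule limit_functor[of \<tau> \<nu>, OF \<tau>_functor \<nu>_nat_trans]) (rule that)
  obtain k where "nat_trans C C id_func L k" "\<And>n A. n \<ge> 1 \<Longrightarrow> A \<in> Obj C \<Longrightarrow> \<pi> n A \<cdot> k A = \<tau>le n A"
    by (rule limit_cone_nat_trans[of \<tau> \<nu> L \<pi> \<tau>le, OF \<tau>_functor \<nu>_nat_trans L \<tau>le_nat_trans \<nu>_\<tau>le])
      (assumption | rule that)+
  with L show thesis by (rule that)
qed

text \<open>Here the family really varies: the towers are compared at level n + 1 in the n-th
  structure, and only the map of limits is examined in H.\<close>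

lemma Ho_limit_isomorphism:
  assumes L: "is_functor C C L" and \<pi>: "\<And>n. n \<ge> 1 \<Longrightarrow> nat_trans C C L (\<tau> n) (\<pi> n)"
    and lim: "\<And>A. A \<in> Obj C \<Longrightarrow> tower_limit C (\<lambda>n. fob (\<tau> n) A) (\<lambda>n. \<nu> n A) (fob L A) (\<lambda>n. \<pi> n A)"
    and f: "f \<in> V"
  shows "isomorphism H (far Ho (far L f))"
proof -
  have fh: "f \<in> hom (Dom C f) (Cod C f)" using f V.W_arr arr_hom by blast
  have A: "Dom C f \<in> Obj C" and B: "Cod C f \<in> Obj C" using hom_obj[OF fh] by auto
  show ?thesis
    by (rule limit_weq_isomorphism[OF rlp_Cf_V V.W_arr \<tau>_fibration_tower[OF A] \<tau>_fibration_tower[OF B]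
          \<tau>_tower_weq[OF fh f] lim[OF A] lim[OF B] functor_hom[OF L fh] nat_trans_sq[OF \<pi> fh]])
qed

lemma functorial_tower:
  "(\<forall>n\<ge>1. is_functor C C (\<tau> n) \<and> nat_trans C C id_func (\<tau> n) (\<tau>le n) \<and>
      nat_trans C C (\<tau> (Suc n)) (\<tau> n) (\<nu> n) \<and>
      (\<forall>A\<in>Obj C. \<nu> n A \<cdot> \<tau>le (Suc n) A = \<tau>le n A)) \<and>
   nat_trans C C (\<tau> 1) (const_func C st) (\<lambda>A. tm (fob (\<tau> 1) A)) \<and>
   (\<exists>L \<pi> k. is_functor C C L \<and> (\<forall>n\<ge>1. nat_trans C C L (\<tau> n) (\<pi> n)) \<and>
      (\<forall>A\<in>Obj C. tower_limit C (\<lambda>n. fob (\<tau> n) A) (\<lambda>n. \<nu> n A) (fob L A) (\<lambda>n. \<pi> n A)) \<and>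
      nat_trans C C id_func L k \<and> (\<forall>A\<in>Obj C. \<forall>n\<ge>1. \<pi> n A \<cdot> k A = \<tau>le n A))"
proof -
  obtain L \<pi> k where "is_functor C C L" "\<And>n. n \<ge> 1 \<Longrightarrow> nat_trans C C L (\<tau> n) (\<pi> n)"
    "\<And>A. A \<in> Obj C \<Longrightarrow> tower_limit C (\<lambda>n. fob (\<tau> n) A) (\<lambda>n. \<nu> n A) (fob L A) (\<lambda>n. \<pi> n A)"
    "nat_trans C C id_func L k" "\<And>n A. n \<ge> 1 \<Longrightarrow> A \<in> Obj C \<Longrightarrow> \<pi> n A \<cdot> k A = \<tau>le n A"
    by (rule tower_part) (rule that)
  then show ?thesis
    using \<tau>_functor \<tau>le_nat_trans \<nu>_nat_trans \<nu>_\<tau>le tm_nat_trans[OF \<tau>_functor]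
    by (intro conjI exI[of _ L] exI[of _ \<pi>] exI[of _ k] allI ballI impI) blast+
qed

lemma homotopy_tower:
  "\<exists>t h p c.
     (\<forall>n\<ge>1. is_functor H H (t n) \<and> functor_eq C (comp_func (t n) Ho) (comp_func Ho (\<tau> n)) \<and>
        (\<forall>s. is_functor H H s \<longrightarrow> functor_eq C (comp_func s Ho) (comp_func Ho (\<tau> n)) \<longrightarrow>
           functor_eq H s (t n)) \<and>
        nat_trans H H id_func (t n) (\<lambda>A. far Ho (\<tau>le n A)) \<and>
        nat_trans H H (t (Suc n)) (t n) (\<lambda>A. far Ho (\<nu> n A)) \<and>
        (\<forall>A\<in>Obj C. Cmp H (far Ho (\<nu> n A)) (far Ho (\<tau>le (Suc n) A)) = far Ho (\<tau>le n A))) \<and>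
     nat_trans H H (t 1) (const_func H st) (\<lambda>A. far Ho (tm (fob (\<tau> 1) A))) \<and>
     is_holim C V (rlp C (Cf \<inter> V)) tm \<tau> \<nu> \<tau>le h p c \<and>
     nat_trans H H id_func h c \<and>
     (\<forall>n\<ge>1. nat_trans H H h (t n) (p n) \<and>
        (\<forall>A\<in>Obj C. Cmp H (far Ho (\<nu> n A)) (p (Suc n) A) = p n A \<and>
           Cmp H (p n A) (c A) = far Ho (\<tau>le n A)))"
proof -
  obtain L \<pi> k where L: "is_functor C C L" and \<pi>: "\<And>n. n \<ge> 1 \<Longrightarrow> nat_trans C C L (\<tau> n) (\<pi> n)"
    and lim: "\<And>A. A \<in> Obj C \<Longrightarrow> tower_limit C (\<lambda>n. fob (\<tau> n) A) (\<lambda>n. \<nu> n A) (fob L A) (\<lambda>n. \<pi> n A)"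
    and k: "nat_trans C C id_func L k" and \<pi>k: "\<And>n A. n \<ge> 1 \<Longrightarrow> A \<in> Obj C \<Longrightarrow> \<pi> n A \<cdot> k A = \<tau>le n A"
    by (rule tower_part) (rule that)
  have "\<exists>t. induces t (\<tau> (Suc n))" for n
    using induces_ex[OF \<tau>_functor Ho_\<tau>_isomorphism] .
  then obtain t' where t': "\<And>n. induces (t' n) (\<tau> (Suc n))" by metis
  \<comment> \<open>Descent was shown from level 1 on; the value at 0 is a filler.\<close>
  define t where "t n = t' (n - 1)" for n
  have t: "induces (t n) (\<tau> n)" if "n \<ge> 1" for n
    using t'[of "n - 1"] that unfolding t_def by simp
  obtain h where h: "induces h L"
    using induces_ex[OF L Ho_limit_isomorphism[OF L \<pi> lim]] by blast
  define p where "p n A = far Ho (\<pi> n A)" for n A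
  define c where "c A = far Ho (k A)" for A
  note id_functor = functor_id_func[OF category]
  have kh: "k A \<in> hom A (fob L A)" if "A \<in> Obj C" for A
    using nat_trans_hom[OF k that] by (simp add: id_func_def)
  have \<pi>h: "\<pi> n A \<in> hom (fob L A) (fob (\<tau> n) A)" if "n \<ge> 1" "A \<in> Obj C" for n A
    using nat_trans_hom[OF \<pi>[OF that(1)] that(2)] .
  have \<tau>obj: "fob (\<tau> n) A \<in> Obj C" if "A \<in> Obj C" for n A
    using functor_obj[OF \<tau>_functor that] .
  have holim: "is_holim C V (rlp C (Cf \<inter> V)) tm \<tau> \<nu> \<tau>le h p c"
    unfolding is_holim_def Let_def
  \<comment> \<open>The tower serves as its own fibrant replacement: R is \<tau>, r is \<nu>, and
    the weak equivalences w are identities.\<close>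
  proof (rule conjI, rule h[unfolded induces_def, THEN conjunct1], rule exI[of _ \<tau>], rule exI[of _ \<nu>],
      rule exI[of _ "\<lambda>n A. Idn C (fob (\<tau> n) A)"], rule exI[of _ L], rule exI[of _ \<pi>], rule exI[of _ k],
      intro conjI allI ballI impI)
    show "nat_trans C C (\<tau> n) (\<tau> n) (\<lambda>A. Idn C (fob (\<tau> n) A))" for n
      using \<tau>obj id_l[OF \<tau>_hom(1)] id_r[OF \<tau>_hom(1)] by (intro nat_transI) auto
    show "functor_eq C (comp_func h Ho) (comp_func Ho L)" using induces_functor_eq[OF h] .
  next
    fix A assume A: "A \<in> Obj C"
    show "tm (fob (\<tau> 1) A) \<in> rlp C (Cf \<inter> V)" using tm_\<tau>_fib[OF A, of 0] fibs_V by auto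
    fix n :: nat assume n: "n \<ge> 1"
    show "Idn C (fob (\<tau> n) A) \<in> V" using V.W_id[OF \<tau>obj[OF A]] .
    show "\<nu> n A \<in> rlp C (Cf \<inter> V)" using \<nu>_fib[OF A] fibs_V by blast
    show "\<nu> n A \<cdot> Idn C (fob (\<tau> (Suc n)) A) = Idn C (fob (\<tau> n) A) \<cdot> \<nu> n A"
      using id_l[OF \<nu>_hom[OF A]] id_r[OF \<nu>_hom[OF A]] by simp
    show "\<pi> n A \<cdot> k A = Idn C (fob (\<tau> n) A) \<cdot> \<tau>le n A"
      using \<pi>k[OF n A] id_l[OF \<tau>le_hom[OF A]] by simp
    show "p n A \<in> homset H (fob h A) (fob (\<tau> n) A)"
      unfolding p_def using Ho_hom[OF \<pi>h[OF n A]] h A unfolding induces_def by simp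
    show "Cmp H (far Ho (Idn C (fob (\<tau> n) A))) (p n A) = far Ho (\<pi> n A)"
      unfolding p_def Ho_id[OF \<tau>obj[OF A]] using H.id_l[OF Ho_hom[OF \<pi>h[OF n A]]] .
  qed (use \<tau>_functor \<nu>_nat_trans L \<pi> lim k c_def in auto)
  have ends: "Cmp H (far Ho (\<nu> n A)) (p (Suc n) A) = p n A" "Cmp H (p n A) (c A) = far Ho (\<tau>le n A)"
    if n: "n \<ge> 1" and A: "A \<in> Obj C" for n A
  proof -
    have "\<pi> (Suc n) A \<in> hom (fob L A) (fob (\<tau> (Suc n)) A)" using \<pi>h[OF _ A] by simp
    from Ho_cmp[OF this \<nu>_hom[OF A]] show "Cmp H (far Ho (\<nu> n A)) (p (Suc n) A) = p n A"
      unfolding p_def using tower_limitD(3)[OF lim[OF A] n] by simp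
    show "Cmp H (p n A) (c A) = far Ho (\<tau>le n A)"
      unfolding p_def c_def using Ho_cmp[OF kh[OF A] \<pi>h[OF n A]] \<pi>k[OF n A] by simp
  qed
  have tower: "is_functor H H (t n) \<and> functor_eq C (comp_func (t n) Ho) (comp_func Ho (\<tau> n)) \<and>
        (\<forall>s. is_functor H H s \<longrightarrow> functor_eq C (comp_func s Ho) (comp_func Ho (\<tau> n)) \<longrightarrow>
           functor_eq H s (t n)) \<and>
        nat_trans H H id_func (t n) (\<lambda>A. far Ho (\<tau>le n A)) \<and>
        nat_trans H H (t (Suc n)) (t n) (\<lambda>A. far Ho (\<nu> n A)) \<and>
        (\<forall>A\<in>Obj C. Cmp H (far Ho (\<nu> n A)) (far Ho (\<tau>le (Suc n) A)) = far Ho (\<tau>le n A))"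
    if n: "n \<ge> 1" for n
  proof (intro conjI allI impI ballI)
    show "is_functor H H (t n)" using t[OF n] unfolding induces_def by simp
    show "functor_eq C (comp_func (t n) Ho) (comp_func Ho (\<tau> n))" using induces_functor_eq[OF t[OF n]] .
    show "functor_eq H s (t n)"
      if "is_functor H H s" "functor_eq C (comp_func s Ho) (comp_func Ho (\<tau> n))" for s
      using induces_unique[OF t[OF n] that] .
    show "nat_trans H H id_func (t n) (\<lambda>A. far Ho (\<tau>le n A))"
      using induces_nat_trans[OF induces_id t[OF n] id_functor \<tau>_functor \<tau>le_nat_trans] .
    show "nat_trans H H (t (Suc n)) (t n) (\<lambda>A. far Ho (\<nu> n A))"
      using induces_nat_trans[OF t t[OF n] \<tau>_functor \<tau>_functor \<nu>_nat_trans] by simp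
    show "Cmp H (far Ho (\<nu> n A)) (far Ho (\<tau>le (Suc n) A)) = far Ho (\<tau>le n A)" if A: "A \<in> Obj C" for A
      using Ho_cmp[OF \<tau>le_hom[OF A] \<nu>_hom[OF A]] \<nu>_\<tau>le[OF A] by simp
  qed
  have bottom: "nat_trans H H (t 1) (const_func H st) (\<lambda>A. far Ho (tm (fob (\<tau> 1) A)))"
    using induces_nat_trans[OF t induces_const[OF st_obj] \<tau>_functor const_functor tm_nat_trans[OF \<tau>_functor]]
    by simp
  have ck: "nat_trans H H id_func h c"
    using induces_nat_trans[OF induces_id h id_functor L k] unfolding c_def .
  have pt: "nat_trans H H h (t n) (p n)" if "n \<ge> 1" for n
    using induces_nat_trans[OF h t[OF that] L \<tau>_functor \<pi>[OF that]] unfolding p_def .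
  show ?thesis
    using tower bottom holim ck pt ends by blast
qed

end

section \<open>The slice tower of motivic spaces\<close>

lemma presheaves_Sm:
  assumes "grothendieck_universe \<UU>" "range enc \<in> \<UU>"
  shows "presheaves \<UU> (Sm X) enc"
  using assms by unfold_locales (auto simp: Sm_def)

text \<open>More test objects leave fewer equivalences, and a smaller set of maps leaves more local
  objects. The two reversals make the weak equivalences monotone in the set of maps, so they
  decrease when \<open>WB\<close> does.\<close>

lemma local_equivalences_antimono:
  "L \<subseteq> L' \<Longrightarrow> local_equivalences \<UU> C L' \<subseteq> local_equivalences \<UU> C L"
  unfolding local_equivalences_def by blast

lemma local_objects_subset: "local_objects C Fib S \<subseteq> Fib"
  and local_objects_antimono: "S \<subseteq> S' \<Longrightarrow> local_objects C Fib S' \<subseteq> local_objects C Fib S"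
  unfolding local_objects_def by blast+

text \<open>Codimension at least n + 2 implies codimension at least n + 1, and the other conditions
  do not depend on n.\<close>

lemma WB_decreasing: "WB X enc (Suc n) \<subseteq> WB X enc n"
proof -
  have "enat (n + 1) \<le> c" if "enat (Suc n + 1) \<le> c" for c
    using that by (rule order_trans[rotated]) simp
  then show ?thesis unfolding WB_def by blast
qed

theorem theorem3p16:
  fixes \<UU> :: "'u set set"
    and X :: "('s, 's) rspace"
    and enc :: "'s smarr option \<Rightarrow> 'u"
    and \<alpha>\<^sub>0 \<gamma>\<^sub>0 :: "('s smobj, 's smarr, 'u) psarr ffact"
    and \<alpha> \<gamma> :: "nat \<Rightarrow> ('s smobj, 's smarr, 'u) psarr ffact"
  assumes universe: "grothendieck_universe \<UU>"
    and enc: "inj enc" "range enc \<in> \<UU>"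
    and large: "infinite (UNIV :: 's set)"
    and X: "noetherian_scheme X" "separated X" "finite_dimensional X"
    and motivic: "model_structure (MM \<UU> X) (motivic_weqs \<UU> X enc)
                    (cofibrations \<UU> (Sm X)) (motivic_fibs \<UU> X enc) \<alpha>\<^sub>0 \<gamma>\<^sub>0"
    and WB: "\<And>n. model_structure (MM \<UU> X) (WB_weqs \<UU> X enc n)
                    (cofibrations \<UU> (Sm X)) (WB_fibs \<UU> X enc n) (\<alpha> n) (\<gamma> n)"
  shows
    "let M = MM \<UU> X;
         tm = bang (Sm X) enc;
         \<tau> = tau M tm \<gamma>;
         \<tau>le = tau_le tm \<gamma>;
         \<nu> = nu tm \<gamma>;
         W = motivic_weqs \<UU> X enc;
         H = localization M W;
         Ho = loc_func M W
     in
      (\<comment> \<open>the functorial tower in the model category\<close>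
       (\<forall>n\<ge>1. is_functor M M (\<tau> n) \<and>
              nat_trans M M id_func (\<tau> n) (\<tau>le n) \<and>
              nat_trans M M (\<tau> (Suc n)) (\<tau> n) (\<nu> n) \<and>
              (\<forall>A\<in>Obj M. Cmp M (\<nu> n A) (\<tau>le (Suc n) A) = \<tau>le n A)) \<and>
       nat_trans M M (\<tau> 1) (const_func M (star enc)) (\<lambda>A. tm (fob (\<tau> 1) A)) \<and>
       (\<exists>L \<pi> k. is_functor M M L \<and> (\<forall>n\<ge>1. nat_trans M M L (\<tau> n) (\<pi> n)) \<and>
          (\<forall>A\<in>Obj M. tower_limit M (\<lambda>n. fob (\<tau> n) A) (\<lambda>n. \<nu> n A) (fob L A) (\<lambda>n. \<pi> n A)) \<and>
          nat_trans M M id_func L k \<and>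
          (\<forall>A\<in>Obj M. \<forall>n\<ge>1. Cmp M (\<pi> n A) (k A) = \<tau>le n A)))
      \<and>
      (\<comment> \<open>the functorial tower in the homotopy category\<close>
       \<exists>t h p c.
         (\<forall>n\<ge>1. is_functor H H (t n) \<and>
                functor_eq M (comp_func (t n) Ho) (comp_func Ho (\<tau> n)) \<and>
                (\<forall>s. is_functor H H s \<longrightarrow> functor_eq M (comp_func s Ho) (comp_func Ho (\<tau> n)) \<longrightarrow>
                     functor_eq H s (t n)) \<and>
                nat_trans H H id_func (t n) (\<lambda>A. far Ho (\<tau>le n A)) \<and>
                nat_trans H H (t (Suc n)) (t n) (\<lambda>A. far Ho (\<nu> n A)) \<and>
                (\<forall>A\<in>Obj M. Cmp H (far Ho (\<nu> n A)) (far Ho (\<tau>le (Suc n) A)) = far Ho (\<tau>le n A))) \<and>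
         nat_trans H H (t 1) (const_func H (star enc)) (\<lambda>A. far Ho (tm (fob (\<tau> 1) A))) \<and>
         is_holim M W (motivic_fibs \<UU> X enc) tm \<tau> \<nu> \<tau>le h p c \<and>
         nat_trans H H id_func h c \<and>
         (\<forall>n\<ge>1. nat_trans H H h (t n) (p n) \<and>
                (\<forall>A\<in>Obj M. Cmp H (far Ho (\<nu> n A)) (p (Suc n) A) = p n A \<and>
                           Cmp H (p n A) (c A) = far Ho (\<tau>le n A))))
      \<and>
      (\<comment> \<open>weak equivalences and fibrations in the localizations\<close>
       \<forall>A\<in>Obj M.
         (\<forall>n\<ge>1. \<tau>le n A \<in> WB_weqs \<UU> X enc (n - 1) \<and> \<nu> n A \<in> WB_fibs \<UU> X enc n) \<and>
         tm (fob (\<tau> 1) A) \<in> WB_fibs \<UU> X enc 0)"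
proof -
  interpret P: presheaves \<UU> "Sm X" enc
    by (rule presheaves_Sm[OF universe enc(2)])
  \<comment> \<open>The locale expects fibrations as lifting classes, which here is their definition
    unfolded.\<close>
  have fibs: "WB_fibs \<UU> X enc n = rlp (MM \<UU> X) (cofibrations \<UU> (Sm X) \<inter> WB_weqs \<UU> X enc n)" for n
    unfolding WB_fibs_def fibrations_def ..
  have fibs0: "motivic_fibs \<UU> X enc = rlp (MM \<UU> X) (cofibrations \<UU> (Sm X) \<inter> motivic_weqs \<UU> X enc)"
    unfolding motivic_fibs_def fibrations_def ..
  interpret S: slice_model "MM \<UU> X" "star enc" "bang (Sm X) enc" "WB_weqs \<UU> X enc"
    "cofibrations \<UU> (Sm X)" \<alpha> \<gamma> "motivic_weqs \<UU> X enc" \<alpha>\<^sub>0 \<gamma>\<^sub>0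
  proof unfold_locales
    show "category (MM \<UU> X)" by (rule P.psh_category)
    show "bang (Sm X) enc A \<in> homset (MM \<UU> X) A (star enc)" if "A \<in> Obj (MM \<UU> X)" for A
      using P.bang_hom[OF that] .
    show "f = bang (Sm X) enc A" if "f \<in> homset (MM \<UU> X) A (star enc)" for f A
      using P.bang_unique[OF that] .
    show "star enc \<in> Obj (MM \<UU> X)" by (rule P.star_Obj)
    show "\<exists>L \<pi>. tower_limit (MM \<UU> X) T d L \<pi>"
      if "\<And>n. n \<ge> 1 \<Longrightarrow> d n \<in> homset (MM \<UU> X) (T (Suc n)) (T n)" for T d
      using that by (rule P.tower_limit_exists)
    show "\<exists>P p q. is_pullback (MM \<UU> X) f g P p q"
      if "f \<in> homset (MM \<UU> X) A D" "g \<in> homset (MM \<UU> X) B D" for f g A B D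
      using P.pullback_exists[OF that] .
    show "motivic_weqs \<UU> X enc \<subseteq> WB_weqs \<UU> X enc n" for n
      unfolding motivic_weqs_def WB_weqs_def
      by (rule local_equivalences_antimono[OF local_objects_subset])
    show "WB_weqs \<UU> X enc (Suc n) \<subseteq> WB_weqs \<UU> X enc n" for n
      unfolding WB_weqs_def
      by (rule local_equivalences_antimono[OF local_objects_antimono[OF WB_decreasing]])
  qed (use WB motivic fibs fibs0 in simp_all)
  \<comment> \<open>The theorem counts levels from n = 1 with structure n - 1, whereas
    \<open>S.\<tau>le_W\<close> speaks of level \<open>Suc n\<close> and structure n.\<close>
  have weqs: "tau_le (bang (Sm X) enc) \<gamma> n A \<in> WB_weqs \<UU> X enc (n - 1)"
    if "A \<in> Obj (MM \<UU> X)" "n \<ge> 1" for n A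
    using S.\<tau>le_W[OF that(1), of "n - 1"] that(2) by simp
  show ?thesis
    unfolding Let_def fibs fibs0
    using S.functorial_tower S.homotopy_tower weqs S.\<nu>_fib S.tm_\<tau>_fib[of _ 0]
    by (intro conjI) simp_all
qed

end
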